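(* Let $0<p<\infty$, $0<q\leq\infty$, $\alpha>-1$, and let $\{X_n\}_{n\ge1}$ be a standard random sequence. Then $(\mathscr{H}^{p,q}_\alpha)_\star=\mathscr{H}^{2,q}_\alpha$. In particular, $(\mathscr{H}^p)_\star=\mathscr{H}^2$ and $(\mathcal{A}^p_\alpha)_\star=\mathscr{H}^{2,p}_\alpha$.
   Context: A standard random sequence $\{X_n\}$ is a sequence of independent identically distributed random variables on a probability space, all of one of the following three types: Bernoulli ($\mathbb{P}(X_n=1)=\mathbb{P}(X_n=-1)=1/2$), Steinhaus (uniformly distributed on the unit circle), or Gaussian $N(0,1)$ (zero mean, unit variance). For $\theta\in\mathbb{R}$ let $\mathbb{C}_\theta=\{s\in\mathbb{C}:\Re s>\theta\}$. $\mathcal{D}$ is the space of Dirichlet series $\sum_{n\ge1}a_nn^{-s}$ ($a_n\in\mathbb{C}$) converging on some half plane $\mathbb{C}_\theta$, and $\mathcal{P}$ is the space of Dirichlet polynomials $\sum_{n=1}^Na_nn^{-s}$. For $f(s)=\sum_{n\ge1}a_nn^{-s}$ in $\mathcal{D}$, the randomization is $\mathcal{R}f(s)=\sum_{n\ge1}a_nX_nn^{-s}$. For a (quasi-)Banach space $\mathscr{X}\subset\mathcal{D}$ containing all Dirichlet polynomials, the symbol space is $\mathscr{X}_\star=\{f\in\mathcal{D}:\mathbb{P}(\mathcal{R}f\in\mathscr{X})=1\}$. Let $p_j$ be the $j$th prime and write $n=\prod_j p_j^{\nu_j(n)}$. The Bohr lift of $P(s)=\sum_{n=1}^N a_nn^{-s}$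 is $\mathscr{B}P(z)=\sum_{n=1}^N a_nz^{\nu(n)}$, where $z=(z_1,z_2,\dots)$ and $z^{\nu(n)}=\prod_jz_j^{\nu_j(n)}$. For $0<p<\infty$, $\mathscr{H}^p$ is the completion of $\mathcal{P}$ with respect to the (quasi-)norm $\|P\|_{\mathscr{H}^p}=\left(\int_{\mathbb{T}^\infty}|\mathscr{B}P(z)|^p\,dm_\infty(z)\right)^{1/p}$, where $m_\infty$ is the Haar probability measure on the infinite torus $\mathbb{T}^\infty$. For $\sigma\ge0$, $P_\sigma(s)=P(s+\sigma)$. For $0<p,q<\infty$ and $\alpha>-1$, the mixed norm space $\mathscr{H}^{p,q}_\alpha$ is the completion of $\mathcal{P}$ with respect to the (quasi-)norm $\|P\|_{\mathscr{H}^{p,q}_\alpha}=\left(\int_0^{+\infty}\|P_\sigma\|_{\mathscr{H}^p}^q\,d\mu_\alpha(\sigma)\right)^{1/q}$, where $d\mu_\alpha(\sigma)=\frac{2^{\alpha+1}}{\Gamma(\alpha+1)}\sigma^\alpha e^{-2\sigma}d\sigma$. By convention $\mathscr{H}^{p,\infty}_\alpha=\mathscr{H}^p$. The Bergman space is $\mathcal{A}^p_\alpha=\mathscr{H}^{p,p}_\alpha$. Elements of all these spaces are identified with Dirichlet series in $\mathcal{D}$ converging on $\mathbb{C}_{1/2}$. *)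

theory Defs
  imports "HOL-Probability.Probability" "HOL-Computational_Algebra.Computational_Algebra"
begin

text \<open>
  A Dirichlet series is represented by its coefficient sequence \<open>a\<close>, where \<open>a n\<close> is the
  coefficient of \<open>n\<^sup>-\<^sup>s\<close> for \<open>n \<ge> 1\<close>. The meaningless entry \<open>a 0\<close> is normalised to \<open>0\<close>, so
  that equality of series is equality of functions.
\<close>

definition half_plane :: "real \<Rightarrow> complex set" where
  "half_plane \<theta> = {s. Re s > \<theta>}"

definition dirichlet_converges_on :: "(nat \<Rightarrow> complex) \<Rightarrow> complex set \<Rightarrow> bool" where
  "dirichlet_converges_on a S \<longleftrightarrow> (\<forall>s\<in>S. summable (\<lambda>n. a n * of_nat n powr (- s)))"

definition dirichlet_series :: "(nat \<Rightarrow> complex) set" where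
  "dirichlet_series = {a. a 0 = 0 \<and> (\<exists>\<theta>. dirichlet_converges_on a (half_plane \<theta>))}"

definition dirichlet_polys :: "(nat \<Rightarrow> complex) set" where
  "dirichlet_polys = {a. a 0 = 0 \<and> (\<exists>N. \<forall>n>N. a n = 0)}"

text \<open>The coefficients of \<open>s \<mapsto> P (s + \<sigma>)\<close>.\<close>

definition dshift :: "real \<Rightarrow> (nat \<Rightarrow> complex) \<Rightarrow> nat \<Rightarrow> complex" where
  "dshift \<sigma> a = (\<lambda>n. a n * of_nat n powr (- of_real \<sigma>))"

text \<open>Primes and coordinates of points of the torus are numbered from \<open>0\<close>: \<open>nth_prime 0 = 2\<close>.\<close>

definition nth_prime :: "nat \<Rightarrow> nat" where
  "nth_prime = enumerate {p. prime p}"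

definition prime_exponent :: "nat \<Rightarrow> nat \<Rightarrow> nat" where
  "prime_exponent j n = multiplicity (nth_prime j) n"

definition bohr_monomial :: "(nat \<Rightarrow> complex) \<Rightarrow> nat \<Rightarrow> complex" where
  "bohr_monomial z n = (\<Prod>j | prime_exponent j n \<noteq> 0. z j ^ prime_exponent j n)"

definition bohr_lift :: "(nat \<Rightarrow> complex) \<Rightarrow> (nat \<Rightarrow> complex) \<Rightarrow> complex" where
  "bohr_lift a z = (\<Sum>n | a n \<noteq> 0. a n * bohr_monomial z n)"

definition circle_measure :: "complex measure" where
  "circle_measure = distr (uniform_measure lborel {0..2 * pi}) borel cis"

text \<open>
  The Haar probability measure of the compact group \<open>\<T>\<^sup>\<infinity>\<close> is the countable product of the
  normalised arc length measures; it is carried by the sequences of unimodular numbers.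
\<close>

definition torus_measure :: "(nat \<Rightarrow> complex) measure" where
  "torus_measure = (\<Pi>\<^sub>M j\<in>UNIV. circle_measure)"

definition hardy_norm :: "real \<Rightarrow> (nat \<Rightarrow> complex) \<Rightarrow> real" where
  "hardy_norm p a = (LINT z|torus_measure. cmod (bohr_lift a z) powr p) powr (1 / p)"

definition mu_measure :: "real \<Rightarrow> real measure" where
  "mu_measure \<alpha> = density lborel
     (\<lambda>\<sigma>. ennreal (indicator {0<..} \<sigma> *
        (2 powr (\<alpha> + 1) / Gamma (\<alpha> + 1) * \<sigma> powr \<alpha> * exp (- 2 * \<sigma>))))"

definition mixed_norm :: "real \<Rightarrow> real \<Rightarrow> real \<Rightarrow> (nat \<Rightarrow> complex) \<Rightarrow> real" where
  "mixed_norm p q \<alpha> a =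
     (LINT \<sigma>|mu_measure \<alpha>. hardy_norm p (dshift \<sigma> a) powr q) powr (1 / q)"

text \<open>
  The completion of the Dirichlet polynomials for a (quasi-)norm \<open>N\<close>, realised inside the
  Dirichlet series converging on \<open>\<complex>\<^bsub>1/2\<^esub>\<close>: the class of a Cauchy sequence of polynomials is
  identified with the series whose coefficients are the limits of the coefficients of these
  polynomials. For the two norms above the coefficient functionals are bounded, so these limits exist.
\<close>

definition dirichlet_completion :: "((nat \<Rightarrow> complex) \<Rightarrow> real) \<Rightarrow> (nat \<Rightarrow> complex) set" where
  "dirichlet_completion N = {a \<in> dirichlet_series.
     dirichlet_converges_on a (half_plane (1/2)) \<and>
     (\<exists>P. (\<forall>k. P k \<in> dirichlet_polys) \<and>
          (\<forall>\<epsilon>>0. \<exists>K. \<forall>k\<ge>K. \<forall>l\<ge>K. N (\<lambda>n. P k n - P l n) < \<epsilon>) \<and>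
          (\<forall>n. (\<lambda>k. P k n) \<longlonglongrightarrow> a n))}"

definition hardy_space :: "real \<Rightarrow> (nat \<Rightarrow> complex) set" where
  "hardy_space p = dirichlet_completion (hardy_norm p)"

definition mixed_space :: "real \<Rightarrow> ereal \<Rightarrow> real \<Rightarrow> (nat \<Rightarrow> complex) set" where
  "mixed_space p q \<alpha> = (if q = \<infinity> then hardy_space p
     else dirichlet_completion (mixed_norm p (real_of_ereal q) \<alpha>))"

definition bergman_space :: "real \<Rightarrow> real \<Rightarrow> (nat \<Rightarrow> complex) set" where
  "bergman_space p \<alpha> = mixed_space p (ereal p) \<alpha>"

definition bernoulli_rv :: "'w measure \<Rightarrow> ('w \<Rightarrow> complex) \<Rightarrow> bool" where
  "bernoulli_rv M Y \<longleftrightarrow>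
     measure M {\<omega> \<in> space M. Y \<omega> = 1} = 1/2 \<and> measure M {\<omega> \<in> space M. Y \<omega> = - 1} = 1/2"

definition steinhaus_rv :: "'w measure \<Rightarrow> ('w \<Rightarrow> complex) \<Rightarrow> bool" where
  "steinhaus_rv M Y \<longleftrightarrow> distr M borel Y = circle_measure"

text \<open>The Gaussian variables are real, hence the embedding into the complex numbers.\<close>

definition gaussian_rv :: "'w measure \<Rightarrow> ('w \<Rightarrow> complex) \<Rightarrow> bool" where
  "gaussian_rv M Y \<longleftrightarrow>
     distr M borel Y = distr (density lborel (\<lambda>x. ennreal (std_normal_density x))) borel complex_of_real"

definition standard_random_sequence :: "'w measure \<Rightarrow> (nat \<Rightarrow> 'w \<Rightarrow> complex) \<Rightarrow> bool" where
  "standard_random_sequence M X \<longleftrightarrow>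
     prob_space M \<and> prob_space.indep_vars M (\<lambda>_. borel) X {1..} \<and>
     ((\<forall>n\<ge>1. bernoulli_rv M (X n)) \<or> (\<forall>n\<ge>1. steinhaus_rv M (X n)) \<or> (\<forall>n\<ge>1. gaussian_rv M (X n)))"

definition randomize ::
    "(nat \<Rightarrow> 'w \<Rightarrow> complex) \<Rightarrow> (nat \<Rightarrow> complex) \<Rightarrow> 'w \<Rightarrow> nat \<Rightarrow> complex" where
  "randomize X a \<omega> = (\<lambda>n. a n * X n \<omega>)"

definition symbol_space ::
    "'w measure \<Rightarrow> (nat \<Rightarrow> 'w \<Rightarrow> complex) \<Rightarrow> (nat \<Rightarrow> complex) set \<Rightarrow> (nat \<Rightarrow> complex) set" where
  "symbol_space M X S = {a \<in> dirichlet_series. AE \<omega> in M. randomize X a \<omega> \<in> S}"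

end

theory Submission
  imports Defs "HOL-Complex_Analysis.Complex_Analysis"
begin

text \<open>
  A series \<open>f\<close> with coefficients \<open>a\<^sub>n\<close> lies in \<open>H\<^sup>2\<^sup>,\<^sup>q\<close> exactly when the partial sums of
  \<open>\<Sum> \<bar>a\<^sub>n\<bar>\<^sup>2 n\<^sup>-\<^sup>2\<^sup>\<sigma>\<close>, raised to the power \<open>q/2\<close>, have bounded integrals in \<open>\<sigma>\<close>.
  If they do, Khintchine's inequality at each \<open>\<sigma>\<close> and each point of the torus bounds the expected
  norms of the blocks of the randomized series, and a rapidly convergent subsequence of its partial
  sums is almost surely Cauchy.

  Conversely, let the randomized series almost surely lie in the space. With probability close to
  \<open>1\<close> it is then a coefficientwise limit of polynomials of bounded norm. The same holds after flipping
  the signs of the coefficients beyond \<open>N\<close>, which does not change the law; averaging both and using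
  that the norm is lower semicontinuous for coefficientwise convergence, the \<open>N\<close>-th partial
  sum has bounded norm with probability close to \<open>1\<close>, uniformly in \<open>N\<close>. By the Paley--Zygmund
  inequality and Fubini this bounds the integrals above. Lower semicontinuity for \<open>p < 1\<close>
  rests on the subharmonicity of \<open>\<bar>f\<bar>\<^sup>p\<close> along the slices \<open>\<zeta> \<mapsto> (\<zeta>\<^sup>2 z\<^sub>1, \<zeta>\<^sup>3 z\<^sub>2, \<zeta>\<^sup>5 z\<^sub>3, \<dots>)\<close>.
\<close>

section \<open>Inequalities and limits\<close>

text \<open>The obstacle is the range p < 1: the spaces are then only quasi-normed, convexity
  arguments such as duality or averaging against a kernel fail, and even lower semicontinuity on
  polynomials needs function theory. The exponents of \<zeta> in a slice are the primes, not all 1,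
  because the n-th monomial then picks up \<zeta> to a weight that only finitely many n share: the
  terms of low weight converge along with their coefficients, and those of high weight carry a high
  power of \<zeta>. In the converse, p may be replaced by \<open>min p 1\<close>, since Hardy norms
  increase with p and the conclusion does not involve p; for exponents at most 1 the p-th power of
  the norm is subadditive. Flipping signs stands in for a maximal inequality: the average of the
  series and its flipped copy is exactly the N-th partial sum.\<close>

lemma powr_add_le:
  fixes x y p :: real
  assumes "0 \<le> x" "0 \<le> y" "0 < p" "p \<le> 1"
  shows "(x + y) powr p \<le> x powr p + y powr p"
proof (cases "x + y = 0")
  case False
  with assms have pos: "0 < x + y" by simp
  \<comment> \<open>Any u between 0 and x + y splits as u^(1-p) u^p, and the first factor is at most
    (x+y)^(1-p). Adding the cases u = x and u = y leaves a common positive factor to cancel.\<close>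
  have le: "u \<le> (x + y) powr (1 - p) * u powr p" if "0 \<le> u" "u \<le> x + y" for u
  proof (cases "u = 0")
    case False
    then have "u = u powr (1 - p) * u powr p"
      using that by (simp flip: powr_add)
    also have "\<dots> \<le> (x + y) powr (1 - p) * u powr p"
      using that assms by (intro mult_right_mono powr_mono2) auto
    finally show ?thesis .
  qed simp
  have "x + y \<le> (x + y) powr (1 - p) * (x powr p + y powr p)"
    using le[of x] le[of y] assms by (simp add: distrib_left)
  moreover have "(x + y) powr (1 - p) * (x + y) powr p = x + y"
    using pos by (simp flip: powr_add)
  ultimately have "(x + y) powr (1 - p) * (x + y) powr p \<le> (x + y) powr (1 - p) * (x powr p + y powr p)"
    by simp
  then show ?thesis
    using pos by simp
qed (use assms in auto)

lemma powr_add_le_two_powr: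
  fixes x y p :: real
  assumes "0 \<le> x" "0 \<le> y" "0 < p"
  shows "(x + y) powr p \<le> 2 powr p * (x powr p + y powr p)"
proof -
  have "(x + y) powr p \<le> (2 * max x y) powr p"
    using assms by (intro powr_mono2) auto
  also have "\<dots> = 2 powr p * max x y powr p"
    using assms by (simp add: powr_mult)
  also have "max x y powr p \<le> x powr p + y powr p"
    by (auto simp: max_def)
  finally show ?thesis by simp
qed

lemma tendsto_ennreal_powr_zero:
  assumes "f \<longlonglongrightarrow> 0" "\<And>k. 0 \<le> f k" "0 < p"
  shows "(\<lambda>k. ennreal (f k powr p)) \<longlonglongrightarrow> 0"
proof -
  have "(\<lambda>k. f k powr p) \<longlonglongrightarrow> 0 powr p"
    using assms by (intro tendsto_powr' tendsto_const) auto
  then show ?thesis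
    using tendsto_ennrealI by fastforce
qed

text \<open>Function types carry the product topology, so topological closures can stand for
  coefficientwise limits.\<close>

lemma tendsto_fun_iff:
  fixes f :: "nat \<Rightarrow> 'i \<Rightarrow> 'a::topological_space"
  shows "f \<longlonglongrightarrow> l \<longleftrightarrow> (\<forall>i. (\<lambda>k. f k i) \<longlonglongrightarrow> l i)"
  using limitin_componentwise[of "\<lambda>_::'i. euclidean :: 'a topology" UNIV f l sequentially]
  by (simp add: euclidean_product_topology)

text \<open>Jensen's inequality for the concave function u^s. The tangent is taken at the given
  bound L rather than at the mean, so an upper bound on the mean suffices.\<close>

lemma (in prob_space) nn_integral_powr_le:
  assumes [measurable]: "f \<in> borel_measurable M" and f: "\<And>x. 0 \<le> f x" and s: "0 < s" "s \<le> 1"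
    and L: "0 \<le> L" "(\<integral>\<^sup>+x. ennreal (f x) \<partial>M) \<le> ennreal L"
  shows "(\<integral>\<^sup>+x. ennreal (f x powr s) \<partial>M) \<le> ennreal (L powr s)"
proof (cases "L = 0")
  case True
  then have "AE x in M. f x = 0"
    using L f by (simp add: nn_integral_0_iff_AE)
  then have "(\<integral>\<^sup>+x. ennreal (f x powr s) \<partial>M) = (\<integral>\<^sup>+x. 0 \<partial>M)"
    by (intro nn_integral_cong_AE) (auto elim!: eventually_mono)
  then show ?thesis by simp
next
  case False
  with L have "0 < L" by simp
  define c where "c = s * L powr (s - 1)"
  have "0 \<le> c" using s by (simp add: c_def)
  \<comment> \<open>Young's inequality u^s L^(1-s) \<le> s u + (1-s) L, divided by L^(1-s), is the
    tangent line at L.\<close>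
  have tangent: "u powr s \<le> c * u + (1 - s) * L powr s" if "0 \<le> u" for u
  proof (cases "u = 0")
    case False
    with that have "0 < u" by simp
    have "u powr s = (u powr s * L powr (1 - s)) * L powr (s - 1)"
      using \<open>0 < L\<close> by (simp add: mult.assoc flip: powr_add)
    also have "\<dots> \<le> (s * u + (1 - s) * L) * L powr (s - 1)"
      using Youngs_inequality_0[of s "1 - s" u L] s \<open>0 < u\<close> \<open>0 < L\<close> by (intro mult_right_mono) auto
    also have "\<dots> = c * u + (1 - s) * (L powr 1 * L powr (s - 1))"
      using \<open>0 < L\<close> by (simp add: c_def algebra_simps)
    also have "L powr 1 * L powr (s - 1) = L powr s"
      unfolding powr_add[symmetric] by simp
    finally show ?thesis .
  qed (use s in simp)
  have "(\<integral>\<^sup>+x. ennreal (f x powr s) \<partial>M) \<le> (\<integral>\<^sup>+x. ennreal c * ennreal (f x) + ennreal ((1 - s) * L powr s) \<partial>M)"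
    using tangent[OF f] f s \<open>0 \<le> c\<close>
    by (intro nn_integral_mono) (simp add: ennreal_leI flip: ennreal_plus ennreal_mult)
  also have "\<dots> = ennreal c * (\<integral>\<^sup>+x. ennreal (f x) \<partial>M) + ennreal ((1 - s) * L powr s)"
    by (simp add: nn_integral_add nn_integral_cmult emeasure_space_1)
  also have "\<dots> \<le> ennreal c * ennreal L + ennreal ((1 - s) * L powr s)"
    by (intro add_mono mult_left_mono L order_refl) auto
  also have "\<dots> = ennreal (s * (L powr (s - 1) * L powr 1) + (1 - s) * L powr s)"
    using L s \<open>0 \<le> c\<close> by (simp add: c_def mult.assoc flip: ennreal_plus ennreal_mult)
  also have "L powr (s - 1) * L powr 1 = L powr s"
    unfolding powr_add[symmetric] by simp
  finally show ?thesis by (simp add: algebra_simps)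
qed

section \<open>Prime exponents and the Bohr lift\<close>

lemma prime_nth_prime: "prime (nth_prime j)"
  using enumerate_in_set[OF primes_infinite, of j] by (simp add: nth_prime_def)

lemma inj_nth_prime: "inj nth_prime"
  unfolding nth_prime_def by (rule strict_mono_imp_inj_on[OF strict_mono_enumerate[OF primes_infinite]])

lemma nth_prime_surj: "prime p \<Longrightarrow> \<exists>j. nth_prime j = p"
  using enumerate_Ex[of "{p. prime p}" p] primes_infinite by (auto simp: nth_prime_def)

lemma prime_exponent_pos_iff: "0 < prime_exponent j n \<longleftrightarrow> n \<noteq> 0 \<and> nth_prime j dvd n"
  unfolding prime_exponent_def using prime_nth_prime[of j]
  by (metis gr0I less_numeral_extra(3) multiplicity_eq_zero_iff multiplicity_zero not_prime_unit)

lemma finite_prime_exponent: "finite {j. prime_exponent j n \<noteq> 0}"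
proof (cases "n = 0")
  case False
  have "{j. prime_exponent j n \<noteq> 0} = nth_prime -` {p. p dvd n}"
    using False by (auto simp: prime_exponent_pos_iff)
  moreover have "finite (nth_prime -` {p. p dvd n})"
    using False by (intro finite_vimageI inj_nth_prime) simp
  ultimately show ?thesis
    by simp
qed (simp add: prime_exponent_def)

lemma prod_prime_exponent:
  assumes "n > 0"
  shows "(\<Prod>j | prime_exponent j n \<noteq> 0. nth_prime j ^ prime_exponent j n) = n"
proof -
  have bij: "bij_betw nth_prime {j. prime_exponent j n \<noteq> 0} (prime_factors n)"
  proof (rule bij_betwI')
    show "(nth_prime x = nth_prime y) = (x = y)" for x y
      using inj_nth_prime by (auto dest: injD)
    show "nth_prime x \<in> prime_factors n" if "x \<in> {j. prime_exponent j n \<noteq> 0}" for x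
      using that prime_nth_prime[of x] assms
      by (auto simp: in_prime_factors_iff prime_exponent_pos_iff)
    show "\<exists>x\<in>{j. prime_exponent j n \<noteq> 0}. p = nth_prime x" if "p \<in> prime_factors n" for p
      using that nth_prime_surj[of p] by (auto simp: in_prime_factors_iff prime_exponent_pos_iff)
  qed
  have "(\<Prod>j | prime_exponent j n \<noteq> 0. nth_prime j ^ prime_exponent j n)
      = (\<Prod>p\<in>prime_factors n. p ^ multiplicity p n)"
    unfolding prime_exponent_def[of _ n]
    using prod.reindex_bij_betw[OF bij, of "\<lambda>p. p ^ multiplicity p n"]
    by (simp add: prime_exponent_def)
  also have "\<dots> = n"
    using prime_factorization_nat[of n] assms by simp
  finally show ?thesis .
qed

lemma prime_exponent_inject:
  assumes "n > 0" "m > 0" "\<And>j. prime_exponent j n = prime_exponent j m"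
  shows "n = m"
  using prod_prime_exponent[OF assms(1)] prod_prime_exponent[OF assms(2)] assms(3) by simp

text \<open>The degree of \<open>bohr_monomial z n\<close> when the j-th variable has degree
  \<open>nth_prime j\<close>. If every variable had degree 1, all primes would share one degree;
  here each degree is attained by finitely many n only.\<close>

definition prime_weight :: "nat \<Rightarrow> nat" where
  "prime_weight n = (\<Sum>j | prime_exponent j n \<noteq> 0. nth_prime j * prime_exponent j n)"

text \<open>From x \<le> 2^x for each prime factor. Its purpose is that a bound on the weight bounds
  n.\<close>

lemma le_two_power_prime_weight:
  assumes "n > 0"
  shows "n \<le> 2 ^ prime_weight n"
proof -
  have "n = (\<Prod>j | prime_exponent j n \<noteq> 0. nth_prime j ^ prime_exponent j n)"
    using prod_prime_exponent[OF assms] by simp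
  also have "\<dots> \<le> (\<Prod>j | prime_exponent j n \<noteq> 0. (2 ^ nth_prime j) ^ prime_exponent j n)"
    by (intro prod_mono conjI power_mono) (auto intro: less_imp_le)
  also have "\<dots> = 2 ^ prime_weight n"
    by (simp add: prime_weight_def power_sum power_mult)
  finally show ?thesis .
qed

lemma finite_prime_weight_le: "finite {n. n > 0 \<and> prime_weight n \<le> L}"
proof (rule finite_subset)
  show "{n. n > 0 \<and> prime_weight n \<le> L} \<subseteq> {..2 ^ L}"
  proof safe
    fix n assume "n > 0" "prime_weight n \<le> L"
    then have "n \<le> 2 ^ prime_weight n" "(2::nat) ^ prime_weight n \<le> 2 ^ L"
      by (auto intro: le_two_power_prime_weight power_increasing)
    then show "n \<le> 2 ^ L" by linarith
  qed
qed simp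

lemma bohr_monomial_mult:
  "bohr_monomial (\<lambda>j. u j * z j) n = bohr_monomial u n * bohr_monomial z n"
  by (simp add: bohr_monomial_def power_mult_distrib prod.distrib)

lemma bohr_monomial_weight: "bohr_monomial (\<lambda>j. w ^ nth_prime j) n = w ^ prime_weight n"
  by (simp add: bohr_monomial_def prime_weight_def power_sum power_mult)

lemma norm_bohr_monomial:
  assumes "\<And>j. norm (z j) = 1"
  shows "norm (bohr_monomial z n) = 1"
  by (simp add: bohr_monomial_def norm_power assms flip: prod_norm)

text \<open>Twisting the coefficients by the monomials at a point of the torus keeps their square
  sum, so the probabilistic estimates hold with constants independent of z.\<close>

lemma sum_norm_sq_unimodular:
  assumes "\<And>j. norm (z j) = 1"
  shows "(\<Sum>n\<in>F. (norm (b n * bohr_monomial z n))\<^sup>2) = (\<Sum>n\<in>F. (norm (b n))\<^sup>2)"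
  by (simp add: norm_mult norm_bohr_monomial[OF assms])

lemma measurable_bohr_monomial[measurable]:
  "(\<lambda>z. bohr_monomial z n) \<in> borel_measurable (\<Pi>\<^sub>M j\<in>UNIV. borel)"
  unfolding bohr_monomial_def by measurable

lemma bohr_lift_eq:
  assumes "finite F" "\<And>n. n \<notin> F \<Longrightarrow> a n = 0"
  shows "bohr_lift a z = (\<Sum>n\<in>F. a n * bohr_monomial z n)"
  unfolding bohr_lift_def using assms by (intro sum.mono_neutral_left) auto

section \<open>Rotation invariance\<close>

lemma measurable_cis[measurable]: "cis \<in> borel_measurable borel"
  by (intro borel_measurable_continuous_onI continuous_intros)

lemma prob_space_circle_measure: "prob_space circle_measure"
  unfolding circle_measure_def
  by (intro prob_space.prob_space_distr prob_space_uniform_measure) auto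

lemma sets_circle_measure[simp, measurable_cong]: "sets circle_measure = sets borel"
  by (simp add: circle_measure_def)

lemma space_circle_measure[simp]: "space circle_measure = UNIV"
  by (simp add: circle_measure_def)

lemma nn_integral_circle_measure:
  assumes [measurable]: "f \<in> borel_measurable borel"
  shows "(\<integral>\<^sup>+z. f z \<partial>circle_measure) = (\<integral>\<^sup>+t. f (cis t) * indicator {0..2*pi} t \<partial>lborel) / ennreal (2 * pi)"
  unfolding circle_measure_def
  by (subst nn_integral_distr) (auto simp: nn_integral_uniform_measure)

lemma AE_circle_norm: "AE z in circle_measure. norm z = 1"
  unfolding circle_measure_def
  by (subst AE_distr_iff) auto

text \<open>With w = cis s the rotated integral runs over [s, s + 2 pi]; the piece beyond 2 pi is
  moved back to [0, s] by periodicity, the cut points being null sets.\<close>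

lemma nn_integral_circle_rotate:
  assumes [measurable]: "f \<in> borel_measurable borel" and w: "norm w = 1"
  shows "(\<integral>\<^sup>+z. f (w * z) \<partial>circle_measure) = (\<integral>\<^sup>+z. f z \<partial>circle_measure)"
proof -
  define s where "s = Arg2pi w"
  have s: "w = cis s" "0 \<le> s" "s < 2 * pi"
    using w Arg2pi[of w] unfolding is_Arg_def by (auto simp: s_def cis_conv_exp)
  define g where "g u = f (cis u)" for u
  have [measurable]: "g \<in> borel_measurable borel"
    unfolding g_def by measurable
  have periodic: "g (u + 2 * pi) = g u" for u
    by (simp add: g_def flip: cis_mult)
  have null: "AE t in lborel. t \<noteq> c" for c :: real
    by (rule AE_lborel_singleton)
  have "(\<integral>\<^sup>+t. f (w * cis t) * indicator {0..2*pi} t \<partial>lborel)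
      = (\<integral>\<^sup>+t. g (s + t) * indicator {0..2*pi} t \<partial>lborel)"
    by (simp add: s g_def cis_mult)
  also have "\<dots> = (\<integral>\<^sup>+u. g u * indicator {s..s + 2*pi} u \<partial>lborel)"
    by (subst nn_integral_real_affine[of "\<lambda>u. g u * indicator {s..s + 2*pi} u" 1 s])
       (auto intro!: nn_integral_cong simp: indicator_def)
  also have "\<dots> = (\<integral>\<^sup>+u. g u * indicator {s..2*pi} u + g u * indicator {2*pi..s + 2*pi} u \<partial>lborel)"
    using null[of "2*pi"] s(2,3) by (intro nn_integral_cong_AE) (auto elim!: eventually_mono simp: indicator_def split: if_splits)
  also have "\<dots> = (\<integral>\<^sup>+u. g u * indicator {s..2*pi} u \<partial>lborel) + (\<integral>\<^sup>+u. g u * indicator {2*pi..s + 2*pi} u \<partial>lborel)"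
    by (rule nn_integral_add) auto
  also have "(\<integral>\<^sup>+u. g u * indicator {2*pi..s + 2*pi} u \<partial>lborel) = (\<integral>\<^sup>+u. g u * indicator {0..s} u \<partial>lborel)"
    by (subst nn_integral_real_affine[of "\<lambda>u. g u * indicator {2*pi..s + 2*pi} u" 1 "2*pi"])
       (auto intro!: nn_integral_cong simp: indicator_def periodic add.commute[of "2*pi"])
  also have "(\<integral>\<^sup>+u. g u * indicator {s..2*pi} u \<partial>lborel) + (\<integral>\<^sup>+u. g u * indicator {0..s} u \<partial>lborel)
     = (\<integral>\<^sup>+u. g u * indicator {s..2*pi} u + g u * indicator {0..s} u \<partial>lborel)"
    by (rule nn_integral_add[symmetric]) auto
  also have "\<dots> = (\<integral>\<^sup>+u. g u * indicator {0..2*pi} u \<partial>lborel)"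
    using null[of s] s by (intro nn_integral_cong_AE) (auto elim!: eventually_mono simp: indicator_def)
  finally show ?thesis
    by (simp add: nn_integral_circle_measure g_def)
qed

lemma distr_circle_rotate:
  assumes "norm w = 1"
  shows "distr circle_measure circle_measure (\<lambda>z. w * z) = circle_measure"
proof (rule measure_eqI)
  fix A assume "A \<in> sets (distr circle_measure circle_measure (\<lambda>z. w * z))"
  then have [measurable]: "A \<in> sets borel" by simp
  have "emeasure (distr circle_measure circle_measure (\<lambda>z. w * z)) A
      = (\<integral>\<^sup>+z. indicator A z \<partial>distr circle_measure circle_measure (\<lambda>z. w * z))"
    by simp
  also have "\<dots> = (\<integral>\<^sup>+z. indicator A (w * z) \<partial>circle_measure)"
    by (subst nn_integral_distr) auto
  also have "\<dots> = emeasure circle_measure A"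
    by (subst nn_integral_circle_rotate[OF _ assms]) auto
  finally show "emeasure (distr circle_measure circle_measure (\<lambda>z. w * z)) A = emeasure circle_measure A" .
qed simp

interpretation circle: prob_space circle_measure
  by (rule prob_space_circle_measure)

interpretation torus_product: product_prob_space "\<lambda>_::nat. circle_measure" UNIV
  by unfold_locales

lemma sets_torus_measure[simp, measurable_cong]:
  "sets torus_measure = sets (\<Pi>\<^sub>M j\<in>UNIV. borel)"
  unfolding torus_measure_def by (rule sets_PiM_cong) auto

lemma space_torus_measure[simp]: "space torus_measure = UNIV"
  by (simp add: torus_measure_def space_PiM)

interpretation torus: prob_space torus_measure
  unfolding torus_measure_def by (rule torus_product.prob_space_axioms)

lemma AE_torus_norm: "AE z in torus_measure. \<forall>j. norm (z j) = 1"
  unfolding torus_measure_def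
  by (subst AE_all_countable) (auto intro!: torus_product.AE_component AE_circle_norm)

lemma measurable_torus_rotate[measurable]:
  "(\<lambda>z j. u j * z j) \<in> measurable torus_measure torus_measure"
  unfolding torus_measure_def
  by (rule measurable_PiM_single') (auto simp: space_PiM)

text \<open>An infinite product measure is determined by its values on cylinders, and a
  coordinatewise rotation pulls a cylinder back to one whose sides are rotated and have the same
  measure.\<close>

lemma distr_torus_rotate:
  assumes u: "\<And>j. norm (u j) = 1"
  shows "distr torus_measure torus_measure (\<lambda>z j. u j * z j) = torus_measure"
proof -
  have "torus_measure = distr torus_measure torus_measure (\<lambda>z j. u j * z j)"
    unfolding torus_measure_def
  proof (rule measure_eqI_PiM_infinite[OF refl])
    fix J :: "nat set" and A :: "nat \<Rightarrow> complex set"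
    assume J: "finite J" "J \<subseteq> UNIV" and A: "\<And>j. j \<in> J \<Longrightarrow> A j \<in> sets circle_measure"
    let ?T = "\<Pi>\<^sub>M j\<in>(UNIV::nat set). circle_measure" and ?B = "\<lambda>j. (\<lambda>z. u j * z) -` A j"
    have B: "?B j \<in> sets circle_measure" "emeasure circle_measure (?B j) = emeasure circle_measure (A j)"
      if "j \<in> J" for j
    proof -
      have [measurable]: "A j \<in> sets borel" using A that by simp
      have "(\<lambda>z. u j * z) -` A j \<inter> space borel \<in> sets borel"
        by (rule measurable_sets[where A=borel]) auto
      then show "?B j \<in> sets circle_measure" by simp
      have "emeasure circle_measure (A j) = emeasure (distr circle_measure circle_measure (\<lambda>z. u j * z)) (A j)"
        by (simp add: distr_circle_rotate u)
      also have "\<dots> = emeasure circle_measure (?B j)"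
        by (subst emeasure_distr) auto
      finally show "emeasure circle_measure (?B j) = emeasure circle_measure (A j)" by simp
    qed
    have "emeasure (distr ?T ?T (\<lambda>z j. u j * z j)) (prod_emb UNIV (\<lambda>_. circle_measure) J (Pi\<^sub>E J A))
        = emeasure ?T ((\<lambda>z j. u j * z j) -` prod_emb UNIV (\<lambda>_. circle_measure) J (Pi\<^sub>E J A) \<inter> space ?T)"
      using J A measurable_torus_rotate by (intro emeasure_distr sets_PiM_I) (auto simp: torus_measure_def)
    also have "(\<lambda>z j. u j * z j) -` prod_emb UNIV (\<lambda>_. circle_measure) J (Pi\<^sub>E J A) \<inter> space ?T
        = prod_emb UNIV (\<lambda>_. circle_measure) J (Pi\<^sub>E J ?B)"
      by (auto simp: prod_emb_def space_PiM PiE_iff)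
    also have "emeasure ?T \<dots> = (\<Prod>j\<in>J. emeasure circle_measure (?B j))"
      using J B by (intro emeasure_PiM_emb prob_space_circle_measure) auto
    also have "\<dots> = (\<Prod>j\<in>J. emeasure circle_measure (A j))"
      using B by (intro prod.cong) auto
    also have "\<dots> = emeasure ?T (prod_emb UNIV (\<lambda>_. circle_measure) J (Pi\<^sub>E J A))"
      using J A by (intro emeasure_PiM_emb[symmetric] prob_space_circle_measure) auto
    finally show "emeasure ?T (prod_emb UNIV (\<lambda>_. circle_measure) J (Pi\<^sub>E J A))
        = emeasure (distr ?T ?T (\<lambda>z j. u j * z j)) (prod_emb UNIV (\<lambda>_. circle_measure) J (Pi\<^sub>E J A))"
      by simp
  qed (auto simp: torus_product.finite_measure_axioms)
  then show ?thesis ..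
qed

lemma nn_integral_torus_rotate:
  assumes f: "f \<in> borel_measurable torus_measure" and u: "\<And>j. norm (u j) = 1"
  shows "(\<integral>\<^sup>+z. f (\<lambda>j. u j * z j) \<partial>torus_measure) = (\<integral>\<^sup>+z. f z \<partial>torus_measure)"
  using nn_integral_distr[OF measurable_torus_rotate, of f u] f by (simp add: distr_torus_rotate[OF u])

lemma emeasure_circle_UNIV[simp]: "emeasure circle_measure UNIV = 1"
  using circle.emeasure_space_1 by simp

lemma emeasure_torus_UNIV[simp]: "emeasure torus_measure UNIV = 1"
  using torus.emeasure_space_1 by simp

section \<open>Subharmonicity\<close>

text \<open>Compares denominator and numerator of the Blaschke factor (z - a) / (1 -
  \<open>cnj a\<close> z). The estimates for reflected roots and for disc automorphisms both follow
  from the sign of the right-hand side.\<close>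

lemma norm_reflect_sq:
  fixes a z :: complex
  shows "(norm (1 - cnj a * z))\<^sup>2 - (norm (z - a))\<^sup>2 = (1 - (norm a)\<^sup>2) * (1 - (norm z)\<^sup>2)"
  unfolding cmod_power2 by (simp add: algebra_simps power2_eq_square)

lemma norm_reflect_le:
  assumes "norm a < 1" "norm z \<le> 1"
  shows "norm (z - a) \<le> norm (1 - cnj a * z)"
proof -
  have "0 \<le> (1 - (norm a)\<^sup>2) * (1 - (norm z)\<^sup>2)"
    using power_le_one[of "norm a" 2] power_le_one[of "norm z" 2] assms
    by (intro mult_nonneg_nonneg) auto
  then show ?thesis
    using norm_reflect_sq[of a z] by (intro power2_le_imp_le[OF _ norm_ge_zero]) linarith
qed

lemma norm_reflect_eq:
  assumes "norm z = 1"
  shows "norm (z - a) = norm (1 - cnj a * z)"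
  using norm_reflect_sq[of a z] assms by simp

lemma reflect_nonzero:
  fixes a z :: complex
  assumes "norm a < 1" "norm z \<le> 1"
  shows "1 - cnj a * z \<noteq> 0"
proof
  assume "1 - cnj a * z = 0"
  then have "norm (cnj a * z) = 1" by (metis eq_iff_diff_eq_0 norm_one)
  moreover have "norm (cnj a * z) < 1"
    using assms mult_left_le[of "norm z" "norm a"] by (simp add: norm_mult)
  ultimately show False by simp
qed

text \<open>A root a in the open disc is traded for the factor 1 - \<open>cnj a\<close> z, which has
  the modulus of z - a on the circle, dominates it inside and does not vanish there. Induction on
  the degree removes all such roots; in effect \<phi> is divided by its Blaschke product.\<close>

lemma reflect_roots:
  fixes \<phi> :: "complex poly"
  assumes "\<phi> \<noteq> 0"
  shows "\<exists>g. (\<forall>z. norm z = 1 \<longrightarrow> norm (poly g z) = norm (poly \<phi> z)) \<and>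
             (\<forall>z. norm z < 1 \<longrightarrow> norm (poly \<phi> z) \<le> norm (poly g z) \<and> poly g z \<noteq> 0)"
  using assms
proof (induction "degree \<phi>" arbitrary: \<phi> rule: less_induct)
  case less
  show ?case
  proof (cases "\<exists>a. norm a < 1 \<and> poly \<phi> a = 0")
    case False
    then show ?thesis by (intro exI[of _ \<phi>]) auto
  next
    case True
    then obtain a where a: "norm a < 1" "poly \<phi> a = 0" by blast
    then obtain \<psi> where \<psi>: "\<phi> = [:-a, 1:] * \<psi>"
      by (auto simp: poly_eq_0_iff_dvd)
    with less.prems have "\<psi> \<noteq> 0" by auto
    then have "degree \<psi> < degree \<phi>"
      unfolding \<psi> by (subst degree_mult_eq) auto
    from less.hyps[OF this \<open>\<psi> \<noteq> 0\<close>] obtain g where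
      g: "\<And>z. norm z = 1 \<Longrightarrow> norm (poly g z) = norm (poly \<psi> z)"
         "\<And>z. norm z < 1 \<Longrightarrow> norm (poly \<psi> z) \<le> norm (poly g z) \<and> poly g z \<noteq> 0" by blast
    have "poly ([:1, - cnj a:] * g) z = (1 - cnj a * z) * poly g z"
         "poly \<phi> z = (z - a) * poly \<psi> z" for z
      by (simp_all add: \<psi> algebra_simps)
    moreover have "norm ((z - a) * poly \<psi> z) = norm ((1 - cnj a * z) * poly g z)" if "norm z = 1" for z
      using that g(1) norm_reflect_eq[of z a] by (simp only: norm_mult)
    moreover have "norm ((z - a) * poly \<psi> z) \<le> norm ((1 - cnj a * z) * poly g z)"
        "(1 - cnj a * z) * poly g z \<noteq> 0" if "norm z < 1" for z
      using g(2)[OF that] norm_reflect_le[OF a(1) less_imp_le[OF that]] reflect_nonzero[OF a(1) less_imp_le[OF that]]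
      by (simp_all add: norm_mult mult_mono)
    ultimately show ?thesis
      by (metis (no_types, lifting))
  qed
qed

text \<open>Cauchy's formula, on a circle of radius s < 1 because F is not assumed to extend to the
  boundary.\<close>

lemma norm_le_circle_mean:
  assumes F: "F holomorphic_on ball 0 1" and s: "0 < s" "s < 1"
  shows "ennreal (2 * pi * norm (F 0)) \<le> (\<integral>\<^sup>+t. ennreal (norm (F (of_real s * cis t))) * indicator {0..2*pi} t \<partial>lborel)"
proof -
  have "((\<lambda>u. F u / (u - 0)) has_contour_integral (2 * of_real pi * \<i> * F 0)) (circlepath 0 s)"
    by (rule Cauchy_integral_circlepath_simple) (use F s in \<open>auto intro: holomorphic_on_subset\<close>)
  then have "((\<lambda>t. F (of_real s * cis t) / (of_real s * cis t) * of_real s * \<i> * cis t) has_integral (2 * of_real pi * \<i> * F 0)) {0..2*pi}"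
    unfolding circlepath_def by (subst (asm) has_contour_integral_part_circlepath_iff) auto
  \<comment> \<open>The derivative \<i> s cis t of the parametrisation cancels against the kernel
    except for \<i>, which the factor - \<i> removes.\<close>
  then have "((\<lambda>t. - \<i> * (F (of_real s * cis t) / (of_real s * cis t) * of_real s * \<i> * cis t)) has_integral (- \<i> * (2 * of_real pi * \<i> * F 0))) {0..2*pi}"
    by (rule has_integral_mult_right)
  then have 1: "((\<lambda>t. F (of_real s * cis t)) has_integral (2 * of_real pi * F 0)) {0..2*pi}"
    using s by (simp add: field_simps)
  have cont: "continuous_on {0..2*pi} (\<lambda>t. F (of_real s * cis t))"
    by (rule continuous_on_compose2[OF holomorphic_on_imp_continuous_on[OF F]])
       (use s in \<open>auto intro!: continuous_intros simp: norm_mult\<close>)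
  then have int: "(\<lambda>t. norm (F (of_real s * cis t))) integrable_on {0..2*pi}"
    by (intro integrable_continuous_interval continuous_intros)
  have "norm (integral {0..2*pi} (\<lambda>t. F (of_real s * cis t))) \<le> integral {0..2*pi} (\<lambda>t. norm (F (of_real s * cis t)))"
    using 1 int by (intro integral_norm_bound_integral) auto
  then have "2 * pi * norm (F 0) \<le> integral {0..2*pi} (\<lambda>t. norm (F (of_real s * cis t)))"
    unfolding integral_unique[OF 1] by (simp add: norm_mult)
  also have "ennreal (integral {0..2*pi} (\<lambda>t. norm (F (of_real s * cis t))))
      = (\<integral>\<^sup>+t. ennreal (norm (F (of_real s * cis t))) * indicator {0..2*pi} t \<partial>lborel)"
    using int by (intro nn_integral_has_integral_lebesgue'[symmetric] integrable_integral) auto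
  finally show ?thesis
    by (simp add: ennreal_leI)
qed

text \<open>The Moebius map of the disc that sends 0 to r. Composing with it moves the mean value
  inequality from 0 to r without writing a Poisson kernel, and since it preserves the unit circle
  its values can later be absorbed as rotations of the torus.\<close>

definition disc_automorphism :: "real \<Rightarrow> complex \<Rightarrow> complex" where
  "disc_automorphism r z = (of_real r + z) / (1 + of_real r * z)"

lemma disc_automorphism_denom:
  fixes z :: complex
  assumes "0 \<le> r" "r < 1" "norm z \<le> 1"
  shows "1 + of_real r * z \<noteq> 0"
  using reflect_nonzero[of "of_real (- r)" z] assms by simp

lemma norm_disc_automorphism:
  assumes "0 \<le> r" "r < 1"
  shows "norm (z::complex) = 1 \<Longrightarrow> norm (disc_automorphism r z) = 1"
    and "norm z \<le> 1 \<Longrightarrow> norm (disc_automorphism r z) \<le> 1"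
    and "norm z < 1 \<Longrightarrow> norm (disc_automorphism r z) < 1"
proof -
  have eq: "(norm (1 + of_real r * z))\<^sup>2 - (norm (of_real r + z))\<^sup>2 = (1 - r\<^sup>2) * (1 - (norm z)\<^sup>2)"
    using norm_reflect_sq[of "of_real (- r)" z] by (simp add: add.commute)
  have r: "0 < 1 - r\<^sup>2" using assms by (simp add: power_less_one_iff)
  {
    assume "norm z \<le> 1"
    then have "0 < norm (1 + of_real r * z)" using disc_automorphism_denom assms by auto
  } note pos = this
  {
    assume z: "norm z = 1"
    then have "norm (of_real r + z) = norm (1 + of_real r * z)" using eq by simp
    then show "norm (disc_automorphism r z) = 1"
      using pos z by (simp add: disc_automorphism_def norm_divide)
  }
  {
    assume z: "norm z \<le> 1"
    then have "0 \<le> (1 - r\<^sup>2) * (1 - (norm z)\<^sup>2)"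
      using r power_le_one[of "norm z" 2] by (intro mult_nonneg_nonneg) auto
    then have "norm (of_real r + z) \<le> norm (1 + of_real r * z)" using eq by (intro power2_le_imp_le[OF _ norm_ge_zero]) linarith
    then show "norm (disc_automorphism r z) \<le> 1"
      using pos z by (simp add: disc_automorphism_def norm_divide)
  }
  {
    assume z: "norm z < 1"
    then have "0 < (1 - r\<^sup>2) * (1 - (norm z)\<^sup>2)"
      using r by (intro mult_pos_pos) (auto simp: power_less_one_iff)
    then have "norm (of_real r + z) < norm (1 + of_real r * z)" using eq by (intro power2_less_imp_less[OF _ norm_ge_zero]) linarith
    then show "norm (disc_automorphism r z) < 1"
      using pos z by (simp add: disc_automorphism_def norm_divide)
  }
qed

lemma measurable_disc_automorphism[measurable]: "disc_automorphism r \<in> borel_measurable borel"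
  unfolding disc_automorphism_def by measurable

lemma measurable_poly[measurable]: "poly (\<phi> :: complex poly) \<in> borel_measurable borel"
  by (intro borel_measurable_continuous_onI continuous_intros)

text \<open>
  Subharmonicity of \<open>\<bar>\<phi>\<bar>\<^sup>p\<close>, at an arbitrary point of the disc. Replacing \<open>\<phi>\<close> by a polynomial
  without zeros in the disc and of the same modulus on the circle, \<open>\<bar>\<phi>\<bar>\<^sup>p\<close> becomes the modulus of a
  holomorphic function.
\<close>

lemma poly_powr_le_circle_mean:
  fixes \<phi> :: "complex poly"
  assumes p: "0 < p" and r: "0 \<le> r" "r < 1"
  shows "ennreal (norm (poly \<phi> (of_real r)) powr p)
    \<le> (\<integral>\<^sup>+z. ennreal (norm (poly \<phi> (disc_automorphism r z)) powr p) \<partial>circle_measure)"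
proof (cases "\<phi> = 0")
  case False
  let ?b = "disc_automorphism r"
  from reflect_roots[OF False] obtain g where
    g: "\<And>z. norm z = 1 \<Longrightarrow> norm (poly g z) = norm (poly \<phi> z)"
       "\<And>z. norm z < 1 \<Longrightarrow> norm (poly \<phi> z) \<le> norm (poly g z)"
       "\<And>z. norm z < 1 \<Longrightarrow> poly g z \<noteq> 0" by blast
  obtain h where h: "h holomorphic_on ball 0 1" "\<And>z. z \<in> ball 0 1 \<Longrightarrow> poly g z = exp (h z)"
  proof (rule contractible_imp_holomorphic_log[of "poly g" "ball 0 1"])
    show "poly g holomorphic_on ball 0 1"
      by (intro holomorphic_intros)
  qed (use g(3) in \<open>auto intro: convex_imp_contractible\<close>)
  define F where "F z = exp (of_real p * h (?b z))" for z
  have b_hol: "?b holomorphic_on ball 0 1"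
    unfolding disc_automorphism_def
    by (intro holomorphic_intros) (use disc_automorphism_denom[OF r] in force)
  have F_hol: "F holomorphic_on ball 0 1"
    unfolding F_def
    using holomorphic_on_compose_gen[OF b_hol h(1)] norm_disc_automorphism(3)[OF r]
    by (intro holomorphic_intros) (force simp: o_def image_subset_iff)
  have norm_F: "norm (F z) = norm (poly g (?b z)) powr p" if "norm z < 1" for z
    using h(2)[of "?b z"] norm_disc_automorphism(3)[OF r that] by (simp add: F_def powr_def)
  \<comment> \<open>g may vanish on the unit circle, where its logarithm breaks down. The mean value
    inequality is therefore applied on the radii \<open>s n\<close> < 1, and dominated convergence
    takes it to the boundary.\<close>
  define s where "s n = 1 - 1 / real (n + 2)" for n
  have s: "0 < s n" "s n < 1" for n by (auto simp: s_def field_simps)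
  have s_lim: "s \<longlonglongrightarrow> 1" unfolding s_def by real_asymp
  have le: "ennreal (norm (poly \<phi> (of_real r)) powr p)
      \<le> (\<integral>\<^sup>+z. ennreal (norm (poly g (?b (of_real (s n) * z))) powr p) \<partial>circle_measure)" for n
  proof -
    have "ennreal (norm (poly \<phi> (of_real r)) powr p) \<le> ennreal (norm (F 0))"
      using r p g(2)[of "of_real r"] by (auto simp: norm_F disc_automorphism_def intro!: ennreal_leI powr_mono2)
    also have "\<dots> = ennreal (2 * pi * norm (F 0)) / ennreal (2 * pi)"
      by (subst divide_ennreal) auto
    also have "\<dots> \<le> (\<integral>\<^sup>+t. ennreal (norm (F (of_real (s n) * cis t))) * indicator {0..2*pi} t \<partial>lborel) / ennreal (2 * pi)"
      using s F_hol by (intro divide_right_mono_ennreal norm_le_circle_mean)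
    also have "\<dots> = (\<integral>\<^sup>+t. ennreal (norm (poly g (?b (of_real (s n) * cis t))) powr p) * indicator {0..2*pi} t \<partial>lborel) / ennreal (2 * pi)"
      using s[of n] by (subst norm_F) (auto simp: norm_mult)
    also have "\<dots> = (\<integral>\<^sup>+z. ennreal (norm (poly g (?b (of_real (s n) * z))) powr p) \<partial>circle_measure)"
      by (subst nn_integral_circle_measure) auto
    finally show ?thesis .
  qed
  obtain B where B: "\<And>z. norm z \<le> 1 \<Longrightarrow> norm (poly g z) \<le> B"
  proof -
    have "compact (poly g ` cball 0 1)"
      by (intro compact_continuous_image continuous_intros compact_cball)
    then show ?thesis
      using that by (fastforce dest!: compact_imp_bounded simp: bounded_iff)
  qed
  have "(\<lambda>n. \<integral>\<^sup>+z. ennreal (norm (poly g (?b (of_real (s n) * z))) powr p) \<partial>circle_measure)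
      \<longlonglongrightarrow> (\<integral>\<^sup>+z. ennreal (norm (poly g (?b z)) powr p) \<partial>circle_measure)"
  proof (rule nn_integral_dominated_convergence[where w="\<lambda>_. ennreal (B powr p)"])
    show "AE z in circle_measure. ennreal (norm (poly g (?b (of_real (s n) * z))) powr p) \<le> ennreal (B powr p)" for n
      using AE_circle_norm
    proof eventually_elim
      case (elim z)
      then show ?case
        using s[of n] p by (intro ennreal_leI powr_mono2 B norm_disc_automorphism(2)[OF r]) (auto simp: norm_mult)
    qed
    show "AE z in circle_measure. (\<lambda>n. ennreal (norm (poly g (?b (of_real (s n) * z))) powr p))
      \<longlonglongrightarrow> ennreal (norm (poly g (?b z)) powr p)"
      using AE_circle_norm
    proof eventually_elim
      case (elim z)
      have "(\<lambda>n. of_real (s n) * z) \<longlonglongrightarrow> of_real 1 * z"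
        by (intro tendsto_intros s_lim)
      then have "(\<lambda>n. ?b (of_real (s n) * z)) \<longlonglongrightarrow> ?b z"
        unfolding disc_automorphism_def
        using disc_automorphism_denom[OF r, of z] elim by (intro tendsto_intros) auto
      then show ?case
        using p by (intro tendsto_ennrealI tendsto_powr2 tendsto_norm tendsto_poly) (auto)
    qed
  qed (auto simp: less_top[symmetric])
  then have "ennreal (norm (poly \<phi> (of_real r)) powr p) \<le> (\<integral>\<^sup>+z. ennreal (norm (poly g (?b z)) powr p) \<partial>circle_measure)"
    by (rule LIMSEQ_le_const) (use le in blast)
  also have "\<dots> = (\<integral>\<^sup>+z. ennreal (norm (poly \<phi> (?b z)) powr p) \<partial>circle_measure)"
    using AE_circle_norm
    by (intro nn_integral_cong_AE) (auto elim!: eventually_mono simp: g(1) norm_disc_automorphism(1)[OF r])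
  finally show ?thesis .
qed (use p in simp)

section \<open>Hardy norms of Dirichlet polynomials\<close>

lemma dirichlet_polys_iff: "a \<in> dirichlet_polys \<longleftrightarrow> a 0 = 0 \<and> (\<exists>N. \<forall>n. n \<notin> {1..N} \<longrightarrow> a n = 0)"
  unfolding dirichlet_polys_def
  by (auto simp: not_le)

lemma dirichlet_polys_combine:
  assumes "a \<in> dirichlet_polys" "b \<in> dirichlet_polys"
  shows "(\<lambda>n. c * a n + d * b n) \<in> dirichlet_polys"
    and "bohr_lift (\<lambda>n. c * a n + d * b n) z = c * bohr_lift a z + d * bohr_lift b z"
proof -
  obtain N where N: "a 0 = 0" "\<And>n. n \<notin> {1..N} \<Longrightarrow> a n = 0"
    using assms(1) unfolding dirichlet_polys_iff by blast
  obtain K where K: "b 0 = 0" "\<And>n. n \<notin> {1..K} \<Longrightarrow> b n = 0"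
    using assms(2) unfolding dirichlet_polys_iff by blast
  show "(\<lambda>n. c * a n + d * b n) \<in> dirichlet_polys"
    unfolding dirichlet_polys_iff using N K by (auto intro!: exI[of _ "max N K"])
  have eq: "bohr_lift f z = (\<Sum>n\<in>{1..max N K}. f n * bohr_monomial z n)"
    if "\<And>n. n \<notin> {1..max N K} \<Longrightarrow> f n = 0" for f
    using that by (intro bohr_lift_eq) auto
  show "bohr_lift (\<lambda>n. c * a n + d * b n) z = c * bohr_lift a z + d * bohr_lift b z"
    using N K by (subst (1 2 3) eq) (auto simp: sum.distrib sum_distrib_left algebra_simps)
qed

lemma dirichlet_polys_add:
  assumes "a \<in> dirichlet_polys" "b \<in> dirichlet_polys"
  shows "(\<lambda>n. a n + b n) \<in> dirichlet_polys"
    and "bohr_lift (\<lambda>n. a n + b n) z = bohr_lift a z + bohr_lift b z"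
  using dirichlet_polys_combine[OF assms, of 1 1] by simp_all

lemma dirichlet_polys_diff:
  assumes "a \<in> dirichlet_polys" "b \<in> dirichlet_polys"
  shows "(\<lambda>n. a n - b n) \<in> dirichlet_polys"
    and "bohr_lift (\<lambda>n. a n - b n) z = bohr_lift a z - bohr_lift b z"
  using dirichlet_polys_combine[OF assms, of 1 "-1"] by simp_all

lemma dirichlet_polys_scale:
  assumes "a \<in> dirichlet_polys"
  shows "(\<lambda>n. c * a n) \<in> dirichlet_polys"
    and "bohr_lift (\<lambda>n. c * a n) z = c * bohr_lift a z"
  using dirichlet_polys_combine[OF assms assms, of c 0] by simp_all

lemma dirichlet_polys_multiplier:
  assumes "a \<in> dirichlet_polys"
  shows "(\<lambda>n. a n * m n) \<in> dirichlet_polys"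
  using assms unfolding dirichlet_polys_iff by auto

lemma dshift_dirichlet_polys: "a \<in> dirichlet_polys \<Longrightarrow> dshift \<sigma> a \<in> dirichlet_polys"
  unfolding dshift_def by (rule dirichlet_polys_multiplier)

definition restrict_coeffs :: "nat set \<Rightarrow> (nat \<Rightarrow> complex) \<Rightarrow> nat \<Rightarrow> complex" where
  "restrict_coeffs F a = (\<lambda>n. if n \<in> F then a n else 0)"

lemma restrict_coeffs_polys:
  assumes "a 0 = 0" "finite F"
  shows "restrict_coeffs F a \<in> dirichlet_polys"
proof -
  have "n \<notin> {1..Max (insert 0 F)} \<Longrightarrow> n = 0 \<or> n \<notin> F" for n
    using assms(2) Max_ge[of "insert 0 F" n] by (auto simp: not_le)
  then show ?thesis
    using assms(1) unfolding dirichlet_polys_iff restrict_coeffs_def by (metis (full_types))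
qed

lemma measurable_bohr_lift[measurable]: "bohr_lift a \<in> borel_measurable torus_measure"
  unfolding bohr_lift_def by measurable

lemma AE_torus_norm_bohr_lift_le:
  assumes "finite F" "\<And>n. n \<notin> F \<Longrightarrow> a n = 0"
  shows "AE z in torus_measure. norm (bohr_lift a z) \<le> (\<Sum>n\<in>F. norm (a n))"
  using AE_torus_norm
proof eventually_elim
  case (elim z)
  then show ?case
    by (subst bohr_lift_eq[OF assms]) (auto intro!: sum_norm_le simp: norm_mult norm_bohr_monomial)
qed

text \<open>The p-th power of the norm, kept without the root because it is subadditive for p \<le>
  1, and kept in the extended nonnegative reals so that Fubini and Fatou need no
  integrability.\<close>

definition hardy_power :: "real \<Rightarrow> (nat \<Rightarrow> complex) \<Rightarrow> ennreal" where
  "hardy_power p a = (\<integral>\<^sup>+z. ennreal (norm (bohr_lift a z) powr p) \<partial>torus_measure)"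

lemma hardy_power_le_sum:
  assumes "finite F" "\<And>n. n \<notin> F \<Longrightarrow> a n = 0" "0 < p"
  shows "hardy_power p a \<le> ennreal ((\<Sum>n\<in>F. norm (a n)) powr p)"
proof -
  have "hardy_power p a \<le> (\<integral>\<^sup>+z. ennreal ((\<Sum>n\<in>F. norm (a n)) powr p) \<partial>torus_measure)"
    unfolding hardy_power_def using AE_torus_norm_bohr_lift_le[of F a, OF assms(1,2)] assms(3)
    by (intro nn_integral_mono_AE) (auto elim!: eventually_mono intro!: ennreal_leI powr_mono2)
  also have "\<dots> = ennreal ((\<Sum>n\<in>F. norm (a n)) powr p)"
    by simp
  finally show ?thesis .
qed

lemma hardy_power_finite:
  assumes "a \<in> dirichlet_polys" "0 < p"
  shows "hardy_power p a < \<infinity>"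
proof -
  obtain N where "\<And>n. n \<notin> {1..N} \<Longrightarrow> a n = 0"
    using assms(1) unfolding dirichlet_polys_iff by blast
  then have "hardy_power p a \<le> ennreal ((\<Sum>n\<in>{1..N}. norm (a n)) powr p)"
    using assms(2) by (intro hardy_power_le_sum) auto
  then show ?thesis
    by (simp add: le_less_trans)
qed

lemma hardy_power_uminus: "a \<in> dirichlet_polys \<Longrightarrow> hardy_power p (\<lambda>n. - a n) = hardy_power p a"
  using dirichlet_polys_scale(2)[of a "-1"] by (simp add: hardy_power_def)

lemma hardy_power_add:
  assumes "a \<in> dirichlet_polys" "b \<in> dirichlet_polys" "0 < p" "p \<le> 1"
  shows "hardy_power p (\<lambda>n. a n + b n) \<le> hardy_power p a + hardy_power p b"
proof -
  have "hardy_power p (\<lambda>n. a n + b n)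
      \<le> (\<integral>\<^sup>+z. ennreal (norm (bohr_lift a z) powr p) + ennreal (norm (bohr_lift b z) powr p) \<partial>torus_measure)"
    unfolding hardy_power_def dirichlet_polys_add(2)[OF assms(1,2)]
  proof (intro nn_integral_mono)
    fix z
    have "norm (bohr_lift a z + bohr_lift b z) powr p \<le> (norm (bohr_lift a z) + norm (bohr_lift b z)) powr p"
      using assms by (intro powr_mono2 norm_triangle_ineq) auto
    also have "\<dots> \<le> norm (bohr_lift a z) powr p + norm (bohr_lift b z) powr p"
      using assms by (intro powr_add_le) auto
    finally show "ennreal (norm (bohr_lift a z + bohr_lift b z) powr p)
        \<le> ennreal (norm (bohr_lift a z) powr p) + ennreal (norm (bohr_lift b z) powr p)"
      by (simp add: ennreal_leI flip: ennreal_plus)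
  qed
  also have "\<dots> = hardy_power p a + hardy_power p b"
    unfolding hardy_power_def by (rule nn_integral_add) auto
  finally show ?thesis .
qed

lemma hardy_power_diff:
  assumes "a \<in> dirichlet_polys" "b \<in> dirichlet_polys" "0 < p" "p \<le> 1"
  shows "hardy_power p (\<lambda>n. a n - b n) \<le> hardy_power p a + hardy_power p b"
  using hardy_power_add[OF assms(1) dirichlet_polys_scale(1)[OF assms(2), of "-1"] assms(3,4)]
    hardy_power_uminus[OF assms(2)] by simp

text \<open>The value at \<zeta> = r of the slices: by \<open>bohr_monomial_weight\<close> it
  replaces each z_j by r^(\<open>nth_prime j\<close>) z_j.\<close>

definition prime_dilate :: "real \<Rightarrow> (nat \<Rightarrow> complex) \<Rightarrow> nat \<Rightarrow> complex" where
  "prime_dilate r a = (\<lambda>n. a n * of_real r ^ prime_weight n)"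

lemma prime_dilate_polys: "a \<in> dirichlet_polys \<Longrightarrow> prime_dilate r a \<in> dirichlet_polys"
  unfolding prime_dilate_def by (rule dirichlet_polys_multiplier)

text \<open>Along a slice the polynomial is \<zeta>^L times another polynomial, since no weight lies
  below L. Subharmonicity bounds the latter at r by a mean over the circle. After exchanging the
  integrals, each point of the circle only rotates the torus and contributes
  \<open>hardy_power p a\<close>. The factor r^L is the gain for high weights.\<close>

lemma hardy_power_prime_dilate:
  assumes a: "a \<in> dirichlet_polys" and p: "0 < p" and r: "0 < r" "r < 1"
    and L: "\<And>n. a n \<noteq> 0 \<Longrightarrow> L \<le> prime_weight n"
  shows "hardy_power p (prime_dilate r a) \<le> ennreal ((r ^ L) powr p) * hardy_power p a"
proof -
  obtain N where N: "a 0 = 0" "\<And>n. n \<notin> {1..N} \<Longrightarrow> a n = 0"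
    using a unfolding dirichlet_polys_iff by blast
  \<comment> \<open>The slice through z divided by \<zeta>^L. The truncated subtraction is harmless
    because coefficients of weight below L vanish.\<close>
  define \<phi> where "\<phi> z = (\<Sum>n\<in>{1..N}. monom (a n * bohr_monomial z n) (prime_weight n - L))" for z
  have poly_\<phi>: "poly (\<phi> z) x = (\<Sum>n\<in>{1..N}. a n * bohr_monomial z n * x ^ (prime_weight n - L))" for z x
    by (simp add: \<phi>_def poly_sum poly_monom)
  have factor: "(\<Sum>n\<in>{1..N}. a n * x ^ prime_weight n * bohr_monomial z n) = x ^ L * poly (\<phi> z) x" for x z
    unfolding poly_\<phi> sum_distrib_left
  proof (rule sum.cong)
    fix n assume "n \<in> {1..N}"
    show "a n * x ^ prime_weight n * bohr_monomial z n = x ^ L * (a n * bohr_monomial z n * x ^ (prime_weight n - L))"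
      using L[of n] by (cases "a n = 0") (auto simp: algebra_simps simp flip: power_add)
  qed simp
  have lift_dilate: "bohr_lift (prime_dilate r a) z = of_real r ^ L * poly (\<phi> z) (of_real r)" for z
    unfolding factor[symmetric] using N by (subst bohr_lift_eq[of "{1..N}"]) (auto simp: prime_dilate_def)
  have lift_rotate: "bohr_lift a (\<lambda>j. x ^ nth_prime j * z j) = x ^ L * poly (\<phi> z) x" for x z
    using N by (subst bohr_lift_eq[of "{1..N}"])
      (auto simp: bohr_monomial_mult bohr_monomial_weight simp flip: factor mult.assoc)
  let ?b = "disc_automorphism r"
  have "hardy_power p (prime_dilate r a)
      = (\<integral>\<^sup>+z. ennreal ((r ^ L) powr p) * ennreal (norm (poly (\<phi> z) (of_real r)) powr p) \<partial>torus_measure)"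
    unfolding hardy_power_def lift_dilate using r
    by (simp add: norm_mult norm_power powr_mult ennreal_mult')
  also have "\<dots> \<le> (\<integral>\<^sup>+z. ennreal ((r ^ L) powr p) *
      (\<integral>\<^sup>+x. ennreal (norm (poly (\<phi> z) (?b x)) powr p) \<partial>circle_measure) \<partial>torus_measure)"
    using p r by (intro nn_integral_mono mult_left_mono poly_powr_le_circle_mean) auto
  also have "\<dots> = ennreal ((r ^ L) powr p) *
      (\<integral>\<^sup>+z. \<integral>\<^sup>+x. ennreal (norm (poly (\<phi> z) (?b x)) powr p) \<partial>circle_measure \<partial>torus_measure)"
    unfolding poly_\<phi> by (intro nn_integral_cmult) measurable
  also have "(\<integral>\<^sup>+z. \<integral>\<^sup>+x. ennreal (norm (poly (\<phi> z) (?b x)) powr p) \<partial>circle_measure \<partial>torus_measure)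
      = (\<integral>\<^sup>+x. \<integral>\<^sup>+z. ennreal (norm (poly (\<phi> z) (?b x)) powr p) \<partial>torus_measure \<partial>circle_measure)"
  proof -
    interpret pair_sigma_finite torus_measure circle_measure ..
    show ?thesis unfolding poly_\<phi> by (intro Fubini'[symmetric]) measurable
  qed
  also have "\<dots> = (\<integral>\<^sup>+x. hardy_power p a \<partial>circle_measure)"
    using AE_circle_norm
  proof (intro nn_integral_cong_AE, eventually_elim)
    case (elim x)
    have "norm (?b x) = 1" using norm_disc_automorphism(1)[of r x] r elim by simp
    then have "(\<integral>\<^sup>+z. ennreal (norm (poly (\<phi> z) (?b x)) powr p) \<partial>torus_measure)
        = (\<integral>\<^sup>+z. ennreal (norm (bohr_lift a (\<lambda>j. ?b x ^ nth_prime j * z j)) powr p) \<partial>torus_measure)"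
      by (simp add: lift_rotate norm_mult norm_power)
    also have "\<dots> = hardy_power p a"
      unfolding hardy_power_def using \<open>norm (?b x) = 1\<close>
      by (intro nn_integral_torus_rotate[where f="\<lambda>z. ennreal (norm (bohr_lift a z) powr p)"])
         (auto simp: norm_power)
    finally show ?case .
  qed
  also have "\<dots> = hardy_power p a"
    by simp
  finally show ?thesis .
qed


lemma restrict_coeffs_simps [simp]:
  "n \<in> F \<Longrightarrow> restrict_coeffs F a n = a n"
  "n \<notin> F \<Longrightarrow> restrict_coeffs F a n = 0"
  by (auto simp: restrict_coeffs_def)

lemma hardy_power_prime_dilate_le:
  assumes "a \<in> dirichlet_polys" "0 < p" "0 < r" "r < 1"
  shows "hardy_power p (prime_dilate r a) \<le> hardy_power p a"
  using hardy_power_prime_dilate[OF assms, of 0] by simp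

text \<open>
  Lower semicontinuity. The part of \<open>P k - Q\<close> of low weight tends to \<open>0\<close> since it has a fixed
  finite support, and dilation damps the part of high weight.
\<close>

lemma hardy_power_prime_dilate_le_lim:
  assumes p: "0 < p" "p \<le> 1" and P: "\<And>k. P k \<in> dirichlet_polys" and Q: "Q \<in> dirichlet_polys"
    and lim: "\<And>n. (\<lambda>k. P k n) \<longlonglongrightarrow> Q n" and t: "(\<lambda>k. hardy_power p (P k)) \<longlonglongrightarrow> t"
    and r: "0 < r" "r < 1"
  shows "hardy_power p (prime_dilate r Q) \<le> t"
proof (cases "t = \<infinity>")
  case False
  define F where "F L = {n. n > 0 \<and> prime_weight n \<le> L}" for L
  have F: "finite (F L)" for L
    unfolding F_def by (rule finite_prime_weight_le)
  define E where "E k n = P k n - Q n" for k n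
  have E: "E k \<in> dirichlet_polys" for k
    unfolding E_def by (intro dirichlet_polys_diff P Q)
  define low where "low L k = restrict_coeffs (F L) (E k)" for L k
  have low: "low L k \<in> dirichlet_polys" for L k
    using E[of k] unfolding low_def by (intro restrict_coeffs_polys F) (auto simp: dirichlet_polys_def)
  define high where "high L k n = E k n - low L k n" for L k n
  have high: "high L k \<in> dirichlet_polys" for L k
    unfolding high_def by (intro dirichlet_polys_diff E low)
  have high_weight: "Suc L \<le> prime_weight n" if "high L k n \<noteq> 0" for L k n
    using that E[of k] by (cases "n = 0") (auto simp: high_def low_def restrict_coeffs_def F_def dirichlet_polys_def split: if_splits)
  have low_lim: "(\<lambda>k. hardy_power p (low L k)) \<longlonglongrightarrow> 0" for L
  proof (rule tendsto_sandwich[OF always_eventually always_eventually tendsto_const])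
    have "hardy_power p (low L k) \<le> ennreal ((\<Sum>n\<in>F L. norm (low L k n)) powr p)" for k
      using F p by (intro hardy_power_le_sum) (auto simp: low_def)
    then show "\<forall>k. hardy_power p (low L k) \<le> ennreal ((\<Sum>n\<in>F L. norm (E k n)) powr p)"
      by (simp add: low_def)
    have "(\<lambda>k. \<Sum>n\<in>F L. norm (E k n)) \<longlonglongrightarrow> (\<Sum>n\<in>F L. norm (Q n - Q n))"
      unfolding E_def by (intro tendsto_intros lim)
    then show "(\<lambda>k. ennreal ((\<Sum>n\<in>F L. norm (E k n)) powr p)) \<longlonglongrightarrow> 0"
      using p by (intro tendsto_ennreal_powr_zero) (auto intro: sum_nonneg)
  qed simp
  have bound: "hardy_power p (prime_dilate r Q) \<le> t + ennreal ((r ^ Suc L) powr p) * (t + hardy_power p Q)" for L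
  proof -
    let ?c = "ennreal ((r ^ Suc L) powr p)"
    have le: "hardy_power p (prime_dilate r Q)
        \<le> hardy_power p (P k) + hardy_power p (low L k) + ?c * (hardy_power p (P k) + hardy_power p Q + hardy_power p (low L k))" for k
    proof -
      \<comment> \<open>Here Q = P k - low L k - high L k and dilation is linear. Only the high part
        gains a factor; for the other two it suffices that dilation does not increase
        \<open>hardy_power\<close>.\<close>
      have "prime_dilate r Q = (\<lambda>n. (prime_dilate r (P k) n - prime_dilate r (low L k) n) - prime_dilate r (high L k) n)"
        by (auto simp: prime_dilate_def high_def E_def algebra_simps)
      then have "hardy_power p (prime_dilate r Q)
          \<le> hardy_power p (\<lambda>n. prime_dilate r (P k) n - prime_dilate r (low L k) n) + hardy_power p (prime_dilate r (high L k))"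
        using hardy_power_diff[OF dirichlet_polys_diff(1)[OF prime_dilate_polys[OF P] prime_dilate_polys[OF low]] prime_dilate_polys[OF high] p]
        by simp
      also have "hardy_power p (\<lambda>n. prime_dilate r (P k) n - prime_dilate r (low L k) n) \<le> hardy_power p (P k) + hardy_power p (low L k)"
        using hardy_power_diff[OF prime_dilate_polys[OF P] prime_dilate_polys[OF low] p, of r k r L k]
          add_mono[OF hardy_power_prime_dilate_le[OF P p(1) r] hardy_power_prime_dilate_le[OF low p(1) r]]
        by (rule order_trans)
      also have "hardy_power p (prime_dilate r (high L k)) \<le> ?c * hardy_power p (high L k)"
        by (intro hardy_power_prime_dilate high p r high_weight)
      also have "hardy_power p (high L k) \<le> hardy_power p (E k) + hardy_power p (low L k)"
        unfolding high_def by (intro hardy_power_diff E low p)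
      also have "hardy_power p (E k) \<le> hardy_power p (P k) + hardy_power p Q"
        unfolding E_def by (intro hardy_power_diff P Q p)
      finally show ?thesis by (simp add: add_mono mult_left_mono)
    qed
    have "(\<lambda>k. hardy_power p (P k) + hardy_power p (low L k) + ?c * (hardy_power p (P k) + hardy_power p Q + hardy_power p (low L k)))
        \<longlonglongrightarrow> t + 0 + ?c * (t + hardy_power p Q + 0)"
      by (intro tendsto_add tendsto_const t low_lim ennreal_tendsto_cmult) auto
    then show ?thesis
      using le by (intro LIMSEQ_le_const[of _ "t + ?c * (t + hardy_power p Q)"]) auto
  qed
  \<comment> \<open>The limit in k was taken with L fixed and left a multiple of r^(L+1) raised to
    p. It disappears as L grows, since t and \<open>hardy_power p Q\<close> are finite.\<close>
  have "(\<lambda>L. ennreal ((r ^ Suc L) powr p)) \<longlonglongrightarrow> 0"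
    using r p by (intro tendsto_ennreal_powr_zero LIMSEQ_Suc LIMSEQ_power_zero) auto
  then have "(\<lambda>L. t + (t + hardy_power p Q) * ennreal ((r ^ Suc L) powr p)) \<longlonglongrightarrow> t + (t + hardy_power p Q) * 0"
    using False hardy_power_finite[OF Q p(1)]
    by (intro tendsto_add tendsto_const ennreal_tendsto_cmult) (auto simp: less_top)
  then show ?thesis
    using bound by (intro LIMSEQ_le_const[of _ t]) (auto simp: mult.commute)
qed simp

text \<open>The dilation is removed by letting r tend to 1: Q is fixed, so the error is controlled
  by a sum over its finite support, and subadditivity lets it enter as an additive term.\<close>

lemma hardy_power_le_lim:
  assumes p: "0 < p" "p \<le> 1" and P: "\<And>k. P k \<in> dirichlet_polys" and Q: "Q \<in> dirichlet_polys"
    and lim: "\<And>n. (\<lambda>k. P k n) \<longlonglongrightarrow> Q n" and t: "(\<lambda>k. hardy_power p (P k)) \<longlonglongrightarrow> t"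
  shows "hardy_power p Q \<le> t"
proof -
  obtain N where N: "Q 0 = 0" "\<And>n. n \<notin> {1..N} \<Longrightarrow> Q n = 0"
    using Q unfolding dirichlet_polys_iff by blast
  define r where "r m = 1 - 1 / real (m + 2)" for m
  have r: "0 < r m" "r m < 1" for m by (auto simp: r_def field_simps)
  have r_lim: "r \<longlonglongrightarrow> 1" unfolding r_def by real_asymp
  define e where "e m = (\<Sum>n\<in>{1..N}. norm (Q n - prime_dilate (r m) Q n))" for m
  have "e \<longlonglongrightarrow> (\<Sum>n\<in>{1..N}. norm (Q n - Q n * of_real 1 ^ prime_weight n))"
    unfolding e_def prime_dilate_def by (intro tendsto_intros r_lim)
  moreover have "0 \<le> e m" for m
    unfolding e_def by (intro sum_nonneg) simp
  ultimately have e_lim: "(\<lambda>m. ennreal (e m powr p)) \<longlonglongrightarrow> 0"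
    using p by (intro tendsto_ennreal_powr_zero) auto
  have "hardy_power p Q \<le> t + ennreal (e m powr p)" for m
  proof -
    let ?D = "prime_dilate (r m) Q"
    have "hardy_power p (\<lambda>n. ?D n + (Q n - ?D n)) \<le> hardy_power p ?D + hardy_power p (\<lambda>n. Q n - ?D n)"
      by (intro hardy_power_add dirichlet_polys_diff prime_dilate_polys Q p)
    also have "hardy_power p ?D \<le> t"
      using assms r by (rule hardy_power_prime_dilate_le_lim)
    also have "hardy_power p (\<lambda>n. Q n - ?D n) \<le> ennreal (e m powr p)"
      unfolding e_def using N p by (intro hardy_power_le_sum) (auto simp: prime_dilate_def)
    finally show ?thesis by (simp add: add_mono)
  qed
  moreover have "(\<lambda>m. t + ennreal (e m powr p)) \<longlonglongrightarrow> t + 0"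
    by (intro tendsto_add tendsto_const e_lim)
  ultimately show ?thesis
    by (intro LIMSEQ_le_const[of _ t]) auto
qed

lemma hardy_power_le_liminf:
  assumes p: "0 < p" "p \<le> 1" and P: "\<And>k. P k \<in> dirichlet_polys" and Q: "Q \<in> dirichlet_polys"
    and lim: "\<And>n. (\<lambda>k. P k n) \<longlonglongrightarrow> Q n"
  shows "hardy_power p Q \<le> liminf (\<lambda>k. hardy_power p (P k))"
proof -
  obtain s where s: "strict_mono s" "((\<lambda>k. hardy_power p (P k)) \<circ> s) \<longlonglongrightarrow> liminf (\<lambda>k. hardy_power p (P k))"
    using liminf_subseq_lim by blast
  show ?thesis
    using LIMSEQ_subseq_LIMSEQ[OF lim s(1)] s(2) P Q p
    by (intro hardy_power_le_lim[of p "\<lambda>k. P (s k)"]) (auto simp: o_def)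
qed

section \<open>Orthogonality of the monomials and Parseval's identity\<close>

lemma measurable_cnj[measurable]: "cnj \<in> borel_measurable borel"
  by (intro borel_measurable_continuous_onI continuous_intros)

text \<open>No integral is computed: if the exponents of one coordinate differ by d, rotating that
  coordinate by the angle pi/d preserves the measure and multiplies the integrand by -1.\<close>

lemma integral_bohr_monomial_orthogonal:
  assumes "n > 0" "m > 0" "n \<noteq> m"
  shows "(LINT z|torus_measure. bohr_monomial z n * cnj (bohr_monomial z m)) = 0"
proof -
  obtain j where j: "prime_exponent j n \<noteq> prime_exponent j m"
    using prime_exponent_inject[of n m] assms by blast
  define d where "d = real (prime_exponent j n) - real (prime_exponent j m)"
  have d: "d \<noteq> 0" using j by (simp add: d_def)
  define u where "u i = (if i = j then cis (pi / d) else 1)" for i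
  have u: "norm (u i) = 1" for i by (simp add: u_def)
  have mono: "bohr_monomial u k = cis (pi / d * real (prime_exponent j k))" for k
  proof -
    have "bohr_monomial u k = (\<Prod>i | prime_exponent i k \<noteq> 0. if i = j then cis (pi / d) ^ prime_exponent j k else 1)"
      unfolding bohr_monomial_def by (intro prod.cong) (auto simp: u_def)
    also have "\<dots> = cis (pi / d) ^ prime_exponent j k"
      using finite_prime_exponent[of k] by (simp add: prod.delta)
    also have "\<dots> = cis (real (prime_exponent j k) * (pi / d))"
      by (rule Complex.DeMoivre)
    finally show ?thesis by (simp only: mult.commute)
  qed
  have "bohr_monomial u n * cnj (bohr_monomial u m) = cis (pi / d * d)"
    by (simp add: mono cis_cnj cis_mult d_def right_diff_distrib)
  also have "\<dots> = -1" using d by simp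
  finally have sign: "bohr_monomial u n * cnj (bohr_monomial u m) = -1" .
  let ?f = "\<lambda>z. bohr_monomial z n * cnj (bohr_monomial z m)"
  have [measurable]: "?f \<in> borel_measurable torus_measure" by measurable
  have "(LINT z|torus_measure. ?f z) = (LINT z|distr torus_measure torus_measure (\<lambda>z j. u j * z j). ?f z)"
    by (simp add: distr_torus_rotate[OF u])
  also have "\<dots> = (LINT z|torus_measure. ?f (\<lambda>j. u j * z j))"
    by (rule integral_distr) auto
  also have "\<dots> = (LINT z|torus_measure. (bohr_monomial u n * cnj (bohr_monomial u m)) * ?f z)"
    by (simp add: bohr_monomial_mult ac_simps)
  also have "\<dots> = - (LINT z|torus_measure. ?f z)"
    by (simp add: sign)
  finally show ?thesis by simp
qed

lemma hardy_power_2: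
  assumes F: "finite F" "0 \<notin> F" "\<And>n. n \<notin> F \<Longrightarrow> a n = 0"
  shows "hardy_power 2 a = ennreal (\<Sum>n\<in>F. (norm (a n))\<^sup>2)"
proof -
  let ?I = "\<lambda>n m z. bohr_monomial z n * cnj (bohr_monomial z m)"
  have int: "integrable torus_measure (?I n m)" for n m
  proof (rule torus.integrable_const_bound[where B=1])
    show "AE z in torus_measure. norm (?I n m z) \<le> 1"
      using AE_torus_norm by eventually_elim (simp add: norm_mult norm_bohr_monomial)
  qed measurable
  have I: "(LINT z|torus_measure. ?I n m z) = (if n = m then 1 else 0)" if "n \<in> F" "m \<in> F" for n m
  proof (cases "n = m")
    case True
    have "(LINT z|torus_measure. ?I n m z) = (LINT z|torus_measure. 1)"
    proof (rule integral_cong_AE)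
      show "AE z in torus_measure. ?I n m z = 1"
        using AE_torus_norm
        by eventually_elim (simp add: True complex_norm_square[symmetric] norm_bohr_monomial)
    qed measurable
    then show ?thesis using True by (simp add: torus.prob_space[simplified])
  qed (use that F(2) integral_bohr_monomial_orthogonal[of n m] in \<open>auto intro!: gr0I\<close>)
  have lift: "bohr_lift a z = (\<Sum>n\<in>F. a n * bohr_monomial z n)" for z
    by (rule bohr_lift_eq[OF F(1,3)])
  have sq: "of_real ((norm (bohr_lift a z))\<^sup>2) = (\<Sum>n\<in>F. \<Sum>m\<in>F. a n * cnj (a m) * ?I n m z)" for z
    unfolding complex_norm_square lift cnj_sum sum_product complex_cnj_mult by (intro sum.cong refl) (simp only: ac_simps)
  have "of_real (LINT z|torus_measure. (norm (bohr_lift a z))\<^sup>2)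
      = (LINT z|torus_measure. (\<Sum>n\<in>F. \<Sum>m\<in>F. a n * cnj (a m) * ?I n m z))"
    by (simp only: sq flip: integral_complex_of_real)
  also have "\<dots> = (\<Sum>n\<in>F. \<Sum>m\<in>F. a n * cnj (a m) * (LINT z|torus_measure. ?I n m z))"
    using int by (simp add: integral_sum integral_mult_right_zero)
  also have "\<dots> = (\<Sum>n\<in>F. \<Sum>m\<in>F. if m = n then a n * cnj (a n) else 0)"
    by (intro sum.cong refl) (auto simp: I)
  also have "\<dots> = of_real (\<Sum>n\<in>F. (norm (a n))\<^sup>2)"
    unfolding of_real_sum complex_norm_square using F(1) by (intro sum.cong refl) simp
  finally have eq: "(LINT z|torus_measure. (norm (bohr_lift a z))\<^sup>2) = (\<Sum>n\<in>F. (norm (a n))\<^sup>2)"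
    by (simp only: of_real_eq_iff)
  have "integrable torus_measure (\<lambda>z. (norm (bohr_lift a z))\<^sup>2)"
  proof (rule torus.integrable_const_bound)
    show "AE z in torus_measure. norm ((norm (bohr_lift a z))\<^sup>2) \<le> (\<Sum>n\<in>F. norm (a n))\<^sup>2"
    proof -
      have "AE z in torus_measure. norm (bohr_lift a z) \<le> (\<Sum>n\<in>F. norm (a n))"
        using F by (intro AE_torus_norm_bohr_lift_le) auto
      then show ?thesis
        by eventually_elim (simp add: power_mono)
    qed
  qed measurable
  then show ?thesis
    by (simp add: hardy_power_def nn_integral_eq_integral eq)
qed

section \<open>Mixed norms\<close>

lemma hardy_norm_eq: "hardy_norm p a = enn2real (hardy_power p a) powr (1 / p)"
  unfolding hardy_norm_def hardy_power_def by (subst integral_eq_nn_integral) auto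

lemma hardy_norm_powr: "hardy_norm p a powr q = enn2real (hardy_power p a) powr (q / p)"
  by (simp add: hardy_norm_eq powr_powr)

lemma hardy_norm_nonneg: "0 \<le> hardy_norm p a"
  by (simp add: hardy_norm_eq)

lemma ennreal_enn2real_hardy_power:
  assumes "a \<in> dirichlet_polys" "0 < p"
  shows "ennreal (enn2real (hardy_power p a)) = hardy_power p a"
  using hardy_power_finite[OF assms] by simp

lemma hardy_norm_mono:
  assumes a: "a \<in> dirichlet_polys" and p: "0 < p" "p \<le> p'"
  shows "hardy_norm p a \<le> hardy_norm p' a"
proof -
  define L where "L = enn2real (hardy_power p' a)"
  have L: "hardy_power p' a = ennreal L" "0 \<le> L"
    using ennreal_enn2real_hardy_power[OF a, of p'] p by (auto simp: L_def)
  have "(\<integral>\<^sup>+z. ennreal ((norm (bohr_lift a z) powr p') powr (p / p')) \<partial>torus_measure) \<le> ennreal (L powr (p / p'))"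
    using L p by (intro torus.nn_integral_powr_le) (auto simp: hardy_power_def)
  then have "hardy_power p a \<le> ennreal (L powr (p / p'))"
    using p by (simp add: powr_powr hardy_power_def)
  then have "enn2real (hardy_power p a) \<le> L powr (p / p')"
    by (simp add: enn2real_leI)
  then have "enn2real (hardy_power p a) powr (1 / p) \<le> (L powr (p / p')) powr (1 / p)"
    using p by (intro powr_mono2) auto
  then show ?thesis
    using p by (simp add: hardy_norm_eq powr_powr L_def)
qed

text \<open>A triangle inequality uniform over all p and q. The crude bound
  \<open>powr_add_le_two_powr\<close> is applied under the torus integral with exponent p and again
  to the outer power q/p; this is where both factors come from.\<close>

lemma hardy_norm_add_powr:
  assumes a: "a \<in> dirichlet_polys" and b: "b \<in> dirichlet_polys" and p: "0 < p" "0 < q"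
  shows "hardy_norm p (\<lambda>n. a n + b n) powr q \<le> 2 powr q * 2 powr (q / p) * (hardy_norm p a powr q + hardy_norm p b powr q)"
proof -
  let ?h = "\<lambda>a. enn2real (hardy_power p a)"
  have "hardy_power p (\<lambda>n. a n + b n)
      \<le> (\<integral>\<^sup>+z. ennreal (2 powr p) * (ennreal (norm (bohr_lift a z) powr p) + ennreal (norm (bohr_lift b z) powr p)) \<partial>torus_measure)"
    unfolding hardy_power_def dirichlet_polys_add(2)[OF a b]
  proof (intro nn_integral_mono)
    fix z
    have "norm (bohr_lift a z + bohr_lift b z) powr p \<le> (norm (bohr_lift a z) + norm (bohr_lift b z)) powr p"
      using p by (intro powr_mono2 norm_triangle_ineq) auto
    also have "\<dots> \<le> 2 powr p * (norm (bohr_lift a z) powr p + norm (bohr_lift b z) powr p)"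
      using p by (intro powr_add_le_two_powr) auto
    finally show "ennreal (norm (bohr_lift a z + bohr_lift b z) powr p)
        \<le> ennreal (2 powr p) * (ennreal (norm (bohr_lift a z) powr p) + ennreal (norm (bohr_lift b z) powr p))"
      by (simp add: ennreal_leI flip: ennreal_plus ennreal_mult)
  qed
  also have "\<dots> = ennreal (2 powr p) * (hardy_power p a + hardy_power p b)"
    unfolding hardy_power_def by (subst nn_integral_cmult) (auto simp: nn_integral_add)
  also have "\<dots> = ennreal (2 powr p * (?h a + ?h b))"
    by (simp add: ennreal_mult ennreal_plus ennreal_enn2real_hardy_power a b p)
  finally have "?h (\<lambda>n. a n + b n) \<le> 2 powr p * (?h a + ?h b)"
    by (simp add: enn2real_leI)
  then have "?h (\<lambda>n. a n + b n) powr (q / p) \<le> (2 powr p * (?h a + ?h b)) powr (q / p)"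
    using p by (intro powr_mono2) auto
  also have "\<dots> = 2 powr q * (?h a + ?h b) powr (q / p)"
    using p by (simp add: powr_mult powr_powr)
  also have "(?h a + ?h b) powr (q / p) \<le> 2 powr (q / p) * (?h a powr (q / p) + ?h b powr (q / p))"
    using p by (intro powr_add_le_two_powr) auto
  finally show ?thesis
    by (simp add: hardy_norm_powr mult.assoc)
qed

lemma hardy_norm_scale:
  assumes a: "a \<in> dirichlet_polys" and p: "0 < p"
  shows "hardy_norm p (\<lambda>n. c * a n) = norm c * hardy_norm p a"
proof -
  have "hardy_power p (\<lambda>n. c * a n) = ennreal (norm c powr p) * hardy_power p a"
    unfolding hardy_power_def dirichlet_polys_scale(2)[OF a]
    by (subst nn_integral_cmult[symmetric]) (auto simp: norm_mult powr_mult ennreal_mult)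
  then show ?thesis
    using p by (simp add: hardy_norm_eq enn2real_mult powr_mult powr_powr)
qed

lemma measurable_hardy_power:
  assumes F: "finite F" and [measurable]: "\<And>n. n \<in> F \<Longrightarrow> c n \<in> borel_measurable M"
  shows "(\<lambda>x. hardy_power p (restrict_coeffs F (\<lambda>n. c n x))) \<in> borel_measurable M"
proof -
  have "bohr_lift (restrict_coeffs F (\<lambda>n. c n x)) z = (\<Sum>n\<in>F. c n x * bohr_monomial z n)" for x z
    using F by (subst bohr_lift_eq[of F]) auto
  then show ?thesis
    unfolding hardy_power_def by simp
qed

lemma measurable_hardy_norm:
  assumes "finite F" "\<And>n. n \<in> F \<Longrightarrow> c n \<in> borel_measurable M"
  shows "(\<lambda>x. hardy_norm p (restrict_coeffs F (\<lambda>n. c n x))) \<in> borel_measurable M"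
  unfolding hardy_norm_eq using measurable_hardy_power[OF assms] by simp

lemma dshift_restrict_coeffs: "dshift \<sigma> (restrict_coeffs F a) = restrict_coeffs F (dshift \<sigma> a)"
  by (auto simp: dshift_def restrict_coeffs_def)

lemma dirichlet_polys_restrictE:
  assumes "a \<in> dirichlet_polys"
  obtains N where "a = restrict_coeffs {1..N} a"
  using assms unfolding dirichlet_polys_iff restrict_coeffs_def by (metis (no_types, lifting) ext)

lemma measurable_dshift[measurable]: "(\<lambda>\<sigma>. dshift \<sigma> a n) \<in> borel_measurable borel"
proof (cases "n = 0")
  case False
  have "(\<lambda>\<sigma>. of_nat n powr (- complex_of_real \<sigma>)) \<in> borel_measurable borel"
    using False by (intro borel_measurable_continuous_onI continuous_intros) auto
  then show ?thesis unfolding dshift_def by simp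
qed (simp add: dshift_def)

lemma norm_dshift: "norm (dshift \<sigma> a n) = norm (a n) * real n powr (- \<sigma>)"
  by (cases "n = 0") (auto simp: dshift_def norm_mult norm_powr_real_powr)

text \<open>
  Both norms are instances of one: the measure \<open>\<nu>\<close> is \<open>mu_measure \<alpha>\<close> for the mixed norm and the
  point mass at \<open>0\<close>, with \<open>q = 1\<close>, for the Hardy norm.
\<close>

definition shift_norm :: "real measure \<Rightarrow> real \<Rightarrow> real \<Rightarrow> (nat \<Rightarrow> complex) \<Rightarrow> real" where
  "shift_norm \<nu> p q a = (LINT \<sigma>|\<nu>. hardy_norm p (dshift \<sigma> a) powr q) powr (1 / q)"

definition shift_power :: "real measure \<Rightarrow> real \<Rightarrow> real \<Rightarrow> (nat \<Rightarrow> complex) \<Rightarrow> ennreal" where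
  "shift_power \<nu> p q a = (\<integral>\<^sup>+\<sigma>. ennreal (hardy_norm p (dshift \<sigma> a) powr q) \<partial>\<nu>)"

lemma summable_dshift_mono:
  assumes "summable (\<lambda>n. (norm (dshift \<sigma> a n))\<^sup>2)" "\<sigma> \<le> s"
  shows "summable (\<lambda>n. (norm (dshift s a n))\<^sup>2)"
  using assms(1)
proof (rule summable_comparison_test'[where N=1])
  fix n :: nat assume "1 \<le> n"
  then have "norm (dshift s a n) \<le> norm (dshift \<sigma> a n)"
    unfolding norm_dshift using assms(2) by (intro mult_left_mono powr_mono) auto
  then show "norm ((norm (dshift s a n))\<^sup>2) \<le> (norm (dshift \<sigma> a n))\<^sup>2"
    by (simp add: power_mono)
qed

definition quasi_const :: "real \<Rightarrow> real \<Rightarrow> real" where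
  "quasi_const p q = 2 powr q * 2 powr (q / p)"

lemma quasi_const_ge_1:
  assumes "0 < p" "0 < q"
  shows "1 \<le> quasi_const p q"
proof -
  have "(1::real) \<le> 2 powr q" "(1::real) \<le> 2 powr (q / p)"
    using assms by (auto intro!: ge_one_powr_ge_zero)
  from mult_mono[OF this] show ?thesis
    by (simp add: quasi_const_def)
qed

lemma hardy_norm_2_powr:
  assumes "finite F" "0 \<notin> F" "\<And>n. n \<notin> F \<Longrightarrow> a n = 0"
  shows "hardy_norm 2 (dshift \<sigma> a) powr q = (\<Sum>n\<in>F. (norm (dshift \<sigma> a n))\<^sup>2) powr (q / 2)"
proof -
  have "hardy_power 2 (dshift \<sigma> a) = ennreal (\<Sum>n\<in>F. (norm (dshift \<sigma> a n))\<^sup>2)"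
    using assms by (intro hardy_power_2) (auto simp: dshift_def)
  then show ?thesis
    by (simp add: hardy_norm_powr sum_nonneg)
qed

lemma shift_power_2:
  assumes "finite F" "0 \<notin> F" "\<And>n. n \<notin> F \<Longrightarrow> a n = 0"
  shows "shift_power \<nu> 2 q a = (\<integral>\<^sup>+\<sigma>. ennreal ((\<Sum>n\<in>F. (norm (dshift \<sigma> a n))\<^sup>2) powr (q / 2)) \<partial>\<nu>)"
  unfolding shift_power_def using hardy_norm_2_powr[OF assms] by simp

lemma shift_power_2_restrict:
  assumes "finite F" "0 \<notin> F"
  shows "shift_power \<nu> 2 q (restrict_coeffs F a)
    = (\<integral>\<^sup>+\<sigma>. ennreal ((\<Sum>n\<in>F. (norm (dshift \<sigma> a n))\<^sup>2) powr (q / 2)) \<partial>\<nu>)"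
  using shift_power_2[of F "restrict_coeffs F a" \<nu> q] assms
  by (simp add: dshift_restrict_coeffs)

text \<open>Cauchy-Schwarz in the form x y \<le> x^2 + y^2: a small part \<sigma> of the decay makes
  the coefficients square summable, and the rest is square summable by itself.\<close>

lemma converges_half_plane:
  assumes "\<And>\<sigma>. 0 < \<sigma> \<Longrightarrow> summable (\<lambda>n. (norm (dshift \<sigma> a n))\<^sup>2)"
  shows "dirichlet_converges_on a (half_plane (1/2))"
  unfolding dirichlet_converges_on_def half_plane_def
proof safe
  fix s assume s: "1/2 < Re s"
  \<comment> \<open>Half of the excess of Re s over 1/2, so that \<sigma> > 0 while 2 (Re s -
    \<sigma>) = Re s + 1/2 still exceeds 1.\<close>
  define \<sigma> where "\<sigma> = (Re s - 1/2) / 2"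
  have \<sigma>: "0 < \<sigma>" "-2 * (Re s - \<sigma>) < -1" using s by (auto simp: \<sigma>_def field_simps)
  show "summable (\<lambda>n. a n * of_nat n powr (- s))"
  proof (rule summable_comparison_test')
    show "summable (\<lambda>n. (norm (dshift \<sigma> a n))\<^sup>2 + real n powr (-2 * (Re s - \<sigma>)))"
      using \<sigma> by (intro summable_add assms) (simp_all add: summable_real_powr_iff)
    show "norm (a n * of_nat n powr (- s)) \<le> (norm (dshift \<sigma> a n))\<^sup>2 + real n powr (-2 * (Re s - \<sigma>))" for n
    proof (cases "n = 0")
      case False
      let ?x = "norm (dshift \<sigma> a n)" and ?y = "real n powr (- (Re s - \<sigma>))"
      have "norm (a n * of_nat n powr (- s)) = norm (a n) * real n powr (- Re s)"
        unfolding norm_mult using False by (subst norm_powr_real) (auto simp: powr_def)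
      also have "real n powr (- Re s) = real n powr (- \<sigma>) * ?y"
        by (simp flip: powr_add)
      also have "norm (a n) * (real n powr (- \<sigma>) * ?y) = ?x * ?y"
        by (simp add: norm_dshift)
      also have "\<dots> \<le> ?x\<^sup>2 + ?y\<^sup>2"
      proof -
        have "0 \<le> ?x * ?y" by simp
        moreover have "2 * (?x * ?y) \<le> ?x\<^sup>2 + ?y\<^sup>2"
          using sum_squares_bound[of ?x ?y] by (simp only: mult.assoc)
        ultimately show ?thesis by linarith
      qed
      also have "?y\<^sup>2 = real n powr (-2 * (Re s - \<sigma>))"
        by (simp add: power2_eq_square flip: powr_add)
      finally show ?thesis .
    qed simp
  qed
qed

lemma restrict_coeffs_diff:
  "N \<le> M \<Longrightarrow> (\<lambda>n. restrict_coeffs {1..M} a n - restrict_coeffs {1..N} a n) = restrict_coeffs {N<..M} a"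
  by (auto simp: restrict_coeffs_def)

text \<open>\<open>AE_nonneg\<close> makes shifting decrease the moduli of the coefficients.
  \<open>pos_near_0\<close> turns a property of almost every \<sigma> that persists for larger
  \<sigma> into one of every \<sigma> > 0.\<close>

locale shift_measure = finite_measure \<nu> for \<nu> :: "real measure" +
  assumes sets_shift[simp, measurable_cong]: "sets \<nu> = sets borel"
    and AE_nonneg: "AE \<sigma> in \<nu>. 0 \<le> \<sigma>"
    and pos_near_0: "\<epsilon> > 0 \<Longrightarrow> emeasure \<nu> {..\<epsilon>} \<noteq> 0"
begin

lemma space_shift[simp]: "space \<nu> = UNIV"
  using sets_eq_imp_space_eq[OF sets_shift] by simp

lemma measurable_hardy_norm_dshift:
  assumes "a \<in> dirichlet_polys"
  shows "(\<lambda>\<sigma>. hardy_norm p (dshift \<sigma> a)) \<in> borel_measurable \<nu>"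
proof -
  obtain N where N: "a = restrict_coeffs {1..N} a"
    using assms by (rule dirichlet_polys_restrictE)
  show ?thesis
    by (subst N, unfold dshift_restrict_coeffs) (intro measurable_hardy_norm, auto)
qed

lemma shift_power_finite:
  assumes a: "a \<in> dirichlet_polys" and p: "0 < p" "0 < q"
  shows "shift_power \<nu> p q a < \<infinity>"
proof -
  obtain N where N: "a = restrict_coeffs {1..N} a"
    using a by (rule dirichlet_polys_restrictE)
  then have N': "a n = 0" if "n \<notin> {1..N}" for n
    using that by (metis restrict_coeffs_simps(2))
  define B where "B = (\<Sum>n\<in>{1..N}. norm (a n))"
  have "shift_power \<nu> p q a \<le> (\<integral>\<^sup>+\<sigma>. ennreal ((B powr p) powr (q / p)) \<partial>\<nu>)"
    unfolding shift_power_def using AE_nonneg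
  proof (intro nn_integral_mono_AE, eventually_elim)
    case (elim \<sigma>)
    have "hardy_power p (dshift \<sigma> a) \<le> ennreal ((\<Sum>n\<in>{1..N}. norm (dshift \<sigma> a n)) powr p)"
      using p N' by (intro hardy_power_le_sum) (auto simp: dshift_def)
    also have "\<dots> \<le> ennreal (B powr p)"
    proof (intro ennreal_leI powr_mono2)
      show "(\<Sum>n\<in>{1..N}. norm (dshift \<sigma> a n)) \<le> B"
        unfolding B_def norm_dshift
      proof (intro sum_mono mult_left_le norm_ge_zero)
        fix n assume "n \<in> {1..N}"
        then show "real n powr - \<sigma> \<le> 1"
          using elim powr_mono[of "- \<sigma>" 0 "real n"] by auto
      qed
    qed (use p in \<open>auto intro: sum_nonneg\<close>)
    finally have "enn2real (hardy_power p (dshift \<sigma> a)) \<le> B powr p"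
      by (simp add: enn2real_leI)
    then show ?case
      unfolding hardy_norm_powr using p by (intro ennreal_leI powr_mono2) auto
  qed
  also have "\<dots> < \<infinity>"
    using emeasure_finite[of UNIV] by (simp add: ennreal_mult_eq_top_iff less_top[symmetric])
  finally show ?thesis .
qed

lemma shift_norm_eq:
  assumes "a \<in> dirichlet_polys"
  shows "shift_norm \<nu> p q a = enn2real (shift_power \<nu> p q a) powr (1 / q)"
  unfolding shift_norm_def shift_power_def using measurable_hardy_norm_dshift[OF assms]
  by (subst integral_eq_nn_integral) auto

lemma shift_norm_less_iff:
  assumes a: "a \<in> dirichlet_polys" and p: "0 < p" "0 < q" and \<epsilon>: "0 < \<epsilon>"
  shows "shift_norm \<nu> p q a < \<epsilon> \<longleftrightarrow> shift_power \<nu> p q a < ennreal (\<epsilon> powr q)"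
proof -
  define x where "x = enn2real (shift_power \<nu> p q a)"
  have x: "shift_power \<nu> p q a = ennreal x" "0 \<le> x"
    using shift_power_finite[OF a p] by (auto simp: x_def)
  have "x powr (1 / q) < \<epsilon> \<longleftrightarrow> (x powr (1 / q)) powr q < \<epsilon> powr q"
    using p \<epsilon> by (metis less_eq_real_def linorder_not_le powr_ge_zero powr_less_mono2 powr_mono2)
  also have "(x powr (1 / q)) powr q = x"
    using p x by (simp add: powr_powr)
  finally show ?thesis
    using x by (simp add: shift_norm_eq[OF a] ennreal_less_iff)
qed

text \<open>The q-th powers of the distances define the same Cauchy sequences, and convergence on
  the half plane already contains all of \<open>dirichlet_series\<close> except the normalisation of
  the coefficient 0.\<close>

lemma mem_completion_iff:
  assumes p: "0 < p" "0 < q"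
  shows "a \<in> dirichlet_completion (shift_norm \<nu> p q) \<longleftrightarrow>
     a 0 = 0 \<and> dirichlet_converges_on a (half_plane (1/2)) \<and>
     (\<exists>P. (\<forall>k. P k \<in> dirichlet_polys) \<and>
          (\<forall>\<epsilon>>0. \<exists>K. \<forall>k\<ge>K. \<forall>l\<ge>K. shift_power \<nu> p q (\<lambda>n. P k n - P l n) < ennreal \<epsilon>) \<and>
          (\<forall>n. (\<lambda>k. P k n) \<longlonglongrightarrow> a n))"
proof -
  have "(\<forall>\<epsilon>>0. \<exists>K. \<forall>k\<ge>K. \<forall>l\<ge>K. shift_norm \<nu> p q (\<lambda>n. P k n - P l n) < \<epsilon>)
     \<longleftrightarrow> (\<forall>\<epsilon>>0. \<exists>K. \<forall>k\<ge>K. \<forall>l\<ge>K. shift_power \<nu> p q (\<lambda>n. P k n - P l n) < ennreal \<epsilon>)"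
    (is "?L \<longleftrightarrow> ?R")
    if P: "\<forall>k. P k \<in> dirichlet_polys" for P
  proof -
    have iff: "shift_norm \<nu> p q (\<lambda>n. P k n - P l n) < \<epsilon> \<longleftrightarrow> shift_power \<nu> p q (\<lambda>n. P k n - P l n) < ennreal (\<epsilon> powr q)"
      if "\<epsilon> > 0" for k l \<epsilon>
      using that p P by (intro shift_norm_less_iff dirichlet_polys_diff) auto
    show ?thesis
    proof
      assume ?R
      then show ?L by (simp add: iff)
    next
      assume L: ?L
      show ?R
      proof (intro allI impI)
        fix \<epsilon> :: real assume \<epsilon>: "\<epsilon> > 0"
        then have eq: "(\<epsilon> powr (1 / q)) powr q = \<epsilon>" and pos: "\<epsilon> powr (1 / q) > 0"
          using p by (simp_all add: powr_powr)
        from L[rule_format, OF pos] show "\<exists>K. \<forall>k\<ge>K. \<forall>l\<ge>K. shift_power \<nu> p q (\<lambda>n. P k n - P l n) < ennreal \<epsilon>"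
          by (simp add: iff[OF pos] eq)
      qed
    qed
  qed
  then have 1: "(\<exists>P. (\<forall>k. P k \<in> dirichlet_polys) \<and>
      (\<forall>\<epsilon>>0. \<exists>K. \<forall>k\<ge>K. \<forall>l\<ge>K. shift_norm \<nu> p q (\<lambda>n. P k n - P l n) < \<epsilon>) \<and> (\<forall>n. (\<lambda>k. P k n) \<longlonglongrightarrow> a n))
    \<longleftrightarrow> (\<exists>P. (\<forall>k. P k \<in> dirichlet_polys) \<and>
      (\<forall>\<epsilon>>0. \<exists>K. \<forall>k\<ge>K. \<forall>l\<ge>K. shift_power \<nu> p q (\<lambda>n. P k n - P l n) < ennreal \<epsilon>) \<and> (\<forall>n. (\<lambda>k. P k n) \<longlonglongrightarrow> a n))"
    by (intro ex_cong1 conj_cong refl)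
  have 2: "a \<in> dirichlet_series \<and> dirichlet_converges_on a (half_plane (1/2))
      \<longleftrightarrow> a 0 = 0 \<and> dirichlet_converges_on a (half_plane (1/2))"
    unfolding dirichlet_series_def by auto
  have *: "E = E' \<Longrightarrow> (d \<and> c \<longleftrightarrow> z \<and> c) \<Longrightarrow> (d \<and> c \<and> E) \<longleftrightarrow> (z \<and> c \<and> E')" for E E' d c z
    by blast
  show ?thesis
    unfolding dirichlet_completion_def mem_Collect_eq by (rule *[OF 1 2])
qed

lemma shift_power_add:
  assumes a: "a \<in> dirichlet_polys" and b: "b \<in> dirichlet_polys" and p: "0 < p" "0 < q"
  shows "shift_power \<nu> p q (\<lambda>n. a n + b n) \<le> ennreal (quasi_const p q) * (shift_power \<nu> p q a + shift_power \<nu> p q b)"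
proof -
  have [measurable]: "(\<lambda>\<sigma>. hardy_norm p (dshift \<sigma> a)) \<in> borel_measurable \<nu>" "(\<lambda>\<sigma>. hardy_norm p (dshift \<sigma> b)) \<in> borel_measurable \<nu>"
    by (intro measurable_hardy_norm_dshift a b)+
  have "shift_power \<nu> p q (\<lambda>n. a n + b n)
      \<le> (\<integral>\<^sup>+\<sigma>. ennreal (quasi_const p q) * (ennreal (hardy_norm p (dshift \<sigma> a) powr q) + ennreal (hardy_norm p (dshift \<sigma> b) powr q)) \<partial>\<nu>)"
    unfolding shift_power_def
  proof (intro nn_integral_mono)
    fix \<sigma>
    have "dshift \<sigma> (\<lambda>n. a n + b n) = (\<lambda>n. dshift \<sigma> a n + dshift \<sigma> b n)"
      by (simp add: dshift_def algebra_simps)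
    then show "ennreal (hardy_norm p (dshift \<sigma> (\<lambda>n. a n + b n)) powr q)
        \<le> ennreal (quasi_const p q) * (ennreal (hardy_norm p (dshift \<sigma> a) powr q) + ennreal (hardy_norm p (dshift \<sigma> b) powr q))"
      using hardy_norm_add_powr[OF dshift_dirichlet_polys[OF a] dshift_dirichlet_polys[OF b] p, of \<sigma> \<sigma>]
      by (simp add: quasi_const_def ennreal_leI flip: ennreal_plus ennreal_mult)
  qed
  also have "\<dots> = ennreal (quasi_const p q) * (shift_power \<nu> p q a + shift_power \<nu> p q b)"
    unfolding shift_power_def by (subst nn_integral_cmult) (auto simp: nn_integral_add)
  finally show ?thesis .
qed

lemma shift_power_scale:
  assumes a: "a \<in> dirichlet_polys" and p: "0 < p"
  shows "shift_power \<nu> p q (\<lambda>n. c * a n) = ennreal (norm c powr q) * shift_power \<nu> p q a"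
proof -
  have [measurable]: "(\<lambda>\<sigma>. hardy_norm p (dshift \<sigma> a)) \<in> borel_measurable \<nu>"
    by (intro measurable_hardy_norm_dshift a)
  have "dshift \<sigma> (\<lambda>n. c * a n) = (\<lambda>n. c * dshift \<sigma> a n)" for \<sigma>
    by (simp add: dshift_def mult.assoc)
  then show ?thesis
    unfolding shift_power_def using hardy_norm_scale[OF dshift_dirichlet_polys[OF a] p]
    by (simp add: powr_mult hardy_norm_nonneg ennreal_mult nn_integral_cmult)
qed

lemma shift_power_minus_commute:
  assumes a: "a \<in> dirichlet_polys" and b: "b \<in> dirichlet_polys" and p: "0 < p"
  shows "shift_power \<nu> p q (\<lambda>n. a n - b n) = shift_power \<nu> p q (\<lambda>n. b n - a n)"
  using shift_power_scale[OF dirichlet_polys_diff(1)[OF a b] p, of q "-1"] by simp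

lemma shift_power_mono:
  assumes a: "a \<in> dirichlet_polys" and p: "0 < p" "p \<le> p'" and q: "0 < q"
  shows "shift_power \<nu> p q a \<le> shift_power \<nu> p' q a"
  unfolding shift_power_def using q hardy_norm_mono[OF dshift_dirichlet_polys[OF a] p]
  by (auto intro!: nn_integral_mono ennreal_leI powr_mono2 hardy_norm_nonneg)

lemma shift_power_bounded:
  fixes P :: "nat \<Rightarrow> nat \<Rightarrow> complex"
  assumes p: "0 < p" "0 < q" and P: "\<And>k. P k \<in> dirichlet_polys"
    and Cauchy: "\<And>\<epsilon>. \<epsilon> > 0 \<Longrightarrow> \<exists>K. \<forall>k\<ge>K. \<forall>l\<ge>K. shift_power \<nu> p q (\<lambda>n. P k n - P l n) < ennreal \<epsilon>"
  obtains K C where "0 \<le> C" "\<And>k. k \<ge> K \<Longrightarrow> shift_power \<nu> p q (P k) \<le> ennreal C"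
proof -
  obtain K where *: "\<forall>k\<ge>K. \<forall>l\<ge>K. shift_power \<nu> p q (\<lambda>n. P k n - P l n) < ennreal 1"
    using Cauchy[OF zero_less_one] by blast
  have K: "shift_power \<nu> p q (\<lambda>n. P k n - P K n) < ennreal 1" if "k \<ge> K" for k
    by (rule *[rule_format]) (use that in auto)
  define D where "D = ennreal (quasi_const p q) * (ennreal 1 + shift_power \<nu> p q (P K))"
  have "D < \<infinity>"
    using shift_power_finite[OF P p, of K] by (auto simp: D_def ennreal_mult_less_top)
  moreover have "shift_power \<nu> p q (P k) \<le> D" if "k \<ge> K" for k
  proof -
    have "shift_power \<nu> p q (\<lambda>n. (P k n - P K n) + P K n) \<le> ennreal (quasi_const p q) * (shift_power \<nu> p q (\<lambda>n. P k n - P K n) + shift_power \<nu> p q (P K))"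
      by (intro shift_power_add dirichlet_polys_diff P p)
    also have "\<dots> \<le> D"
      unfolding D_def using K[OF that] by (intro mult_left_mono add_mono) auto
    finally show ?thesis by simp
  qed
  ultimately show ?thesis
    using that[of "enn2real D" K] by simp
qed


section \<open>Square sums and the exponent p = 2\<close>

definition square_space :: "real \<Rightarrow> (nat \<Rightarrow> complex) set" where
  "square_space q = {a. a 0 = 0 \<and> (\<exists>C. \<forall>N. shift_power \<nu> 2 q (restrict_coeffs {1..N} a) \<le> ennreal C)}"

text \<open>Fatou bounds the integral of the liminf. The square sums increase with N, so a finite
  liminf at \<sigma> bounds all of them.\<close>

lemma square_spaceD:
  assumes a: "a \<in> square_space q" and q: "0 < q"
  shows "(\<integral>\<^sup>+\<sigma>. liminf (\<lambda>N. ennreal ((\<Sum>n\<in>{1..N}. (norm (dshift \<sigma> a n))\<^sup>2) powr (q / 2))) \<partial>\<nu>) < \<infinity>"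
    and "AE \<sigma> in \<nu>. summable (\<lambda>n. (norm (dshift \<sigma> a n))\<^sup>2)"
proof -
  let ?f = "\<lambda>N \<sigma>. (\<Sum>n\<in>{1..N}. (norm (dshift \<sigma> a n))\<^sup>2) powr (q / 2)"
  obtain C where C: "\<And>N. shift_power \<nu> 2 q (restrict_coeffs {1..N} a) \<le> ennreal C" and a0: "a 0 = 0"
    using a by (auto simp: square_space_def)
  have "(\<integral>\<^sup>+\<sigma>. liminf (\<lambda>N. ennreal (?f N \<sigma>)) \<partial>\<nu>) \<le> liminf (\<lambda>N. \<integral>\<^sup>+\<sigma>. ennreal (?f N \<sigma>) \<partial>\<nu>)"
    by (rule nn_integral_liminf) measurable
  also have "\<dots> \<le> liminf (\<lambda>N::nat. ennreal C)"
    using C by (intro Liminf_mono always_eventually) (simp add: shift_power_2_restrict)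
  also have "\<dots> < \<infinity>" by (simp add: Liminf_const)
  finally show *: "(\<integral>\<^sup>+\<sigma>. liminf (\<lambda>N. ennreal (?f N \<sigma>)) \<partial>\<nu>) < \<infinity>" .
  then have "AE \<sigma> in \<nu>. liminf (\<lambda>N. ennreal (?f N \<sigma>)) \<noteq> \<infinity>"
    by (intro nn_integral_PInf_AE) auto
  then show "AE \<sigma> in \<nu>. summable (\<lambda>n. (norm (dshift \<sigma> a n))\<^sup>2)"
  proof eventually_elim
    case (elim \<sigma>)
    define c where "c = enn2real (liminf (\<lambda>N. ennreal (?f N \<sigma>)))"
    have c: "liminf (\<lambda>N. ennreal (?f N \<sigma>)) = ennreal c"
      using elim by (simp add: c_def less_top)
    have mono: "?f N \<sigma> \<le> ?f N' \<sigma>" if "N \<le> N'" for N N'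
      using that q by (intro powr_mono2 sum_mono2 sum_nonneg) auto
    have "ennreal (?f N \<sigma>) \<le> liminf (\<lambda>N. ennreal (?f N \<sigma>))" for N
      using mono by (intro Liminf_bounded) (auto simp: eventually_sequentially intro!: exI[of _ N] ennreal_leI)
    then have le: "?f N \<sigma> \<le> c" for N
      unfolding c by (simp add: c_def)
    have "(\<Sum>n\<in>{1..N}. (norm (dshift \<sigma> a n))\<^sup>2) \<le> c powr (2 / q)" for N
    proof -
      have "(?f N \<sigma>) powr (2 / q) \<le> c powr (2 / q)"
        using le q by (intro powr_mono2) auto
      then show ?thesis
        using q by (simp add: powr_powr sum_nonneg)
    qed
    moreover have "(\<Sum>n<N. (norm (dshift \<sigma> a n))\<^sup>2) \<le> (\<Sum>n\<in>{1..N}. (norm (dshift \<sigma> a n))\<^sup>2)" for N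
    proof -
      have "(\<Sum>n<N. (norm (dshift \<sigma> a n))\<^sup>2) = (\<Sum>n\<in>{1..<N}. (norm (dshift \<sigma> a n))\<^sup>2)"
        using a0 by (intro sum.mono_neutral_right) (auto simp: dshift_def not_le)
      also have "\<dots> \<le> (\<Sum>n\<in>{1..N}. (norm (dshift \<sigma> a n))\<^sup>2)"
        by (intro sum_mono2) auto
      finally show ?thesis .
    qed
    ultimately show ?case
      by (intro summableI_nonneg_bounded[of _ "c powr (2 / q)"]) (auto intro: order_trans)
  qed
qed

text \<open>Dominated convergence for the tails of the square sums, with the whole sum as majorant;
  the bound \<open>D M\<close> is uniform in the upper end N.\<close>

lemma square_space_tail:
  assumes a: "a \<in> square_space q" and q: "0 < q"
  obtains D where "D \<longlonglongrightarrow> 0" "\<And>M N. shift_power \<nu> 2 q (restrict_coeffs {M<..N} a) \<le> D M"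
proof -
  have a0: "a 0 = 0" using a by (simp add: square_space_def)
  \<comment> \<open>Where the series diverges this infinite sum is an unspecified default; such
    \<sigma> form a null set, so every comparison below is made almost everywhere.\<close>
  define w where "w M \<sigma> = (\<Sum>n. (norm (dshift \<sigma> a (n + Suc M)))\<^sup>2) powr (q / 2)" for M \<sigma>
  have meas[measurable]: "w M \<in> borel_measurable \<nu>" for M
    unfolding w_def by measurable
  define D where "D M = (\<integral>\<^sup>+\<sigma>. ennreal (w M \<sigma>) \<partial>\<nu>)" for M
  note sum = square_spaceD(2)[OF a q]
  have w0: "AE \<sigma> in \<nu>. ennreal (w 0 \<sigma>) = liminf (\<lambda>N. ennreal ((\<Sum>n\<in>{1..N}. (norm (dshift \<sigma> a n))\<^sup>2) powr (q / 2)))"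
    using sum
  proof eventually_elim
    case (elim \<sigma>)
    have "(\<lambda>N. \<Sum>n<N. (norm (dshift \<sigma> a (n + Suc 0)))\<^sup>2) \<longlonglongrightarrow> (\<Sum>n. (norm (dshift \<sigma> a (n + Suc 0)))\<^sup>2)"
      by (intro summable_LIMSEQ summable_ignore_initial_segment elim)
    also have "(\<lambda>N. \<Sum>n<N. (norm (dshift \<sigma> a (n + Suc 0)))\<^sup>2) = (\<lambda>N. \<Sum>n\<in>{1..N}. (norm (dshift \<sigma> a n))\<^sup>2)"
      by (intro ext sum.reindex_bij_witness[of _ "\<lambda>n. n - 1" Suc]) auto
    finally have "(\<lambda>N. ennreal ((\<Sum>n\<in>{1..N}. (norm (dshift \<sigma> a n))\<^sup>2) powr (q / 2))) \<longlonglongrightarrow> ennreal (w 0 \<sigma>)"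
      unfolding w_def using q by (intro tendsto_ennrealI tendsto_powr') (auto intro!: always_eventually sum_nonneg)
    then show ?case
      by (intro lim_imp_Liminf[symmetric]) auto
  qed
  have fin: "(\<integral>\<^sup>+\<sigma>. ennreal (w 0 \<sigma>) \<partial>\<nu>) < \<infinity>"
    using nn_integral_cong_AE[OF w0] square_spaceD(1)[OF a q] by simp
  have "D \<longlonglongrightarrow> (\<integral>\<^sup>+\<sigma>. 0 \<partial>\<nu>)"
    unfolding D_def
  proof (rule nn_integral_dominated_convergence[where w="\<lambda>\<sigma>. ennreal (w 0 \<sigma>)"])
    show "AE \<sigma> in \<nu>. ennreal (w M \<sigma>) \<le> ennreal (w 0 \<sigma>)" for M
      using sum
    proof eventually_elim
      case (elim \<sigma>)
      let ?g = "\<lambda>n. (norm (dshift \<sigma> a (n + Suc 0)))\<^sup>2"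
      have s: "summable ?g" by (intro summable_ignore_initial_segment elim)
      have "(\<Sum>n. ?g (n + M)) \<le> (\<Sum>n. ?g n)"
        using suminf_split_initial_segment[OF s, of M] by (simp add: sum_nonneg)
      then show ?case
        unfolding w_def using q s
        by (intro ennreal_leI powr_mono2 suminf_nonneg summable_ignore_initial_segment elim) (auto simp: add_ac)
    qed
    show "AE \<sigma> in \<nu>. (\<lambda>M. ennreal (w M \<sigma>)) \<longlonglongrightarrow> 0"
      using sum
    proof eventually_elim
      case (elim \<sigma>)
      have "(\<lambda>M. \<Sum>n. (norm (dshift \<sigma> a (n + Suc M)))\<^sup>2) \<longlonglongrightarrow> 0"
        by (rule LIMSEQ_Suc[OF suminf_exist_split2[OF elim]])
      then show ?case
        unfolding w_def using q
        by (intro tendsto_ennreal_powr_zero suminf_nonneg summable_ignore_initial_segment elim) auto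
    qed
  qed (use fin in auto)
  then have "D \<longlonglongrightarrow> 0" by simp
  moreover have "shift_power \<nu> 2 q (restrict_coeffs {M<..N} a) \<le> D M" for M N
  proof -
    have "shift_power \<nu> 2 q (restrict_coeffs {M<..N} a)
        = (\<integral>\<^sup>+\<sigma>. ennreal ((\<Sum>n\<in>{M<..N}. (norm (dshift \<sigma> a n))\<^sup>2) powr (q / 2)) \<partial>\<nu>)"
      by (intro shift_power_2_restrict) auto
    also have "\<dots> \<le> D M"
      unfolding D_def using sum
    proof (intro nn_integral_mono_AE, eventually_elim)
      case (elim \<sigma>)
      have "(\<Sum>n\<in>{M<..N}. (norm (dshift \<sigma> a n))\<^sup>2) = (\<Sum>n<N - M. (norm (dshift \<sigma> a (n + Suc M)))\<^sup>2)"
        by (intro sum.reindex_bij_witness[of _ "\<lambda>n. n + Suc M" "\<lambda>n. n - Suc M"]) auto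
      also have "\<dots> \<le> (\<Sum>n. (norm (dshift \<sigma> a (n + Suc M)))\<^sup>2)"
        by (intro sum_le_suminf summable_ignore_initial_segment elim) auto
      finally show ?case
        unfolding w_def using q by (intro ennreal_leI powr_mono2 sum_nonneg) auto
    qed
    finally show ?thesis .
  qed
  ultimately show ?thesis using that by blast
qed

text \<open>Divergence at s forces divergence at every smaller \<sigma>, hence on a set of positive
  measure by \<open>pos_near_0\<close>.\<close>

lemma square_space_summable:
  assumes a: "a \<in> square_space q" and q: "0 < q" and s: "0 < s"
  shows "summable (\<lambda>n. (norm (dshift s a n))\<^sup>2)"
proof (rule ccontr)
  assume ns: "\<not> summable (\<lambda>n. (norm (dshift s a n))\<^sup>2)"
  then have "\<not> summable (\<lambda>n. (norm (dshift \<sigma> a n))\<^sup>2)" if "\<sigma> \<le> s" for \<sigma>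
    using summable_dshift_mono that by blast
  then have "AE \<sigma> in \<nu>. \<sigma> \<notin> {..s}"
    using square_spaceD(2)[OF a q] by (auto elim!: eventually_mono)
  then have "emeasure \<nu> {..s} = 0"
    by (subst (asm) AE_iff_measurable[of "{..s}"]) auto
  with pos_near_0[OF s] show False ..
qed

text \<open>For exponent 2 truncation is a contraction, so a bound on approximating polynomials
  passes to their truncations and, by Fatou, to the truncations of the limit. Conversely the partial
  sums are Cauchy by the tail estimate.\<close>

lemma completion_2_eq:
  assumes q: "0 < q"
  shows "dirichlet_completion (shift_norm \<nu> 2 q) = square_space q"
proof (intro equalityI subsetI)
  fix a assume "a \<in> dirichlet_completion (shift_norm \<nu> 2 q)"
  then obtain P where a0: "a 0 = 0" and P: "\<And>k. P k \<in> dirichlet_polys" and lim: "\<And>n. (\<lambda>k. P k n) \<longlonglongrightarrow> a n"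
    and Cauchy: "\<And>\<epsilon>. \<epsilon> > 0 \<Longrightarrow> \<exists>K. \<forall>k\<ge>K. \<forall>l\<ge>K. shift_power \<nu> 2 q (\<lambda>n. P k n - P l n) < ennreal \<epsilon>"
    using q by (auto simp: mem_completion_iff)
  obtain K C where C: "\<And>k. k \<ge> K \<Longrightarrow> shift_power \<nu> 2 q (P k) \<le> ennreal C"
    by (rule shift_power_bounded[OF _ q P Cauchy]) auto
  have "shift_power \<nu> 2 q (restrict_coeffs {1..N} a) \<le> ennreal C" for N
  proof -
    let ?f = "\<lambda>b \<sigma>. (\<Sum>n\<in>{1..N}. (norm (dshift \<sigma> b n))\<^sup>2) powr (q / 2)"
    have "shift_power \<nu> 2 q (restrict_coeffs {1..N} a) = (\<integral>\<^sup>+\<sigma>. ennreal (?f a \<sigma>) \<partial>\<nu>)"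
      by (rule shift_power_2_restrict) auto
    also have "\<dots> = (\<integral>\<^sup>+\<sigma>. liminf (\<lambda>k. ennreal (?f (P k) \<sigma>)) \<partial>\<nu>)"
    proof (intro nn_integral_cong lim_imp_Liminf[symmetric])
      show "(\<lambda>k. ennreal (?f (P k) \<sigma>)) \<longlonglongrightarrow> ennreal (?f a \<sigma>)" for \<sigma>
        unfolding dshift_def using q
        by (intro tendsto_ennrealI tendsto_powr' tendsto_intros lim) (auto intro!: always_eventually sum_nonneg)
    qed simp
    also have "\<dots> \<le> liminf (\<lambda>k. \<integral>\<^sup>+\<sigma>. ennreal (?f (P k) \<sigma>) \<partial>\<nu>)"
      by (rule nn_integral_liminf) measurable
    also have "\<dots> \<le> liminf (\<lambda>k::nat. ennreal C)"
    proof (intro Liminf_mono, unfold eventually_sequentially, intro exI[of _ K] allI impI)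
      fix k assume "K \<le> k"
      obtain N' where N': "P k = restrict_coeffs {1..N'} (P k)"
        using P by (rule dirichlet_polys_restrictE)
      then have z: "P k n = 0" if "n \<notin> {1..N'}" for n
        using that by (metis restrict_coeffs_simps(2))
      \<comment> \<open>The truncation contracts: enlarging the index range to cover the support of
        P k only adds squares.\<close>
      have "(\<integral>\<^sup>+\<sigma>. ennreal (?f (P k) \<sigma>) \<partial>\<nu>) \<le> (\<integral>\<^sup>+\<sigma>. ennreal ((\<Sum>n\<in>{1..max N N'}. (norm (dshift \<sigma> (P k) n))\<^sup>2) powr (q / 2)) \<partial>\<nu>)"
        using q by (intro nn_integral_mono ennreal_leI powr_mono2 sum_mono2 sum_nonneg) auto
      also have "\<dots> = shift_power \<nu> 2 q (P k)"
        using z by (intro shift_power_2[symmetric]) auto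
      also have "\<dots> \<le> ennreal C"
        using C \<open>K \<le> k\<close> by blast
      finally show "(\<integral>\<^sup>+\<sigma>. ennreal (?f (P k) \<sigma>) \<partial>\<nu>) \<le> ennreal C" .
    qed
    finally show ?thesis by (simp add: Liminf_const)
  qed
  then show "a \<in> square_space q"
    using a0 by (auto simp: square_space_def)
next
  fix a assume a: "a \<in> square_space q"
  then have a0: "a 0 = 0" by (simp add: square_space_def)
  obtain D where D: "D \<longlonglongrightarrow> 0" "\<And>M N. shift_power \<nu> 2 q (restrict_coeffs {M<..N} a) \<le> D M"
    using square_space_tail[OF a q] by blast
  define P where "P k = restrict_coeffs {1..k} a" for k
  have P: "P k \<in> dirichlet_polys" for k
    unfolding P_def using a0 by (intro restrict_coeffs_polys) auto
  show "a \<in> dirichlet_completion (shift_norm \<nu> 2 q)"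
    unfolding mem_completion_iff[OF zero_less_numeral q]
  proof (intro conjI exI[of _ P] allI impI)
    fix \<epsilon> :: real assume "\<epsilon> > 0"
    then obtain K where K: "\<And>k. k \<ge> K \<Longrightarrow> D k < ennreal \<epsilon>"
      using order_tendstoD(2)[OF D(1), of "ennreal \<epsilon>"] by (auto simp: eventually_sequentially)
    have le: "shift_power \<nu> 2 q (\<lambda>n. P k n - P l n) < ennreal \<epsilon>" if "K \<le> l" "l \<le> k" for k l
      using D(2)[of l k] K[OF that(1)] unfolding P_def restrict_coeffs_diff[OF that(2)]
      by (rule le_less_trans)
    show "\<exists>K. \<forall>k\<ge>K. \<forall>l\<ge>K. shift_power \<nu> 2 q (\<lambda>n. P k n - P l n) < ennreal \<epsilon>"
    proof (intro exI[of _ K] allI impI)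
      fix k l assume "K \<le> k" "K \<le> l"
      then show "shift_power \<nu> 2 q (\<lambda>n. P k n - P l n) < ennreal \<epsilon>"
        using le[of k l] le[of l k] shift_power_minus_commute[OF P P, of 2 q k l]
        by (cases "l \<le> k") auto
    qed
  next
    fix n
    show "(\<lambda>k. P k n) \<longlonglongrightarrow> a n"
      using a0 by (intro tendsto_eventually, unfold eventually_sequentially)
        (auto intro!: exI[of _ n] simp: P_def restrict_coeffs_def not_le)
  qed (use a0 P square_space_summable[OF a q] in \<open>auto intro: converges_half_plane\<close>)
qed

end

section \<open>Sums of independent coefficients\<close>

text \<open>Reduces absolute moments to exponential moments exp(Re (u s)) in the four directions u =
  1, -1, \<i>, -\<i>, which independence factorises.\<close>

lemma norm_power_le_exp:
  fixes s :: complex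
  shows "norm s ^ k \<le> 2 ^ k * fact k * (exp (Re s) + exp (Re (- s)) + exp (Re (\<i> * s)) + exp (Re (- \<i> * s)))"
proof -
  have abs_le: "\<bar>x\<bar> ^ k \<le> fact k * (exp x + exp (- x))" for x :: real
  proof -
    have "\<bar>x\<bar> ^ k / fact k \<le> exp \<bar>x\<bar>"
    proof -
      have "sum (\<lambda>n. \<bar>x\<bar> ^ n /\<^sub>R fact n) {k} \<le> (\<Sum>n. \<bar>x\<bar> ^ n /\<^sub>R fact n)"
        by (intro sum_le_suminf summable_exp_generic) auto
      then show ?thesis by (simp add: exp_def field_simps)
    qed
    then have "\<bar>x\<bar> ^ k \<le> fact k * exp \<bar>x\<bar>" by (simp add: field_simps)
    also have "exp \<bar>x\<bar> \<le> exp x + exp (- x)" by (auto simp: abs_if add_increasing add_increasing2)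
    finally show ?thesis by simp
  qed
  have "norm s ^ k \<le> (2 * max \<bar>Re s\<bar> \<bar>Im s\<bar>) ^ k"
    using cmod_le[of s] by (intro power_mono) auto
  also have "\<dots> = 2 ^ k * max \<bar>Re s\<bar> \<bar>Im s\<bar> ^ k" by (simp add: power_mult_distrib)
  also have "max \<bar>Re s\<bar> \<bar>Im s\<bar> ^ k \<le> \<bar>Re s\<bar> ^ k + \<bar>Im s\<bar> ^ k" by (auto simp: max_def)
  also have "\<dots> \<le> fact k * (exp (Re s) + exp (- Re s)) + fact k * (exp (Im s) + exp (- Im s))"
    by (intro add_mono abs_le)
  finally show ?thesis by (simp add: algebra_simps)
qed

lemma (in prob_space) prob_Int_ge:
  assumes "A \<in> sets M" "B \<in> sets M"
  shows "prob A + prob B - 1 \<le> prob (A \<inter> B)"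
proof -
  have "prob (A \<union> B) = prob A + prob B - prob (A \<inter> B)"
    using assms by (intro measure_Un3) (auto simp: fmeasurable_eq_sets)
  then show ?thesis
    using prob_le_1[of "A \<union> B"] by linarith
qed

text \<open>The factor 2^k k! of \<open>norm_power_le_exp\<close> times four exponential moments of
  size at most exp(1/2).\<close>

definition moment_const :: "nat \<Rightarrow> real" where
  "moment_const k = 2 ^ k * (4 * fact k * exp (1/2))"

text \<open>What the three types of variables share. The exponential bound has the Gaussian constant
  and yields Khintchine's inequality, the second moment serves the lower bound, and symmetry allows
  flipping signs.\<close>

locale random_coeffs = prob_space M for M :: "'w measure" +
  fixes X :: "nat \<Rightarrow> 'w \<Rightarrow> complex"
  assumes indep: "indep_vars (\<lambda>_. borel) X {1..}"
    and second_moment: "1 \<le> n \<Longrightarrow> (\<integral>\<^sup>+\<omega>. ennreal ((norm (X n \<omega>))\<^sup>2) \<partial>M) = 1"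
    and symmetric: "1 \<le> n \<Longrightarrow> distr M borel (\<lambda>\<omega>. - X n \<omega>) = distr M borel (X n)"
    and subgaussian: "1 \<le> n \<Longrightarrow> (\<integral>\<^sup>+\<omega>. ennreal (exp (Re (c * X n \<omega>))) \<partial>M) \<le> ennreal (exp ((norm c)\<^sup>2 / 2))"
begin

lemma measurable_X: "1 \<le> n \<Longrightarrow> X n \<in> borel_measurable M"
  using indep by (auto simp: indep_vars_def)

lemma integrable_X_sq:
  assumes "1 \<le> n"
  shows "integrable M (\<lambda>\<omega>. (norm (X n \<omega>))\<^sup>2)" and "(LINT \<omega>|M. (norm (X n \<omega>))\<^sup>2) = 1"
proof -
  have [measurable]: "X n \<in> borel_measurable M" by (rule measurable_X[OF assms])
  show "integrable M (\<lambda>\<omega>. (norm (X n \<omega>))\<^sup>2)"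
    by (rule integrableI_bounded) (auto simp: second_moment[OF assms])
  show "(LINT \<omega>|M. (norm (X n \<omega>))\<^sup>2) = 1"
    by (subst integral_eq_nn_integral) (auto simp: second_moment[OF assms])
qed

lemma integrable_X: "1 \<le> n \<Longrightarrow> integrable M (X n)"
proof (rule Bochner_Integration.integrable_bound[where f="\<lambda>\<omega>. 1 + (norm (X n \<omega>))\<^sup>2"])
  assume n: "1 \<le> n"
  show "integrable M (\<lambda>\<omega>. 1 + (norm (X n \<omega>))\<^sup>2)"
    using integrable_X_sq(1)[OF n] by simp
  have "x \<le> 1 + x\<^sup>2" if "0 \<le> x" for x :: real
    using that sum_squares_bound[of x 1] by simp
  then show "AE \<omega> in M. norm (X n \<omega>) \<le> norm (1 + (norm (X n \<omega>))\<^sup>2)"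
    by simp
qed (rule measurable_X)

lemma expectation_X:
  assumes "1 \<le> n"
  shows "(LINT \<omega>|M. X n \<omega>) = 0"
proof -
  have [measurable]: "X n \<in> borel_measurable M" by (rule measurable_X[OF assms])
  have "(LINT \<omega>|M. X n \<omega>) = (LINT x|distr M borel (X n). x)"
    by (subst integral_distr) auto
  also have "\<dots> = (LINT x|distr M borel (\<lambda>\<omega>. - X n \<omega>). x)"
    by (simp add: symmetric[OF assms])
  also have "\<dots> = - (LINT \<omega>|M. X n \<omega>)"
    by (subst integral_distr) auto
  finally show ?thesis by simp
qed

lemma expectation_X_cnj:
  assumes "1 \<le> n" "1 \<le> m"
  shows "integrable M (\<lambda>\<omega>. X n \<omega> * cnj (X m \<omega>))"
    and "(LINT \<omega>|M. X n \<omega> * cnj (X m \<omega>)) = (if n = m then 1 else 0)"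
proof -
  have "integrable M (\<lambda>\<omega>. X n \<omega> * cnj (X m \<omega>)) \<and> (LINT \<omega>|M. X n \<omega> * cnj (X m \<omega>)) = (if n = m then 1 else 0)"
  proof (cases "n = m")
    case True
    then show ?thesis
      using integrable_X_sq[OF assms(1)]
      by (simp flip: complex_norm_square of_real_power)
  next
    case False
    \<comment> \<open>Only the second factor is conjugated, which puts the product into the form of
      an independent pair.\<close>
    define Y where "Y i = (if i = m then cnj else id)" for i
    have *: "indep_vars (\<lambda>_. borel) (\<lambda>i \<omega>. Y i (X i \<omega>)) {n, m}"
      by (rule indep_vars_compose2[OF indep_vars_subset[OF indep]]) (use assms in \<open>auto simp: Y_def\<close>)
    have int: "integrable M (\<lambda>\<omega>. Y i (X i \<omega>))" if "i \<in> {n, m}" for i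
      using that assms integrable_X by (auto simp: Y_def)
    show ?thesis
      using indep_vars_lebesgue_integral[OF _ * int] indep_vars_integrable[OF _ * int] False
        expectation_X[OF assms(1)]
      by (simp add: Y_def integral_cnj)
  qed
  then show "integrable M (\<lambda>\<omega>. X n \<omega> * cnj (X m \<omega>))"
    and "(LINT \<omega>|M. X n \<omega> * cnj (X m \<omega>)) = (if n = m then 1 else 0)" by auto
qed

lemma nn_integral_sum_sq:
  assumes F: "finite F" "F \<subseteq> {1..}"
  shows "(\<integral>\<^sup>+\<omega>. ennreal ((norm (\<Sum>n\<in>F. c n * X n \<omega>))\<^sup>2) \<partial>M) = ennreal (\<Sum>n\<in>F. (norm (c n))\<^sup>2)"
proof -
  let ?S = "\<lambda>\<omega>. \<Sum>n\<in>F. c n * X n \<omega>"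
  have X: "1 \<le> n" if "n \<in> F" for n using that F by auto
  have [measurable]: "X n \<in> borel_measurable M" if "n \<in> F" for n by (intro measurable_X X that)
  have expand: "of_real ((norm (?S \<omega>))\<^sup>2) = (\<Sum>n\<in>F. \<Sum>m\<in>F. c n * cnj (c m) * (X n \<omega> * cnj (X m \<omega>)))" for \<omega>
    unfolding complex_norm_square cnj_sum sum_product complex_cnj_mult by (intro sum.cong refl) (simp only: ac_simps)
  have int: "integrable M (\<lambda>\<omega>. \<Sum>n\<in>F. \<Sum>m\<in>F. c n * cnj (c m) * (X n \<omega> * cnj (X m \<omega>)))"
    by (intro Bochner_Integration.integrable_sum integrable_mult_right expectation_X_cnj X)
  then have int': "integrable M (\<lambda>\<omega>. (norm (?S \<omega>))\<^sup>2)"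
    unfolding expand[symmetric] complex_of_real_integrable_eq .
  have "of_real (LINT \<omega>|M. (norm (?S \<omega>))\<^sup>2)
      = (LINT \<omega>|M. (\<Sum>n\<in>F. \<Sum>m\<in>F. c n * cnj (c m) * (X n \<omega> * cnj (X m \<omega>))))"
    by (simp only: expand flip: integral_complex_of_real)
  also have "\<dots> = (\<Sum>n\<in>F. \<Sum>m\<in>F. c n * cnj (c m) * (LINT \<omega>|M. X n \<omega> * cnj (X m \<omega>)))"
    using expectation_X_cnj X by (simp add: integral_sum integral_mult_right_zero)
  also have "\<dots> = (\<Sum>n\<in>F. \<Sum>m\<in>F. if m = n then c n * cnj (c n) else 0)"
    by (intro sum.cong refl) (simp add: expectation_X_cnj(2)[OF X X])
  also have "\<dots> = of_real (\<Sum>n\<in>F. (norm (c n))\<^sup>2)"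
    unfolding of_real_sum complex_norm_square using F(1) by (intro sum.cong refl) simp
  finally have "(LINT \<omega>|M. (norm (?S \<omega>))\<^sup>2) = (\<Sum>n\<in>F. (norm (c n))\<^sup>2)"
    by (simp only: of_real_eq_iff)
  then show ?thesis
    using int' by (simp add: nn_integral_eq_integral)
qed

lemma nn_integral_exp_sum:
  assumes F: "finite F" "F \<subseteq> {1..}"
  shows "(\<integral>\<^sup>+\<omega>. ennreal (exp (Re (\<Sum>n\<in>F. c n * X n \<omega>))) \<partial>M) \<le> ennreal (exp ((\<Sum>n\<in>F. (norm (c n))\<^sup>2) / 2))"
proof -
  have "indep_vars (\<lambda>_. borel) (\<lambda>n \<omega>. ennreal (exp (Re (c n * X n \<omega>)))) F"
    by (rule indep_vars_compose2[OF indep_vars_subset[OF indep F(2)]]) measurable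
  then have "(\<integral>\<^sup>+\<omega>. (\<Prod>n\<in>F. ennreal (exp (Re (c n * X n \<omega>)))) \<partial>M)
      = (\<Prod>n\<in>F. \<integral>\<^sup>+\<omega>. ennreal (exp (Re (c n * X n \<omega>))) \<partial>M)"
    using F(1) by (intro indep_vars_nn_integral) auto
  also have "\<dots> \<le> (\<Prod>n\<in>F. ennreal (exp ((norm (c n))\<^sup>2 / 2)))"
    using F by (intro prod_mono_ennreal subgaussian) auto
  also have "\<dots> = ennreal (exp ((\<Sum>n\<in>F. (norm (c n))\<^sup>2) / 2))"
    using F(1) by (simp add: prod_ennreal exp_sum sum_divide_distrib)
  finally show ?thesis
    using F(1) by (simp add: prod_ennreal exp_sum)
qed

text \<open>Once the square sum is normalised to 1, independence bounds each of the four exponential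
  moments by exp(1/2); homogeneity restores the factor v^k.\<close>

lemma khintchine:
  assumes F: "finite F" "F \<subseteq> {1..}" and k: "0 < k"
  shows "(\<integral>\<^sup>+\<omega>. ennreal (norm (\<Sum>n\<in>F. c n * X n \<omega>) ^ k) \<partial>M) \<le> ennreal (moment_const k * sqrt (\<Sum>n\<in>F. (norm (c n))\<^sup>2) ^ k)"
proof (cases "(\<Sum>n\<in>F. (norm (c n))\<^sup>2) = 0")
  case True
  then have "c n = 0" if "n \<in> F" for n
    using that F(1) by (simp add: sum_nonneg_eq_0_iff)
  then show ?thesis using k by (simp add: zero_power)
next
  case False
  define v where "v = sqrt (\<Sum>n\<in>F. (norm (c n))\<^sup>2)"
  have v: "0 < v" "v\<^sup>2 = (\<Sum>n\<in>F. (norm (c n))\<^sup>2)"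
    using False by (auto simp: v_def less_le sum_nonneg)
  define S where "S \<omega> = (\<Sum>n\<in>F. (c n / of_real v) * X n \<omega>)" for \<omega>
  have [measurable]: "S \<in> borel_measurable M"
    unfolding S_def using F measurable_X by (intro borel_measurable_sum borel_measurable_times) auto
  have exp_le: "(\<integral>\<^sup>+\<omega>. ennreal (exp (Re (u * S \<omega>))) \<partial>M) \<le> ennreal (exp (1/2))" if "norm u = 1" for u
  proof -
    have "(\<Sum>n\<in>F. (norm (u * (c n / of_real v)))\<^sup>2) = (\<Sum>n\<in>F. (norm (c n))\<^sup>2) / v\<^sup>2"
      using that by (simp add: norm_mult norm_divide power_divide sum_divide_distrib)
    also have "\<dots> = 1" using v False by simp
    finally show ?thesis
      using nn_integral_exp_sum[OF F, of "\<lambda>n. u * (c n / of_real v)"]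
      by (simp add: S_def sum_distrib_left mult.assoc)
  qed
  have eq: "norm (\<Sum>n\<in>F. c n * X n \<omega>) ^ k = v ^ k * norm (S \<omega>) ^ k" for \<omega>
  proof -
    have "(\<Sum>n\<in>F. c n * X n \<omega>) = of_real v * S \<omega>"
      using v by (simp add: S_def sum_distrib_left)
    then show ?thesis using v by (simp add: norm_mult power_mult_distrib)
  qed
  have "(\<integral>\<^sup>+\<omega>. ennreal (norm (S \<omega>) ^ k) \<partial>M)
      \<le> (\<integral>\<^sup>+\<omega>. ennreal (2 ^ k * fact k) * (ennreal (exp (Re (1 * S \<omega>))) + ennreal (exp (Re (-1 * S \<omega>)))
           + ennreal (exp (Re (\<i> * S \<omega>))) + ennreal (exp (Re (- \<i> * S \<omega>)))) \<partial>M)"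
    using norm_power_le_exp by (intro nn_integral_mono) (simp add: ennreal_leI flip: ennreal_plus ennreal_mult)
  also have "\<dots> = ennreal (2 ^ k * fact k) * ((\<integral>\<^sup>+\<omega>. ennreal (exp (Re (1 * S \<omega>))) \<partial>M) + (\<integral>\<^sup>+\<omega>. ennreal (exp (Re (-1 * S \<omega>))) \<partial>M)
           + (\<integral>\<^sup>+\<omega>. ennreal (exp (Re (\<i> * S \<omega>))) \<partial>M) + (\<integral>\<^sup>+\<omega>. ennreal (exp (Re (- \<i> * S \<omega>))) \<partial>M))"
    by (simp add: nn_integral_cmult nn_integral_add del: mult_1 mult_minus_left)
  also have "\<dots> \<le> ennreal (2 ^ k * fact k) * (ennreal (exp (1/2)) + ennreal (exp (1/2)) + ennreal (exp (1/2)) + ennreal (exp (1/2)))"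
    by (intro mult_left_mono add_mono exp_le) auto
  also have "\<dots> = ennreal (moment_const k)"
    by (simp add: moment_const_def flip: ennreal_plus ennreal_mult)
  finally have *: "(\<integral>\<^sup>+\<omega>. ennreal (norm (S \<omega>) ^ k) \<partial>M) \<le> ennreal (moment_const k)" .
  have "(\<integral>\<^sup>+\<omega>. ennreal (norm (\<Sum>n\<in>F. c n * X n \<omega>) ^ k) \<partial>M) = ennreal (v ^ k) * (\<integral>\<^sup>+\<omega>. ennreal (norm (S \<omega>) ^ k) \<partial>M)"
    unfolding eq using v by (simp add: ennreal_mult nn_integral_cmult)
  also have "\<dots> \<le> ennreal (v ^ k) * ennreal (moment_const k)"
    by (intro mult_left_mono *) auto
  finally show ?thesis
    using v by (simp add: v_def moment_const_def mult.commute flip: ennreal_mult)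
qed

text \<open>Let C be \<open>moment_const 4\<close>. Off the event the square is at most w/2; on it
  the square is split between the fourth moment and the indicator. Taking means gives w \<le> w/2 +
  w/4 + C w prob, hence the bound 1/(4 C).\<close>

lemma paley_zygmund:
  assumes F: "finite F" "F \<subseteq> {1..}"
  shows "1 / (4 * moment_const 4) \<le> prob {\<omega> \<in> space M. (\<Sum>n\<in>F. (norm (c n))\<^sup>2) / 2 \<le> (norm (\<Sum>n\<in>F. c n * X n \<omega>))\<^sup>2}"
    (is "_ \<le> prob ?B")
proof -
  let ?S = "\<lambda>\<omega>. \<Sum>n\<in>F. c n * X n \<omega>" and ?C = "moment_const 4"
  define w where "w = (\<Sum>n\<in>F. (norm (c n))\<^sup>2)"
  \<comment> \<open>The number 1536 is 2^4 * 4 * 4!. That C is at least 1 settles the degenerate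
    case w = 0.\<close>
  have "1 \<le> exp (1/2 :: real)" by simp
  then have "1 \<le> 1536 * exp (1/2 :: real)" by linarith
  then have C: "1 \<le> ?C" by (simp add: moment_const_def fact_numeral)
  have [measurable]: "?S \<in> borel_measurable M"
    using F measurable_X by (intro borel_measurable_sum borel_measurable_times) auto
  have B[measurable]: "?B \<in> sets M" by measurable
  show ?thesis
  proof (cases "w = 0")
    case True
    then have "?B = space M" by (simp add: w_def)
    then show ?thesis using C by (simp add: prob_space field_simps)
  next
    case False
    then have w: "0 < w" by (simp add: w_def less_le sum_nonneg)
    have pointwise: "(norm (?S \<omega>))\<^sup>2 \<le> w / 2 + (1 / (4 * ?C * w)) * norm (?S \<omega>) ^ 4 + ?C * w * indicator ?B \<omega>"
      if "\<omega> \<in> space M" for \<omega>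
    proof (cases "\<omega> \<in> ?B")
      case True
      \<comment> \<open>Completing the square. The weight 1/(4 C w) is chosen so that a fourth
        moment of at most C w^2 contributes at most w/4.\<close>
      define x where "x = (norm (?S \<omega>))\<^sup>2"
      have "0 \<le> (x - 2 * ?C * w)\<^sup>2 / (4 * ?C * w)" using C w by simp
      also have "\<dots> = (1 / (4 * ?C * w)) * x\<^sup>2 + ?C * w - x"
        using C w by (simp add: power2_eq_square field_simps)
      finally have "x \<le> (1 / (4 * ?C * w)) * x\<^sup>2 + ?C * w" by simp
      moreover have "x\<^sup>2 = norm (?S \<omega>) ^ 4" by (simp add: x_def flip: power_mult)
      ultimately show ?thesis using True w by (simp add: x_def)
    next
      case False
      then have "(norm (?S \<omega>))\<^sup>2 \<le> w / 2" using that by (simp add: w_def)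
      moreover have "0 \<le> (1 / (4 * ?C * w)) * norm (?S \<omega>) ^ 4" using C w by simp
      ultimately show ?thesis using False by simp
    qed
    have "ennreal w = (\<integral>\<^sup>+\<omega>. ennreal ((norm (?S \<omega>))\<^sup>2) \<partial>M)"
      unfolding w_def by (rule nn_integral_sum_sq[OF F, symmetric])
    also have "\<dots> \<le> (\<integral>\<^sup>+\<omega>. ennreal (w / 2) + ennreal (1 / (4 * ?C * w)) * ennreal (norm (?S \<omega>) ^ 4) + ennreal (?C * w) * indicator ?B \<omega> \<partial>M)"
    proof (intro nn_integral_mono)
      fix \<omega> assume "\<omega> \<in> space M"
      have "ennreal (w / 2) + ennreal (1 / (4 * ?C * w)) * ennreal (norm (?S \<omega>) ^ 4) + ennreal (?C * w) * indicator ?B \<omega>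
        = ennreal (w / 2 + (1 / (4 * ?C * w)) * norm (?S \<omega>) ^ 4 + ?C * w * indicator ?B \<omega>)"
      proof -
        have "ennreal (w / 2) + ennreal u * ennreal y + ennreal (?C * w) * ennreal i = ennreal (w / 2 + u * y + ?C * w * i)"
          if "0 \<le> u" "0 \<le> y" "0 \<le> i" for u y i
          using that C w by (simp flip: ennreal_plus ennreal_mult)
        from this[of "1 / (4 * ?C * w)" "norm (?S \<omega>) ^ 4" "indicator ?B \<omega>"] show ?thesis
          using C w by (simp only: ennreal_indicator) simp
      qed
      then show "ennreal ((norm (?S \<omega>))\<^sup>2) \<le> ennreal (w / 2) + ennreal (1 / (4 * ?C * w)) * ennreal (norm (?S \<omega>) ^ 4) + ennreal (?C * w) * indicator ?B \<omega>"
        using pointwise[OF \<open>\<omega> \<in> space M\<close>] by (simp add: ennreal_leI)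
    qed
    also have "\<dots> = ennreal (w / 2) + ennreal (1 / (4 * ?C * w)) * (\<integral>\<^sup>+\<omega>. ennreal (norm (?S \<omega>) ^ 4) \<partial>M) + ennreal (?C * w) * emeasure M ?B"
      by (simp add: nn_integral_add nn_integral_cmult emeasure_space_1)
    also have "\<dots> \<le> ennreal (w / 2) + ennreal (1 / (4 * ?C * w)) * ennreal (?C * sqrt w ^ 4) + ennreal (?C * w) * emeasure M ?B"
      unfolding w_def by (intro add_mono mult_left_mono khintchine F) auto
    also have "sqrt w ^ 4 = w\<^sup>2" using w power_mult[of "sqrt w" 2 2] by simp
    also have "emeasure M ?B = ennreal (prob ?B)" by (rule emeasure_eq_measure)
    also have "ennreal (w / 2) + ennreal (1 / (4 * ?C * w)) * ennreal (?C * w\<^sup>2) + ennreal (?C * w) * ennreal (prob ?B)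
      = ennreal (w / 2 + w / 4 + ?C * w * prob ?B)"
      using C w by (simp add: power2_eq_square flip: ennreal_plus ennreal_mult)
    finally have "w \<le> w / 2 + w / 4 + ?C * w * prob ?B"
      using C w by (subst (asm) ennreal_le_iff) auto
    then have "w * (1/4) \<le> w * (?C * prob ?B)" by (simp add: algebra_simps)
    then show ?thesis using C w by (simp add: field_simps)
  qed
qed

text \<open>By independence the joint law is the product of the marginal laws, and negating a
  symmetric variable keeps its marginal.\<close>

lemma prob_flip_signs:
  assumes A: "A \<in> sets borel" and a0: "a 0 = 0"
  shows "{\<omega> \<in> space M. (\<lambda>n. a n * X n \<omega>) \<in> A} \<in> sets M"
    and "{\<omega> \<in> space M. (\<lambda>n. a n * (if n \<le> N then X n \<omega> else - X n \<omega>)) \<in> A} \<in> sets M"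
    and "prob {\<omega> \<in> space M. (\<lambda>n. a n * (if n \<le> N then X n \<omega> else - X n \<omega>)) \<in> A}
       = prob {\<omega> \<in> space M. (\<lambda>n. a n * X n \<omega>) \<in> A}"
proof -
  let ?Q = "\<Pi>\<^sub>M n\<in>{1::nat..}. (borel :: complex measure)"
  \<comment> \<open>Nothing is assumed about X 0, so the joint law lives on the indices from 1 on
    and the coordinate 0 is filled with 0, which matches a 0 = 0.\<close>
  define \<Phi> where "\<Phi> x n = (if n \<in> {1..} then a n * x n else 0)" for x n
  define Y where "Y n \<omega> = (if n \<le> N then X n \<omega> else - X n \<omega>)" for n \<omega>
  have \<Phi>: "\<Phi> \<in> measurable ?Q borel"
  proof -
    have "\<Phi> \<in> measurable ?Q (\<Pi>\<^sub>M n\<in>UNIV. borel)"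
      unfolding \<Phi>_def
    proof (rule measurable_PiM_single')
      show "(\<lambda>x. if n \<in> {1..} then a n * x n else 0) \<in> borel_measurable ?Q" for n
      proof (cases "n \<in> {1..}")
        case True
        then have "(\<lambda>x. x n) \<in> borel_measurable ?Q"
          by (rule measurable_component_singleton)
        with True show ?thesis by simp
      qed simp
    qed auto
    then show ?thesis
      by (simp add: measurable_cong_sets[OF refl sets_PiM_equal_borel])
  qed
  have rv: "X n \<in> borel_measurable M" "Y n \<in> borel_measurable M" if "n \<in> {1..}" for n
    using measurable_X that unfolding Y_def by (auto intro!: measurable_If)
  have tup: "(\<lambda>\<omega>. \<lambda>n\<in>{1..}. Z n \<omega>) \<in> measurable M ?Q"
    if "\<And>n. n \<in> {1..} \<Longrightarrow> Z n \<in> borel_measurable M" for Z :: "nat \<Rightarrow> 'w \<Rightarrow> complex"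
    by (intro measurable_restrict that)
  have \<Phi>_eq: "\<Phi> (\<lambda>n\<in>{1..}. Z n) = (\<lambda>n. a n * Z n)" for Z
    by (auto simp: \<Phi>_def a0 fun_eq_iff not_le)
  have set_eq: "{\<omega> \<in> space M. (\<lambda>n. a n * Z n \<omega>) \<in> A} = (\<lambda>\<omega>. \<lambda>n\<in>{1..}. Z n \<omega>) -` (\<Phi> -` A \<inter> space ?Q) \<inter> space M" for Z
    by (auto simp: \<Phi>_eq[simplified] space_PiM)
  have \<Phi>A: "\<Phi> -` A \<inter> space ?Q \<in> sets ?Q"
    by (rule measurable_sets[OF \<Phi> A])
  have sets: "{\<omega> \<in> space M. (\<lambda>n. a n * Z n \<omega>) \<in> A} \<in> sets M"
    "prob {\<omega> \<in> space M. (\<lambda>n. a n * Z n \<omega>) \<in> A} = measure (distr M ?Q (\<lambda>\<omega>. \<lambda>n\<in>{1..}. Z n \<omega>)) (\<Phi> -` A \<inter> space ?Q)"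
    if "\<And>n. n \<in> {1..} \<Longrightarrow> Z n \<in> borel_measurable M" for Z
  proof -
    have t: "(\<lambda>\<omega>. \<lambda>n\<in>{1..}. Z n \<omega>) \<in> measurable M ?Q"
      by (rule tup) (rule that)
    show "{\<omega> \<in> space M. (\<lambda>n. a n * Z n \<omega>) \<in> A} \<in> sets M"
      unfolding set_eq by (rule measurable_sets[OF t \<Phi>A])
    show "prob {\<omega> \<in> space M. (\<lambda>n. a n * Z n \<omega>) \<in> A} = measure (distr M ?Q (\<lambda>\<omega>. \<lambda>n\<in>{1..}. Z n \<omega>)) (\<Phi> -` A \<inter> space ?Q)"
      unfolding set_eq by (rule measure_distr[OF t \<Phi>A, symmetric])
  qed
  have "indep_vars (\<lambda>_. borel) (\<lambda>n \<omega>. (\<lambda>x. if n \<le> N then x else - x) (X n \<omega>)) {1..}"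
    by (rule indep_vars_compose2[OF indep]) auto
  then have indep_Y: "indep_vars (\<lambda>_. borel) Y {1..}"
    by (simp add: Y_def[abs_def])
  have "distr M borel (Y n) = distr M borel (X n)" if "n \<in> {1..}" for n
    using symmetric[of n] that by (cases "n \<le> N") (auto simp: Y_def[abs_def])
  then have "(\<Pi>\<^sub>M n\<in>{1..}. distr M borel (Y n)) = (\<Pi>\<^sub>M n\<in>{1..}. distr M borel (X n))"
    by (intro PiM_cong) auto
  then have "distr M ?Q (\<lambda>\<omega>. \<lambda>n\<in>{1..}. Y n \<omega>) = distr M ?Q (\<lambda>\<omega>. \<lambda>n\<in>{1..}. X n \<omega>)"
    using indep_vars_iff_distr_eq_PiM'[of "{1..}" X "\<lambda>_. borel"] indep_vars_iff_distr_eq_PiM'[of "{1..}" Y "\<lambda>_. borel"]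
      indep indep_Y rv by auto
  then show "{\<omega> \<in> space M. (\<lambda>n. a n * X n \<omega>) \<in> A} \<in> sets M"
    and "{\<omega> \<in> space M. (\<lambda>n. a n * (if n \<le> N then X n \<omega> else - X n \<omega>)) \<in> A} \<in> sets M"
    and "prob {\<omega> \<in> space M. (\<lambda>n. a n * (if n \<le> N then X n \<omega> else - X n \<omega>)) \<in> A}
       = prob {\<omega> \<in> space M. (\<lambda>n. a n * X n \<omega>) \<in> A}"
    using sets[of X, OF rv(1)] sets[of Y, OF rv(2)] by (simp_all add: Y_def)
qed

end

section \<open>Random Dirichlet series\<close>

lemma dshift_randomize: "dshift \<sigma> (randomize X a \<omega>) n = dshift \<sigma> a n * X n \<omega>"
  by (simp add: dshift_def randomize_def)

locale random_shift = P: random_coeffs M X + S: shift_measure \<nu>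
  for M :: "'w measure" and X :: "nat \<Rightarrow> 'w \<Rightarrow> complex" and \<nu> :: "real measure" +
  fixes a :: "nat \<Rightarrow> complex"
  assumes a0: "a 0 = 0"
begin

definition random_poly :: "nat set \<Rightarrow> 'w \<Rightarrow> nat \<Rightarrow> complex" where
  "random_poly F \<omega> = restrict_coeffs F (randomize X a \<omega>)"

lemma random_poly_polys: "finite F \<Longrightarrow> random_poly F \<omega> \<in> dirichlet_polys"
  unfolding random_poly_def by (rule restrict_coeffs_polys) (simp_all add: randomize_def a0)

lemma dshift_random_poly: "dshift \<sigma> (random_poly F \<omega>) = restrict_coeffs F (\<lambda>n. dshift \<sigma> a n * X n \<omega>)"
  unfolding random_poly_def dshift_restrict_coeffs by (auto simp: restrict_coeffs_def dshift_randomize)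

lemma bohr_lift_random_poly:
  assumes "finite F"
  shows "bohr_lift (dshift \<sigma> (random_poly F \<omega>)) z = (\<Sum>n\<in>F. (dshift \<sigma> a n * bohr_monomial z n) * X n \<omega>)"
  unfolding dshift_random_poly using assms by (subst bohr_lift_eq[of F]) (auto simp: ac_simps)

lemma measurable_hardy_norm_random:
  assumes F: "finite F" "F \<subseteq> {1..}"
  shows "(\<lambda>(\<omega>, \<sigma>). hardy_norm p (dshift \<sigma> (random_poly F \<omega>))) \<in> borel_measurable (M \<Otimes>\<^sub>M \<nu>)"
    and "(\<lambda>\<omega>. hardy_norm p (dshift \<sigma> (random_poly F \<omega>))) \<in> borel_measurable M"
    and "(\<lambda>\<omega>. hardy_power p (dshift \<sigma> (random_poly F \<omega>))) \<in> borel_measurable M"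
proof -
  have X: "X n \<in> borel_measurable M" if "n \<in> F" for n
    using F that by (intro P.measurable_X) auto
  have "(\<lambda>x. dshift (snd x) a n * X n (fst x)) \<in> borel_measurable (M \<Otimes>\<^sub>M \<nu>)" if "n \<in> F" for n
    by (intro borel_measurable_times measurable_compose[OF measurable_snd] measurable_compose[OF measurable_fst X[OF that]])
       (simp add: measurable_cong_sets[OF S.sets_shift refl])
  then show "(\<lambda>(\<omega>, \<sigma>). hardy_norm p (dshift \<sigma> (random_poly F \<omega>))) \<in> borel_measurable (M \<Otimes>\<^sub>M \<nu>)"
    unfolding dshift_random_poly case_prod_beta
    by (intro measurable_hardy_norm[where c="\<lambda>n x. dshift (snd x) a n * X n (fst x)"] F)
  show "(\<lambda>\<omega>. hardy_norm p (dshift \<sigma> (random_poly F \<omega>))) \<in> borel_measurable M"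
    unfolding dshift_random_poly using X
    by (intro measurable_hardy_norm[where c="\<lambda>n \<omega>. dshift \<sigma> a n * X n \<omega>"] F) auto
  show "(\<lambda>\<omega>. hardy_power p (dshift \<sigma> (random_poly F \<omega>))) \<in> borel_measurable M"
    unfolding dshift_random_poly using X
    by (intro measurable_hardy_power[where c="\<lambda>n \<omega>. dshift \<sigma> a n * X n \<omega>"] F) auto
qed

lemma measurable_shift_power_random:
  assumes F: "finite F" "F \<subseteq> {1..}"
  shows "(\<lambda>\<omega>. shift_power \<nu> p q (random_poly F \<omega>)) \<in> borel_measurable M"
  unfolding shift_power_def using measurable_hardy_norm_random(1)[OF F, of p]
  by (intro S.borel_measurable_nn_integral) (simp add: case_prod_beta)

lemma measurable_random_lift:
  assumes F: "finite F" "F \<subseteq> {1..}"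
  shows "(\<lambda>(\<omega>, z). bohr_lift (dshift \<sigma> (random_poly F \<omega>)) z) \<in> borel_measurable (M \<Otimes>\<^sub>M torus_measure)"
proof -
  have X: "X n \<in> borel_measurable M" if "n \<in> F" for n
    using F that by (intro P.measurable_X) auto
  have "(\<lambda>x. (dshift \<sigma> a n * bohr_monomial (snd x) n) * X n (fst x)) \<in> borel_measurable (M \<Otimes>\<^sub>M torus_measure)" if "n \<in> F" for n
    by (intro borel_measurable_times measurable_compose[OF measurable_snd] measurable_compose[OF measurable_fst X[OF that]] borel_measurable_const)
       (simp add: measurable_cong_sets[OF sets_torus_measure refl])
  then show ?thesis
    unfolding bohr_lift_random_poly[OF F(1)] case_prod_beta by (rule borel_measurable_sum)
qed

text \<open>An integer k above p and q dominates both: H^p norms are at most H^k norms, Khintchine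
  applies at each z after exchanging integrals, and q/k \<le> 1 allows Jensen's inequality to return
  to the power q.\<close>

lemma expectation_shift_power_le:
  assumes F: "finite F" "F \<subseteq> {1..}" and k: "0 < k" "p \<le> real k" "q \<le> real k" and p: "0 < p" "0 < q"
  shows "(\<integral>\<^sup>+\<omega>. shift_power \<nu> p q (random_poly F \<omega>) \<partial>M)
    \<le> ennreal (moment_const k powr (q / real k)) * shift_power \<nu> 2 q (restrict_coeffs F a)"
proof -
  interpret MT: pair_sigma_finite M torus_measure ..
  interpret MN: pair_sigma_finite M \<nu> ..
  have C: "0 \<le> moment_const k" by (simp add: moment_const_def)
  have "(\<integral>\<^sup>+\<omega>. shift_power \<nu> p q (random_poly F \<omega>) \<partial>M)
      = (\<integral>\<^sup>+\<sigma>. \<integral>\<^sup>+\<omega>. ennreal (hardy_norm p (dshift \<sigma> (random_poly F \<omega>)) powr q) \<partial>M \<partial>\<nu>)"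
    unfolding shift_power_def using measurable_hardy_norm_random(1)[OF F, of p]
    by (intro MN.Fubini'[symmetric]) (simp add: case_prod_beta)
  also have "\<dots> \<le> (\<integral>\<^sup>+\<sigma>. ennreal (moment_const k powr (q / real k)) *
      ennreal ((\<Sum>n\<in>F. (norm (dshift \<sigma> a n))\<^sup>2) powr (q / 2)) \<partial>\<nu>)"
  proof (intro nn_integral_mono)
    fix \<sigma>
    define w where "w = (\<Sum>n\<in>F. (norm (dshift \<sigma> a n))\<^sup>2)"
    let ?R = "\<lambda>\<omega>. dshift \<sigma> (random_poly F \<omega>)"
    have R: "?R \<omega> \<in> dirichlet_polys" for \<omega>
      by (intro dshift_dirichlet_polys random_poly_polys F)
    define L where "L = moment_const k * sqrt w ^ k"
    have "0 \<le> w" by (simp add: w_def sum_nonneg)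
    then have "0 \<le> L" using C by (simp add: L_def)
    have "(\<integral>\<^sup>+\<omega>. hardy_power k (?R \<omega>) \<partial>M)
        = (\<integral>\<^sup>+z. \<integral>\<^sup>+\<omega>. ennreal (norm (bohr_lift (?R \<omega>) z) ^ k) \<partial>M \<partial>torus_measure)"
      unfolding hardy_power_def using k(1) measurable_random_lift[OF F, of \<sigma>]
      by (subst MT.Fubini') (simp_all add: case_prod_beta powr_realpow')
    also have "\<dots> \<le> (\<integral>\<^sup>+z. ennreal L \<partial>torus_measure)"
      using AE_torus_norm
    proof (intro nn_integral_mono_AE, eventually_elim)
      case (elim z)
      show ?case
        using P.khintchine[OF F k(1), of "\<lambda>n. dshift \<sigma> a n * bohr_monomial z n"] elim
        by (simp add: bohr_lift_random_poly F L_def w_def sum_norm_sq_unimodular)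
    qed
    finally have le: "(\<integral>\<^sup>+\<omega>. hardy_power k (?R \<omega>) \<partial>M) \<le> ennreal L" by simp
    have "(\<integral>\<^sup>+\<omega>. ennreal (hardy_norm p (?R \<omega>) powr q) \<partial>M) \<le> (\<integral>\<^sup>+\<omega>. ennreal (enn2real (hardy_power k (?R \<omega>)) powr (q / k)) \<partial>M)"
      using hardy_norm_mono[OF R p(1) k(2)] p
      by (intro nn_integral_mono ennreal_leI) (auto simp flip: hardy_norm_powr intro!: powr_mono2 hardy_norm_nonneg)
    also have "\<dots> \<le> ennreal (L powr (q / k))"
      using measurable_hardy_norm_random(3)[OF F, of k \<sigma>] k p \<open>0 \<le> L\<close> le ennreal_enn2real_hardy_power[OF R, of k]
      by (intro P.nn_integral_powr_le) auto
    also have "L powr (q / k) = moment_const k powr (q / k) * w powr (q / 2)"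
    proof -
      have "sqrt w ^ k = w powr (k / 2)"
        using \<open>0 \<le> w\<close> k(1) by (cases "w = 0") (auto simp: powr_half_sqrt[symmetric] powr_powr simp flip: powr_realpow)
      then show ?thesis
        using C k by (simp add: L_def powr_mult powr_powr)
    qed
    finally show "(\<integral>\<^sup>+\<omega>. ennreal (hardy_norm p (?R \<omega>) powr q) \<partial>M)
        \<le> ennreal (moment_const k powr (q / real k)) * ennreal ((\<Sum>n\<in>F. (norm (dshift \<sigma> a n))\<^sup>2) powr (q / 2))"
      by (simp add: w_def ennreal_mult)
  qed
  also have "\<dots> = ennreal (moment_const k powr (q / real k)) * shift_power \<nu> 2 q (restrict_coeffs F a)"
    using F by (subst shift_power_2_restrict) (auto intro!: nn_integral_cmult)
  finally show ?thesis .
qed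

text \<open>The expected square sum of the randomized series equals that of a, so it is almost
  surely finite after any fixed positive shift.\<close>

lemma AE_random_converges:
  assumes a: "a \<in> S.square_space q" and q: "0 < q"
  shows "AE \<omega> in M. dirichlet_converges_on (randomize X a \<omega>) (half_plane (1/2))"
proof -
  have "AE \<omega> in M. summable (\<lambda>n. (norm (dshift s (randomize X a \<omega>) n))\<^sup>2)" if s: "0 < s" for s
  proof -
    define g where "g n \<omega> = ennreal ((norm (dshift s (randomize X a \<omega>) n))\<^sup>2)" for n \<omega>
    have g: "g n \<in> borel_measurable M" "(\<integral>\<^sup>+\<omega>. g n \<omega> \<partial>M) = ennreal ((norm (dshift s a n))\<^sup>2)" for n
    proof -
      have "g n \<in> borel_measurable M \<and> (\<integral>\<^sup>+\<omega>. g n \<omega> \<partial>M) = ennreal ((norm (dshift s a n))\<^sup>2)"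
      proof (cases "n = 0")
        case False
        then have [measurable]: "X n \<in> borel_measurable M" by (intro P.measurable_X) simp
        show ?thesis
          using False P.second_moment[of n]
          by (simp add: g_def[abs_def] dshift_randomize norm_mult power_mult_distrib ennreal_mult nn_integral_cmult)
      qed (simp add: g_def[abs_def] dshift_def)
      then show "g n \<in> borel_measurable M" "(\<integral>\<^sup>+\<omega>. g n \<omega> \<partial>M) = ennreal ((norm (dshift s a n))\<^sup>2)" by auto
    qed
    have "(\<integral>\<^sup>+\<omega>. (\<Sum>n. g n \<omega>) \<partial>M) = (\<Sum>n. ennreal ((norm (dshift s a n))\<^sup>2))"
      using g by (subst nn_integral_suminf) auto
    also have "\<dots> \<noteq> \<infinity>"
      using S.square_space_summable[OF a q s] by (subst suminf_ennreal2) auto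
    finally have "AE \<omega> in M. (\<Sum>n. g n \<omega>) \<noteq> \<infinity>"
      using g by (intro nn_integral_PInf_AE) auto
    then show ?thesis
      by eventually_elim (rule summable_suminf_not_top, auto simp: g_def)
  qed
  \<comment> \<open>Countably many shifts share one null set; monotonicity in the shift covers all
    the others.\<close>
  then have "AE \<omega> in M. \<forall>j. summable (\<lambda>n. (norm (dshift (1 / real (Suc j)) (randomize X a \<omega>) n))\<^sup>2)"
    by (subst AE_all_countable) simp
  then show ?thesis
  proof eventually_elim
    case (elim \<omega>)
    show ?case
    proof (rule converges_half_plane)
      fix \<sigma> :: real assume "0 < \<sigma>"
      then obtain j where "1 / real (Suc j) < \<sigma>" using nat_approx_posE by blast
      then show "summable (\<lambda>n. (norm (dshift \<sigma> (randomize X a \<omega>) n))\<^sup>2)"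
        using summable_dshift_mono[OF elim[rule_format, of j]] by simp
    qed
  qed
qed

text \<open>Each use of the weak triangle inequality costs a factor K, so steps decaying like (2
  K)^(-k) are needed. The constant 2 K B reproduces itself: K (B r + B r) = 2 K B r, because the
  bound for the remaining d steps at k + 1 is again B r.\<close>

lemma shift_power_telescope:
  fixes P :: "nat \<Rightarrow> nat \<Rightarrow> complex"
  assumes P: "\<And>k. P k \<in> dirichlet_polys" and p: "0 < p" "0 < q" and B: "0 \<le> B"
    and K: "K = quasi_const p q"
    and step: "\<And>k. shift_power \<nu> p q (\<lambda>n. P (Suc k) n - P k n) \<le> ennreal (B * (1 / (2 * K)) ^ k)"
  shows "shift_power \<nu> p q (\<lambda>n. P (k + d) n - P k n) \<le> ennreal (2 * K * B * (1 / (2 * K)) ^ k)"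
proof (induction d arbitrary: k)
  case 0
  have "shift_power \<nu> p q (\<lambda>n. 0 * P k n) = 0"
    using S.shift_power_scale[OF P p(1), of q 0 k] p by simp
  then show ?case by simp
next
  case (Suc d)
  have K1: "1 \<le> K" using quasi_const_ge_1[OF p] K by simp
  define r where "r = (1 / (2 * K)) ^ k"
  have r: "0 \<le> r" using K1 by (simp add: r_def)
  have "shift_power \<nu> p q (\<lambda>n. (P (Suc k) n - P k n) + (P (Suc k + d) n - P (Suc k) n))
      \<le> ennreal K * (shift_power \<nu> p q (\<lambda>n. P (Suc k) n - P k n) + shift_power \<nu> p q (\<lambda>n. P (Suc k + d) n - P (Suc k) n))"
    unfolding K by (intro S.shift_power_add dirichlet_polys_diff P p)
  also have "\<dots> \<le> ennreal K * (ennreal (B * r) + ennreal (2 * K * B * (1 / (2 * K)) ^ Suc k))"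
    unfolding r_def by (intro mult_left_mono add_mono step Suc.IH) auto
  also have "2 * K * B * (1 / (2 * K)) ^ Suc k = B * r"
    using K1 by (simp add: r_def)
  also have "ennreal K * (ennreal (B * r) + ennreal (B * r)) = ennreal (2 * K * B * r)"
    using K1 B r by (simp add: algebra_simps flip: ennreal_plus ennreal_mult)
  finally show ?case by (simp add: r_def)
qed

lemma square_space_imp_AE_completion:
  assumes a: "a \<in> S.square_space q" and p: "0 < p" "0 < q"
  shows "AE \<omega> in M. randomize X a \<omega> \<in> dirichlet_completion (shift_norm \<nu> p q)"
proof -
  define K where "K = quasi_const p q"
  have K: "1 \<le> K" using quasi_const_ge_1[OF p] by (simp add: K_def)
  define k where "k = nat \<lceil>max (max p q) 1\<rceil>"
  have k: "0 < k" "p \<le> real k" "q \<le> real k" unfolding k_def by linarith+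
  define C where "C = moment_const k powr (q / real k)"
  have C: "0 \<le> C" by (simp add: C_def)
  obtain D where D: "D \<longlonglongrightarrow> 0" "\<And>M N. shift_power \<nu> 2 q (restrict_coeffs {M<..N} a) \<le> D M"
    using S.square_space_tail[OF a p(2)] by blast
  \<comment> \<open>Tails below (4 K)^(-j) leave expected norms summable with ratio 1/2 even after
    multiplication by (2 K)^j, the weight that \<open>shift_power_telescope\<close> demands.\<close>
  have "\<exists>r. \<forall>m\<ge>r. D m \<le> ennreal ((1 / (4 * K)) ^ j)" for j
  proof -
    have "0 < ennreal ((1 / (4 * K)) ^ j)" using K by simp
    from order_tendstoD(2)[OF D(1) this] show ?thesis
      by (auto simp: eventually_sequentially intro: less_imp_le)
  qed
  then obtain r where r: "\<And>j m. m \<ge> r j \<Longrightarrow> D m \<le> ennreal ((1 / (4 * K)) ^ j)" by metis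
  \<comment> \<open>Summing makes the cut points increase, lie beyond every r j, and be at least j,
    so that the blocks exhaust all coefficients.\<close>
  define m where "m j = (\<Sum>i\<le>j. Suc (r i))" for j
  have m_Suc: "m j \<le> m (Suc j)" and m_r: "r j \<le> m j" for j
    by (auto simp: m_def intro: order_trans[OF _ member_le_sum[of j]])
  have m_ge: "j \<le> m j" for j
    by (induction j) (auto simp: m_def)
  define f where "f j \<omega> = shift_power \<nu> p q (random_poly {m j<..m (Suc j)} \<omega>)" for j \<omega>
  have f_meas[measurable]: "f j \<in> borel_measurable M" for j
    unfolding f_def by (rule measurable_shift_power_random) auto
  have f_int: "(\<integral>\<^sup>+\<omega>. f j \<omega> \<partial>M) \<le> ennreal (C * (1 / (4 * K)) ^ j)" for j
  proof -
    have "(\<integral>\<^sup>+\<omega>. f j \<omega> \<partial>M) \<le> ennreal C * shift_power \<nu> 2 q (restrict_coeffs {m j<..m (Suc j)} a)"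
      unfolding f_def C_def by (intro expectation_shift_power_le k p) auto
    also have "\<dots> \<le> ennreal C * ennreal ((1 / (4 * K)) ^ j)"
      using order_trans[OF D(2) r[OF m_r]] by (intro mult_left_mono) auto
    finally show ?thesis using C K by (simp add: ennreal_mult)
  qed
  \<comment> \<open>A finite mean makes this weighted series almost surely finite; its value B then
    bounds every single term, giving geometric decay of the blocks for each such \<omega>.\<close>
  have "(\<integral>\<^sup>+\<omega>. (\<Sum>j. ennreal ((2 * K) ^ j) * f j \<omega>) \<partial>M) = (\<Sum>j. ennreal ((2 * K) ^ j) * (\<integral>\<^sup>+\<omega>. f j \<omega> \<partial>M))"
    by (subst nn_integral_suminf) (auto simp: nn_integral_cmult)
  also have "\<dots> \<le> (\<Sum>j. ennreal (C * (1 / 2) ^ j))"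
  proof (intro suminf_le summableI)
    fix j
    have "ennreal ((2 * K) ^ j) * (\<integral>\<^sup>+\<omega>. f j \<omega> \<partial>M) \<le> ennreal ((2 * K) ^ j) * ennreal (C * (1 / (4 * K)) ^ j)"
      by (intro mult_left_mono f_int) auto
    also have "\<dots> = ennreal ((2 * K) ^ j * (C * (1 / (4 * K)) ^ j))"
      using K C by (intro ennreal_mult[symmetric]) auto
    also have "(2 * K) ^ j * (C * (1 / (4 * K)) ^ j) = C * ((2 * K) * (1 / (4 * K))) ^ j"
      unfolding power_mult_distrib[of "2 * K" "1 / (4 * K)"] by (simp only: mult_ac)
    also have "(2 * K) * (1 / (4 * K)) = 1 / 2" using K by simp
    finally show "ennreal ((2 * K) ^ j) * (\<integral>\<^sup>+\<omega>. f j \<omega> \<partial>M) \<le> ennreal (C * (1 / 2) ^ j)" .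
  qed
  also have "\<dots> < \<infinity>"
    using C by (subst suminf_ennreal2) (auto intro!: summable_mult summable_geometric)
  finally have "(\<integral>\<^sup>+\<omega>. (\<Sum>j. ennreal ((2 * K) ^ j) * f j \<omega>) \<partial>M) \<noteq> \<infinity>"
    by simp
  then have "AE \<omega> in M. (\<Sum>j. ennreal ((2 * K) ^ j) * f j \<omega>) \<noteq> \<infinity>"
    by (intro nn_integral_PInf_AE) auto
  with AE_random_converges[OF a p(2)] show ?thesis
  proof eventually_elim
    case (elim \<omega>)
    define B where "B = enn2real (\<Sum>j. ennreal ((2 * K) ^ j) * f j \<omega>)"
    have B: "(\<Sum>j. ennreal ((2 * K) ^ j) * f j \<omega>) = ennreal B" "0 \<le> B"
      using elim(2) by (auto simp: B_def less_top)
    define P where "P j = random_poly {1..m j} \<omega>" for j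
    have P: "P j \<in> dirichlet_polys" for j
      unfolding P_def by (rule random_poly_polys) simp
    have step: "shift_power \<nu> p q (\<lambda>n. P (Suc j) n - P j n) \<le> ennreal (B * (1 / (2 * K)) ^ j)" for j
    proof -
      have eq: "(\<lambda>n. P (Suc j) n - P j n) = random_poly {m j<..m (Suc j)} \<omega>"
        unfolding P_def random_poly_def using m_Suc by (rule restrict_coeffs_diff)
      have le: "ennreal ((2 * K) ^ j) * f j \<omega> \<le> ennreal B"
        unfolding B(1)[symmetric] using sum_le_suminf[of "\<lambda>j. ennreal ((2 * K) ^ j) * f j \<omega>" "{j}"] by simp
      have "f j \<omega> = (ennreal ((1 / (2 * K)) ^ j) * ennreal ((2 * K) ^ j)) * f j \<omega>"
        using K by (simp add: power_divide flip: ennreal_mult)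
      also have "\<dots> \<le> ennreal ((1 / (2 * K)) ^ j) * ennreal B"
        unfolding mult.assoc by (intro mult_left_mono le) auto
      finally show ?thesis
        using B K by (simp add: eq f_def mult.commute flip: ennreal_mult)
    qed
    note tele = shift_power_telescope[OF P p B(2) K_def step]
    show ?case
      unfolding S.mem_completion_iff[OF p]
    proof (intro conjI exI[of _ P] allI impI P elim(1))
      show "randomize X a \<omega> 0 = 0" by (simp add: randomize_def a0)
    next
      fix \<epsilon> :: real assume "\<epsilon> > 0"
      have "(\<lambda>j. 2 * K * B * (1 / (2 * K)) ^ j) \<longlonglongrightarrow> 2 * K * B * 0"
        using K by (intro tendsto_intros LIMSEQ_power_zero) auto
      then have "eventually (\<lambda>j. 2 * K * B * (1 / (2 * K)) ^ j < \<epsilon>) sequentially"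
        using \<open>\<epsilon> > 0\<close> by (intro order_tendstoD(2)) auto
      then obtain J where J: "\<And>j. j \<ge> J \<Longrightarrow> 2 * K * B * (1 / (2 * K)) ^ j < \<epsilon>"
        by (auto simp: eventually_sequentially)
      have le: "shift_power \<nu> p q (\<lambda>n. P i n - P j n) < ennreal \<epsilon>" if "J \<le> j" "j \<le> i" for i j
        using tele[of j "i - j"] J[OF that(1)] that(2) \<open>\<epsilon> > 0\<close> by (auto intro: le_less_trans ennreal_lessI)
      show "\<exists>J. \<forall>i\<ge>J. \<forall>j\<ge>J. shift_power \<nu> p q (\<lambda>n. P i n - P j n) < ennreal \<epsilon>"
      proof (intro exI[of _ J] allI impI)
        fix i j assume "J \<le> i" "J \<le> j"
        then show "shift_power \<nu> p q (\<lambda>n. P i n - P j n) < ennreal \<epsilon>"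
          using le[of i j] le[of j i] S.shift_power_minus_commute[OF P P p(1), of q i j]
          by (cases "j \<le> i") auto
      qed
    next
      fix n
      show "(\<lambda>j. P j n) \<longlonglongrightarrow> randomize X a \<omega> n"
      proof (rule tendsto_eventually, unfold eventually_sequentially, intro exI[of _ n] allI impI)
        fix j assume "n \<le> j"
        then have "n \<le> m j" using m_ge[of j] by simp
        then show "P j n = randomize X a \<omega> n"
          using a0 by (cases "n = 0") (auto simp: P_def random_poly_def restrict_coeffs_def randomize_def)
      qed
    qed
  qed
qed

end

section \<open>Coefficientwise limits of polynomials of bounded norm\<close>

context shift_measure
begin

text \<open>For each \<sigma> the lower semicontinuity of \<open>hardy_power\<close> passes through
  the increasing function u^(q/p); Fatou then integrates over \<sigma>. Comparing with each y below
  the value avoids continuity of powers at infinity.\<close>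

lemma shift_power_le_liminf:
  assumes p: "0 < p" "p \<le> 1" "0 < q" and P: "\<And>k. P k \<in> dirichlet_polys" and Q: "Q \<in> dirichlet_polys"
    and lim: "\<And>n. (\<lambda>k. P k n) \<longlonglongrightarrow> Q n"
  shows "shift_power \<nu> p q Q \<le> liminf (\<lambda>k. shift_power \<nu> p q (P k))"
proof -
  have [measurable]: "(\<lambda>\<sigma>. hardy_norm p (dshift \<sigma> (P k))) \<in> borel_measurable \<nu>" for k
    by (rule measurable_hardy_norm_dshift[OF P])
  have "ennreal (hardy_norm p (dshift \<sigma> Q) powr q) \<le> liminf (\<lambda>k. ennreal (hardy_norm p (dshift \<sigma> (P k)) powr q))" for \<sigma>
    unfolding le_Liminf_iff
  proof (intro allI impI)
    fix y assume y: "y < ennreal (hardy_norm p (dshift \<sigma> Q) powr q)"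
    define x where "x = enn2real y"
    have x: "y = ennreal x" "0 \<le> x"
      using y by (auto simp: x_def less_top intro!: ennreal_enn2real[symmetric] elim: less_trans)
    let ?h = "\<lambda>b. enn2real (hardy_power p (dshift \<sigma> b))"
    have "x < ?h Q powr (q / p)"
      using y x by (simp add: hardy_norm_powr ennreal_less_iff)
    then have "x powr (p / q) < (?h Q powr (q / p)) powr (p / q)"
      using p x by (intro powr_less_mono2) auto
    then have "ennreal (x powr (p / q)) < ennreal (?h Q)"
      using p by (simp add: powr_powr ennreal_less_iff)
    also have "\<dots> \<le> liminf (\<lambda>k. hardy_power p (dshift \<sigma> (P k)))"
    proof -
      have "(\<lambda>k. dshift \<sigma> (P k) n) \<longlonglongrightarrow> dshift \<sigma> Q n" for n
        unfolding dshift_def by (intro tendsto_mult_right lim)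
      from hardy_power_le_liminf[OF p(1,2) dshift_dirichlet_polys[OF P] dshift_dirichlet_polys[OF Q] this]
      show ?thesis
        by (simp add: ennreal_enn2real_hardy_power[OF dshift_dirichlet_polys[OF Q] p(1)])
    qed
    finally have "eventually (\<lambda>k. ennreal (x powr (p / q)) < hardy_power p (dshift \<sigma> (P k))) sequentially"
      by (rule less_LiminfD)
    then show "eventually (\<lambda>k. y < ennreal (hardy_norm p (dshift \<sigma> (P k)) powr q)) sequentially"
    proof eventually_elim
      case (elim k)
      then have "ennreal (x powr (p / q)) < ennreal (?h (P k))"
        using ennreal_enn2real_hardy_power[OF dshift_dirichlet_polys[OF P] p(1)] by simp
      then have "(x powr (p / q)) powr (q / p) < ?h (P k) powr (q / p)"
        using p by (intro powr_less_mono2) (auto simp: ennreal_less_iff)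
      then show ?case
        using p x by (simp add: powr_powr hardy_norm_powr ennreal_less_iff)
    qed
  qed
  then have "shift_power \<nu> p q Q \<le> (\<integral>\<^sup>+\<sigma>. liminf (\<lambda>k. ennreal (hardy_norm p (dshift \<sigma> (P k)) powr q)) \<partial>\<nu>)"
    unfolding shift_power_def by (intro nn_integral_mono)
  also have "\<dots> \<le> liminf (\<lambda>k. shift_power \<nu> p q (P k))"
    unfolding shift_power_def by (rule nn_integral_liminf) measurable
  finally show ?thesis .
qed

text \<open>
  The closure is taken for coefficientwise convergence, so that these sets are measurable in the
  coefficients; they exhaust the completion.
\<close>

definition closed_ball :: "real \<Rightarrow> real \<Rightarrow> nat \<Rightarrow> (nat \<Rightarrow> complex) set" where
  "closed_ball p q i = closure {P \<in> dirichlet_polys. shift_power \<nu> p q P \<le> ennreal (real i)}"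

lemma mem_closed_ball:
  "b \<in> closed_ball p q i \<longleftrightarrow>
    (\<exists>P. (\<forall>k. P k \<in> dirichlet_polys \<and> shift_power \<nu> p q (P k) \<le> ennreal (real i)) \<and> (\<forall>n. (\<lambda>k. P k n) \<longlonglongrightarrow> b n))"
  unfolding closed_ball_def closure_sequential tendsto_fun_iff by simp

lemma closed_ball_borel: "closed_ball p q i \<in> sets borel"
  unfolding closed_ball_def by (intro borel_closed closed_closure)

lemma closed_ball_mono: "i \<le> j \<Longrightarrow> closed_ball p q i \<subseteq> closed_ball p q j"
  unfolding closed_ball_def by (intro closure_mono) (auto intro: order_trans ennreal_leI)

text \<open>A Cauchy sequence is bounded from some index on, and dropping the earlier terms gives
  the approximants. Lowering p to p' prepares for p' \<le> 1, where lower semicontinuity was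
  proved.\<close>

lemma completion_subset_closed_ball:
  assumes p: "0 < p" "0 < q" "0 < p'" "p' \<le> p"
    and b: "b \<in> dirichlet_completion (shift_norm \<nu> p q)"
  shows "\<exists>i. b \<in> closed_ball p' q i"
proof -
  obtain P where P: "\<And>k. P k \<in> dirichlet_polys" and lim: "\<And>n. (\<lambda>k. P k n) \<longlonglongrightarrow> b n"
    and Cauchy: "\<And>\<epsilon>. \<epsilon> > 0 \<Longrightarrow> \<exists>K. \<forall>k\<ge>K. \<forall>l\<ge>K. shift_power \<nu> p q (\<lambda>n. P k n - P l n) < ennreal \<epsilon>"
    using b p by (auto simp: mem_completion_iff)
  obtain K C where C: "0 \<le> C" "\<And>k. k \<ge> K \<Longrightarrow> shift_power \<nu> p q (P k) \<le> ennreal C"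
    by (rule shift_power_bounded[OF p(1,2) P Cauchy]) auto
  obtain i where i: "C \<le> real i" using real_arch_simple by blast
  have "shift_power \<nu> p' q (P (k + K)) \<le> ennreal (real i)" for k
    using shift_power_mono[OF P p(3,4,2), of "k + K"] C(2)[of "k + K"] ennreal_leI[OF i] by (auto intro: order_trans)
  then show ?thesis
    unfolding mem_closed_ball using P LIMSEQ_ignore_initial_segment[OF lim]
    by (intro exI[of _ i] exI[of _ "\<lambda>k. P (k + K)"]) auto
qed

text \<open>Averages of the approximants tend to Q, which is itself a polynomial, so semicontinuity
  on polynomials is enough. The constant is K (i + i), the scaling factor (1/2)^q being at most
  1.\<close>

lemma closed_ball_average:
  assumes p: "0 < p" "p \<le> 1" "0 < q" and b: "b \<in> closed_ball p q i" "b' \<in> closed_ball p q i"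
    and Q: "Q \<in> dirichlet_polys" "\<And>n. Q n = (1/2) * (b n + b' n)"
  shows "shift_power \<nu> p q Q \<le> ennreal (2 * quasi_const p q * real i)"
proof -
  obtain P where P: "\<And>k. P k \<in> dirichlet_polys" "\<And>k. shift_power \<nu> p q (P k) \<le> ennreal (real i)"
      "\<And>n. (\<lambda>k. P k n) \<longlonglongrightarrow> b n"
    using b(1) unfolding mem_closed_ball by blast
  obtain P' where P': "\<And>k. P' k \<in> dirichlet_polys" "\<And>k. shift_power \<nu> p q (P' k) \<le> ennreal (real i)"
      "\<And>n. (\<lambda>k. P' k n) \<longlonglongrightarrow> b' n"
    using b(2) unfolding mem_closed_ball by blast
  have sum: "(\<lambda>n. P k n + P' k n) \<in> dirichlet_polys" for k
    by (intro dirichlet_polys_add P P')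
  have K: "0 \<le> quasi_const p q" by (simp add: quasi_const_def)
  have "shift_power \<nu> p q (\<lambda>n. (1/2) * (P k n + P' k n)) \<le> ennreal (2 * quasi_const p q * real i)" for k
  proof -
    have "shift_power \<nu> p q (\<lambda>n. (1/2) * (P k n + P' k n)) = ennreal ((1/2) powr q) * shift_power \<nu> p q (\<lambda>n. P k n + P' k n)"
      by (subst shift_power_scale[OF sum p(1)]) (simp add: norm_divide)
    also have "\<dots> \<le> 1 * shift_power \<nu> p q (\<lambda>n. P k n + P' k n)"
      using p powr_mono2[of q "1/2" 1] by (intro mult_right_mono) (auto simp flip: ennreal_1 intro!: ennreal_leI)
    also have "\<dots> \<le> ennreal (quasi_const p q) * (shift_power \<nu> p q (P k) + shift_power \<nu> p q (P' k))"
      using shift_power_add[OF P(1) P'(1) p(1,3)] by simp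
    also have "\<dots> \<le> ennreal (quasi_const p q) * (ennreal (real i) + ennreal (real i))"
      by (intro mult_left_mono add_mono P P') auto
    also have "\<dots> = ennreal (2 * quasi_const p q * real i)"
      using K by (simp add: algebra_simps flip: ennreal_plus ennreal_mult)
    finally show ?thesis .
  qed
  then have "liminf (\<lambda>k. shift_power \<nu> p q (\<lambda>n. (1/2) * (P k n + P' k n))) \<le> liminf (\<lambda>k::nat. ennreal (2 * quasi_const p q * real i))"
    by (intro Liminf_mono always_eventually) auto
  moreover have "shift_power \<nu> p q Q \<le> liminf (\<lambda>k. shift_power \<nu> p q (\<lambda>n. (1/2) * (P k n + P' k n)))"
    using P(3) P'(3) by (intro shift_power_le_liminf p Q dirichlet_polys_scale sum) (auto simp: Q(2) intro!: tendsto_intros)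
  ultimately show ?thesis
    by (simp add: Liminf_const)
qed

end

section \<open>Necessity of the bound on square sums\<close>

context random_shift
begin

text \<open>The event may depend on N but T may not: the radius i is fixed by the unflipped series,
  and every flipped series lies in the same closed ball with the same probability. Each of the two
  events fails with probability below \<epsilon>/2.\<close>

lemma prob_random_poly_bounded:
  assumes p: "0 < p" "0 < q" "0 < p'" "p' \<le> p" "p' \<le> 1" and \<epsilon>: "0 < \<epsilon>"
    and AE: "AE \<omega> in M. randomize X a \<omega> \<in> dirichlet_completion (shift_norm \<nu> p q)"
  obtains T where "0 \<le> T" "\<And>N. \<exists>A\<in>sets M. 1 - \<epsilon> \<le> P.prob A \<and>
     (\<forall>\<omega>\<in>A. shift_power \<nu> p' q (random_poly {1..N} \<omega>) \<le> ennreal T)"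
proof -
  define E where "E i = {\<omega> \<in> space M. (\<lambda>n. a n * X n \<omega>) \<in> S.closed_ball p' q i}" for i
  define E' where "E' N i = {\<omega> \<in> space M. (\<lambda>n. a n * (if n \<le> N then X n \<omega> else - X n \<omega>)) \<in> S.closed_ball p' q i}" for N i
  note flip = P.prob_flip_signs[where a=a, OF S.closed_ball_borel a0]
  have E_sets: "E i \<in> sets M" "E' N i \<in> sets M" and E'_prob: "P.prob (E' N i) = P.prob (E i)" for N i
    unfolding E_def E'_def by (rule flip)+
  have "AE \<omega> in M. \<omega> \<in> (\<Union>i. E i)"
    using AE AE_space
  proof eventually_elim
    case (elim \<omega>)
    then show ?case
      using S.completion_subset_closed_ball[OF p(1-4) elim(1)] by (auto simp: E_def randomize_def)
  qed
  then have "P.prob (\<Union>i. E i) = 1"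
    using E_sets by (subst P.prob_eq_1) auto
  moreover have "incseq E"
    using S.closed_ball_mono by (fastforce simp: incseq_def E_def)
  ultimately have "(\<lambda>i. P.prob (E i)) \<longlonglongrightarrow> 1"
    using P.finite_Lim_measure_incseq[of E] E_sets by auto
  then have "eventually (\<lambda>i. 1 - \<epsilon> / 2 < P.prob (E i)) sequentially"
    using \<epsilon> by (intro order_tendstoD(1)) auto
  then obtain i where i: "1 - \<epsilon> / 2 < P.prob (E i)"
    by (auto simp: eventually_sequentially)
  have "\<exists>A\<in>sets M. 1 - \<epsilon> \<le> P.prob A \<and>
     (\<forall>\<omega>\<in>A. shift_power \<nu> p' q (random_poly {1..N} \<omega>) \<le> ennreal (2 * quasi_const p' q * real i))" for N
  proof (intro bexI[of _ "E i \<inter> E' N i"] conjI ballI)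
    show "E i \<inter> E' N i \<in> sets M" using E_sets by auto
    show "1 - \<epsilon> \<le> P.prob (E i \<inter> E' N i)"
      using P.prob_Int_ge[OF E_sets(1)[of i] E_sets(2)[of N i]] i E'_prob[of N i] by linarith
  next
    fix \<omega> assume "\<omega> \<in> E i \<inter> E' N i"
    then have b: "(\<lambda>n. a n * X n \<omega>) \<in> S.closed_ball p' q i"
      "(\<lambda>n. a n * (if n \<le> N then X n \<omega> else - X n \<omega>)) \<in> S.closed_ball p' q i"
      by (auto simp: E_def E'_def)
    show "shift_power \<nu> p' q (random_poly {1..N} \<omega>) \<le> ennreal (2 * quasi_const p' q * real i)"
    proof (rule S.closed_ball_average[OF p(3,5,2) b random_poly_polys])
      fix n
      show "random_poly {1..N} \<omega> n = 1/2 * (a n * X n \<omega> + a n * (if n \<le> N then X n \<omega> else - X n \<omega>))"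
        using a0 by (cases "n = 0") (auto simp: random_poly_def restrict_coeffs_def randomize_def)
    qed simp
  qed
  moreover have "0 \<le> 2 * quasi_const p' q * real i" by (simp add: quasi_const_def)
  ultimately show ?thesis using that by blast
qed

text \<open>
  For every \<open>\<sigma>\<close> and \<open>z\<close> the random polynomial is large with probability at least \<open>c\<close>, which
  persists on an event of probability at least \<open>1 - c / 2\<close>.
\<close>

lemma expectation_hardy_norm_ge:
  assumes F: "finite F" "F \<subseteq> {1..}" and p: "0 < p" "0 < q" and A: "A \<in> sets M"
    and c: "c = 1 / (4 * moment_const 4)" "1 - c / 2 \<le> P.prob A"
  shows "ennreal ((1/2) powr (q / 2) * (c / 4) powr (1 + q / p)) * ennreal ((\<Sum>n\<in>F. (norm (dshift \<sigma> a n))\<^sup>2) powr (q / 2))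
    \<le> (\<integral>\<^sup>+\<omega>. ennreal (hardy_norm p (dshift \<sigma> (random_poly F \<omega>)) powr q) * indicator A \<omega> \<partial>M)"
proof -
  interpret MT: pair_sigma_finite M torus_measure ..
  have c_pos: "0 < c" by (simp add: c(1) moment_const_def)
  define w where "w = (\<Sum>n\<in>F. (norm (dshift \<sigma> a n))\<^sup>2)"
  have w: "0 \<le> w" by (simp add: w_def sum_nonneg)
  let ?R = "\<lambda>\<omega>. dshift \<sigma> (random_poly F \<omega>)"
  have R: "?R \<omega> \<in> dirichlet_polys" for \<omega>
    by (intro dshift_dirichlet_polys random_poly_polys F)
  define B where "B \<omega> z \<longleftrightarrow> w / 2 \<le> (norm (bohr_lift (?R \<omega>) z))\<^sup>2" for \<omega> z
  define b :: "'w \<Rightarrow> (nat \<Rightarrow> complex) \<Rightarrow> real" where "b \<omega> z = (if B \<omega> z then 1 else 0)" for \<omega> z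
  have b_meas: "(\<lambda>x. b (fst x) (snd x)) \<in> borel_measurable (M \<Otimes>\<^sub>M torus_measure)"
    using measurable_random_lift[OF F, of \<sigma>] unfolding b_def B_def case_prod_beta by measurable
  \<comment> \<open>The measure of the set of points z of the torus at which the polynomial for
    \<omega> is large.\<close>
  define U where "U \<omega> = enn2real (\<integral>\<^sup>+z. ennreal (b \<omega> z) \<partial>torus_measure)" for \<omega>
  have U_le: "(\<integral>\<^sup>+z. ennreal (b \<omega> z) \<partial>torus_measure) \<le> 1" for \<omega>
  proof -
    have "(\<integral>\<^sup>+z. ennreal (b \<omega> z) \<partial>torus_measure) \<le> (\<integral>\<^sup>+z. 1 \<partial>torus_measure)"
      by (intro nn_integral_mono) (simp add: b_def)
    then show ?thesis by simp
  qed
  then have U: "ennreal (U \<omega>) = (\<integral>\<^sup>+z. ennreal (b \<omega> z) \<partial>torus_measure)" "0 \<le> U \<omega>" for \<omega>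
    unfolding U_def using le_less_trans[OF U_le[of \<omega>], of top] by auto
  have U_meas[measurable]: "U \<in> borel_measurable M"
    unfolding U_def using b_meas
    by (intro borel_measurable_enn2real torus.borel_measurable_nn_integral) (simp add: case_prod_beta)
  \<comment> \<open>For almost every z, Paley-Zygmund and A overlap in probability at least c + (1 -
    c/2) - 1 = c/2; Fubini turns this into a mean of U over A.\<close>
  have U_int: "ennreal (c / 2) \<le> (\<integral>\<^sup>+\<omega>. ennreal (U \<omega>) * indicator A \<omega> \<partial>M)"
  proof -
    have "ennreal (c / 2) = (\<integral>\<^sup>+z. ennreal (c / 2) \<partial>torus_measure)" by simp
    also have "\<dots> \<le> (\<integral>\<^sup>+z. (\<integral>\<^sup>+\<omega>. ennreal (b \<omega> z) * indicator A \<omega> \<partial>M) \<partial>torus_measure)"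
      using AE_torus_norm
    proof (intro nn_integral_mono_AE, eventually_elim)
      case (elim z)
      let ?B = "{\<omega> \<in> space M. B \<omega> z}"
      have B_eq: "?B = {\<omega> \<in> space M. (\<Sum>n\<in>F. (norm (dshift \<sigma> a n * bohr_monomial z n))\<^sup>2) / 2 \<le> (norm (\<Sum>n\<in>F. (dshift \<sigma> a n * bohr_monomial z n) * X n \<omega>))\<^sup>2}"
        using elim by (simp add: B_def bohr_lift_random_poly F w_def sum_norm_sq_unimodular)
      have "(\<lambda>\<omega>. b \<omega> z) \<in> borel_measurable M"
        using measurable_compose[OF measurable_Pair2'[of z torus_measure M] b_meas] by simp
      then have "{\<omega> \<in> space M. b \<omega> z = 1} \<in> sets M" by measurable
      also have "{\<omega> \<in> space M. b \<omega> z = 1} = ?B" by (auto simp: b_def)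
      finally have B_sets: "?B \<in> sets M" .
      have "c \<le> P.prob ?B"
        unfolding B_eq c(1) by (rule P.paley_zygmund[OF F])
      then have "c / 2 \<le> P.prob (A \<inter> ?B)"
        using P.prob_Int_ge[OF A B_sets] c(2) by linarith
      then have "ennreal (c / 2) \<le> emeasure M (A \<inter> ?B)"
        by (simp add: P.emeasure_eq_measure ennreal_leI)
      also have "\<dots> = (\<integral>\<^sup>+\<omega>. indicator (A \<inter> ?B) \<omega> \<partial>M)"
        using A B_sets by simp
      also have "\<dots> = (\<integral>\<^sup>+\<omega>. ennreal (b \<omega> z) * indicator A \<omega> \<partial>M)"
        by (intro nn_integral_cong) (auto simp: b_def indicator_def)
      finally show ?case .
    qed
    also have "\<dots> = (\<integral>\<^sup>+\<omega>. (\<integral>\<^sup>+z. ennreal (b \<omega> z) * indicator A \<omega> \<partial>torus_measure) \<partial>M)"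
      using b_meas A by (intro MT.Fubini') (simp add: case_prod_beta)
    also have "\<dots> = (\<integral>\<^sup>+\<omega>. ennreal (U \<omega>) * indicator A \<omega> \<partial>M)"
    proof (intro nn_integral_cong)
      fix \<omega> assume "\<omega> \<in> space M"
      have "(\<lambda>z. b \<omega> z) \<in> borel_measurable torus_measure"
        using measurable_compose[OF measurable_Pair1'[OF \<open>\<omega> \<in> space M\<close>] b_meas] by simp
      then show "(\<integral>\<^sup>+z. ennreal (b \<omega> z) * indicator A \<omega> \<partial>torus_measure) = ennreal (U \<omega>) * indicator A \<omega>"
        by (simp add: U nn_integral_multc)
    qed
    finally show ?thesis .
  qed
  define s where "s = q / p"
  have s: "0 < s" using p by (simp add: s_def)
  have U_powr: "ennreal ((c / 4) powr (1 + s)) \<le> (\<integral>\<^sup>+\<omega>. ennreal (U \<omega> powr s) * indicator A \<omega> \<partial>M)" (is "_ \<le> ?I")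
  proof -
    \<comment> \<open>Either U is at most c/4, or (4 U / c)^s is at least 1 and hence at least U.
      This converts the mean of U into a mean of U^s for every s > 0, whereas Jensen's inequality
      has the right direction only for s \<ge> 1.\<close>
    have pt: "U \<omega> \<le> c / 4 + (4 / c) powr s * U \<omega> powr s" for \<omega>
    proof (cases "U \<omega> \<le> c / 4")
      case True
      moreover have "0 \<le> (4 / c) powr s * U \<omega> powr s" by simp
      ultimately show ?thesis by linarith
    next
      case False
      then have "1 \<le> (4 / c) * U \<omega>" using c_pos by (simp add: field_simps)
      then have "1 \<le> ((4 / c) * U \<omega>) powr s" using s by (intro ge_one_powr_ge_zero) auto
      also have "((4 / c) * U \<omega>) powr s = (4 / c) powr s * U \<omega> powr s"
        by (rule powr_mult)
      finally have "1 \<le> (4 / c) powr s * U \<omega> powr s" .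
      moreover have "U \<omega> \<le> 1" using U_le[of \<omega>] unfolding U(1)[symmetric] by simp
      ultimately show ?thesis using c_pos by linarith
    qed
    have "ennreal (c / 2) \<le> (\<integral>\<^sup>+\<omega>. ennreal (c / 4) + ennreal ((4 / c) powr s) * (ennreal (U \<omega> powr s) * indicator A \<omega>) \<partial>M)"
      using U_int
    proof (rule order_trans[OF _ nn_integral_mono])
      fix \<omega>
      have "ennreal (U \<omega>) \<le> ennreal (c / 4) + ennreal ((4 / c) powr s) * ennreal (U \<omega> powr s)"
        using ennreal_leI[OF pt[of \<omega>]] c_pos by (simp add: ennreal_mult)
      then show "ennreal (U \<omega>) * indicator A \<omega> \<le> ennreal (c / 4) + ennreal ((4 / c) powr s) * (ennreal (U \<omega> powr s) * indicator A \<omega>)"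
        by (auto simp: indicator_def)
    qed
    also have "\<dots> = ennreal (c / 4) + ennreal ((4 / c) powr s) * ?I"
      using A by (simp add: nn_integral_add nn_integral_cmult P.emeasure_space_1)
    finally have 1: "ennreal (c / 2) \<le> ennreal (c / 4) + ennreal ((4 / c) powr s) * ?I" .
    have 2: "ennreal (c / 4) \<le> ennreal ((4 / c) powr s) * ?I"
    proof -
      have "ennreal (c / 2) = ennreal (c / 4) + ennreal (c / 4)"
        using c_pos by (simp flip: ennreal_plus)
      with 1 show ?thesis by simp
    qed
    have "ennreal ((c / 4) powr (1 + s)) = ennreal ((c / 4) powr s) * ennreal (c / 4)"
      using c_pos by (simp add: powr_add ac_simps flip: ennreal_mult)
    also have "\<dots> \<le> ennreal ((c / 4) powr s) * (ennreal ((4 / c) powr s) * ?I)"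
      by (intro mult_left_mono 2) auto
    also have "\<dots> = ennreal ((c / 4 * (4 / c)) powr s) * ?I"
      unfolding powr_mult by (simp add: ennreal_mult mult.assoc)
    also have "c / 4 * (4 / c) = 1" using c_pos by simp
    finally show ?thesis by simp
  qed
  \<comment> \<open>On a set of measure U the p-th power of the modulus is at least (w/2)^(p/2);
    integrating and raising to the power q/p gives the bound.\<close>
  have lower: "(w / 2) powr (q / 2) * U \<omega> powr s \<le> hardy_norm p (?R \<omega>) powr q" for \<omega>
  proof -
    have "ennreal ((w / 2) powr (p / 2)) * (\<integral>\<^sup>+z. ennreal (b \<omega> z) \<partial>torus_measure)
        = (\<integral>\<^sup>+z. ennreal ((w / 2) powr (p / 2)) * ennreal (b \<omega> z) \<partial>torus_measure)"
      unfolding b_def B_def by (intro nn_integral_cmult[symmetric]) measurable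
    also have "\<dots> \<le> hardy_power p (?R \<omega>)"
      unfolding hardy_power_def
    proof (intro nn_integral_mono)
      fix z
      have "(w / 2) powr (p / 2) \<le> norm (bohr_lift (?R \<omega>) z) powr p" if "B \<omega> z"
      proof -
        have "(w / 2) powr (p / 2) \<le> ((norm (bohr_lift (?R \<omega>) z))\<^sup>2) powr (p / 2)"
          using that w p unfolding B_def by (intro powr_mono2) auto
        also have "\<dots> = norm (bohr_lift (?R \<omega>) z) powr p"
          by (simp add: powr_powr flip: powr_numeral)
        finally show ?thesis .
      qed
      then show "ennreal ((w / 2) powr (p / 2)) * ennreal (b \<omega> z) \<le> ennreal (norm (bohr_lift (?R \<omega>) z) powr p)"
        by (auto simp: b_def ennreal_leI)
    qed
    finally have "ennreal ((w / 2) powr (p / 2) * U \<omega>) \<le> ennreal (enn2real (hardy_power p (?R \<omega>)))"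
      using U ennreal_enn2real_hardy_power[OF R p(1)] by (simp add: ennreal_mult)
    then have "(w / 2) powr (p / 2) * U \<omega> \<le> enn2real (hardy_power p (?R \<omega>))"
      by (simp add: ennreal_le_iff)
    then have "((w / 2) powr (p / 2) * U \<omega>) powr s \<le> enn2real (hardy_power p (?R \<omega>)) powr s"
      using U(2) s by (intro powr_mono2) auto
    then show ?thesis
      using U(2) p by (simp add: hardy_norm_powr powr_mult powr_powr s_def)
  qed
  have "ennreal ((1/2) powr (q / 2) * (c / 4) powr (1 + q / p)) * ennreal (w powr (q / 2))
      = ennreal ((w / 2) powr (q / 2)) * ennreal ((c / 4) powr (1 + s))"
    using w powr_mult[of w "1/2" "q / 2"] by (simp add: s_def ac_simps flip: ennreal_mult)
  also have "\<dots> \<le> ennreal ((w / 2) powr (q / 2)) * ?I"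
    by (intro mult_left_mono U_powr) auto
  also have "\<dots> = (\<integral>\<^sup>+\<omega>. ennreal ((w / 2) powr (q / 2)) * (ennreal (U \<omega> powr s) * indicator A \<omega>) \<partial>M)"
    using A by (intro nn_integral_cmult[symmetric]) simp
  also have "\<dots> \<le> (\<integral>\<^sup>+\<omega>. ennreal (hardy_norm p (?R \<omega>) powr q) * indicator A \<omega> \<partial>M)"
    using lower by (intro nn_integral_mono) (auto simp: indicator_def ennreal_leI simp flip: ennreal_mult)
  finally show ?thesis by (simp add: w_def)
qed

text \<open>Integrating the lower bound over \<sigma> and exchanging integrals bounds \<kappa> times
  the power of the partial sum by the mean over A of its random counterpart, which is at most T.
  Neither \<kappa> nor T depends on N.\<close>

lemma AE_completion_imp_square_space:
  assumes p: "0 < p" "0 < q"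
    and AE: "AE \<omega> in M. randomize X a \<omega> \<in> dirichlet_completion (shift_norm \<nu> p q)"
  shows "a \<in> S.square_space q"
proof -
  interpret MN: pair_sigma_finite M \<nu> ..
  define p' where "p' = min p 1"
  have p': "0 < p'" "p' \<le> p" "p' \<le> 1" using p by (auto simp: p'_def)
  define c where "c = 1 / (4 * moment_const 4)"
  have c: "0 < c" by (simp add: c_def moment_const_def)
  define \<kappa> where "\<kappa> = (1/2) powr (q / 2) * (c / 4) powr (1 + q / p')"
  have \<kappa>: "0 < \<kappa>" using c by (simp add: \<kappa>_def)
  obtain T where T: "0 \<le> T" "\<And>N. \<exists>A\<in>sets M. 1 - c / 2 \<le> P.prob A \<and>
     (\<forall>\<omega>\<in>A. shift_power \<nu> p' q (random_poly {1..N} \<omega>) \<le> ennreal T)"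
    using prob_random_poly_bounded[OF p p'(1,2,3) _ AE, of "c / 2"] c by auto
  have "shift_power \<nu> 2 q (restrict_coeffs {1..N} a) \<le> ennreal (T / \<kappa>)" for N
  proof -
    obtain A where A: "A \<in> sets M" "1 - c / 2 \<le> P.prob A"
      "\<And>\<omega>. \<omega> \<in> A \<Longrightarrow> shift_power \<nu> p' q (random_poly {1..N} \<omega>) \<le> ennreal T"
      using T(2)[of N] by blast
    have F: "finite {1..N}" "{1..N} \<subseteq> {1..}" by auto
    let ?h = "\<lambda>\<omega> \<sigma>. ennreal (hardy_norm p' (dshift \<sigma> (random_poly {1..N} \<omega>)) powr q)"
    have h_meas: "(\<lambda>x. ?h (fst x) (snd x)) \<in> borel_measurable (M \<Otimes>\<^sub>M \<nu>)"
      using measurable_hardy_norm_random(1)[OF F, of p'] by (simp add: case_prod_beta)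
    have "ennreal \<kappa> * shift_power \<nu> 2 q (restrict_coeffs {1..N} a)
        = (\<integral>\<^sup>+\<sigma>. ennreal \<kappa> * ennreal ((\<Sum>n\<in>{1..N}. (norm (dshift \<sigma> a n))\<^sup>2) powr (q / 2)) \<partial>\<nu>)"
      by (subst shift_power_2_restrict) (auto intro!: nn_integral_cmult[symmetric])
    also have "\<dots> \<le> (\<integral>\<^sup>+\<sigma>. \<integral>\<^sup>+\<omega>. ?h \<omega> \<sigma> * indicator A \<omega> \<partial>M \<partial>\<nu>)"
      unfolding \<kappa>_def by (intro nn_integral_mono expectation_hardy_norm_ge F p'(1) p(2) A c_def)
    also have "\<dots> = (\<integral>\<^sup>+\<omega>. \<integral>\<^sup>+\<sigma>. ?h \<omega> \<sigma> * indicator A \<omega> \<partial>\<nu> \<partial>M)"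
      using h_meas A(1) by (intro MN.Fubini') (simp add: case_prod_beta)
    also have "\<dots> = (\<integral>\<^sup>+\<omega>. shift_power \<nu> p' q (random_poly {1..N} \<omega>) * indicator A \<omega> \<partial>M)"
      unfolding shift_power_def using S.measurable_hardy_norm_dshift[OF random_poly_polys[OF F(1)]]
      by (intro nn_integral_cong nn_integral_multc) simp
    also have "\<dots> \<le> (\<integral>\<^sup>+\<omega>. ennreal T \<partial>M)"
      using A(3) by (intro nn_integral_mono) (auto simp: indicator_def)
    also have "\<dots> = ennreal T" by (simp add: P.emeasure_space_1)
    finally have le: "ennreal \<kappa> * shift_power \<nu> 2 q (restrict_coeffs {1..N} a) \<le> ennreal T" .
    have "shift_power \<nu> 2 q (restrict_coeffs {1..N} a) = ennreal (1 / \<kappa>) * (ennreal \<kappa> * shift_power \<nu> 2 q (restrict_coeffs {1..N} a))"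
      using \<kappa> by (simp flip: ennreal_mult mult.assoc)
    also have "\<dots> \<le> ennreal (1 / \<kappa>) * ennreal T"
      by (intro mult_left_mono le) auto
    finally show ?thesis using \<kappa> T(1) by (simp flip: ennreal_mult)
  qed
  then show ?thesis
    using a0 by (auto simp: S.square_space_def)
qed

end

theorem symbol_space_completion:
  assumes "random_coeffs M X" "shift_measure \<nu>" "0 < p" "0 < q"
  shows "symbol_space M X (dirichlet_completion (shift_norm \<nu> p q)) = dirichlet_completion (shift_norm \<nu> 2 q)"
proof (intro equalityI subsetI)
  fix a assume a: "a \<in> symbol_space M X (dirichlet_completion (shift_norm \<nu> p q))"
  then have "a 0 = 0" by (simp add: symbol_space_def dirichlet_series_def)
  then interpret random_shift M X \<nu> a
    using assms by (simp add: random_shift_def random_shift_axioms_def)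
  show "a \<in> dirichlet_completion (shift_norm \<nu> 2 q)"
    using AE_completion_imp_square_space[OF assms(3,4)] a
    by (simp add: S.completion_2_eq[OF assms(4)] symbol_space_def)
next
  fix a assume a: "a \<in> dirichlet_completion (shift_norm \<nu> 2 q)"
  then have ds: "a \<in> dirichlet_series" by (simp add: dirichlet_completion_def)
  then have "a 0 = 0" by (simp add: dirichlet_series_def)
  then interpret random_shift M X \<nu> a
    using assms by (simp add: random_shift_def random_shift_axioms_def)
  show "a \<in> symbol_space M X (dirichlet_completion (shift_norm \<nu> p q))"
    using square_space_imp_AE_completion[OF _ assms(3,4)] a ds
    by (simp add: S.completion_2_eq[OF assms(4)] symbol_space_def)
qed

section \<open>Standard random sequences\<close>

lemma shift_measure_return: "shift_measure (return borel 0)"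
proof -
  interpret prob_space "return borel (0::real)" by (rule prob_space_return) simp
  show ?thesis
    by unfold_locales (auto simp: AE_return emeasure_return)
qed

lemma shift_measure_mu:
  assumes \<alpha>: "\<alpha> > -1"
  shows "shift_measure (mu_measure \<alpha>)"
proof -
  define C where "C = 2 powr (\<alpha> + 1) / Gamma (\<alpha> + 1)"
  have C: "0 < C" using \<alpha> by (simp add: C_def Gamma_real_pos)
  define d where "d \<sigma> = ennreal (indicator {0<..} \<sigma> * (C * \<sigma> powr \<alpha> * exp (- 2 * \<sigma>)))" for \<sigma> :: real
  have d[measurable]: "d \<in> borel_measurable borel" unfolding d_def by measurable
  have mu: "mu_measure \<alpha> = density lborel d"
    unfolding mu_measure_def d_def C_def ..
  have fin: "emeasure (mu_measure \<alpha>) UNIV < \<infinity>"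
  proof -
    have "emeasure (mu_measure \<alpha>) UNIV = (\<integral>\<^sup>+\<sigma>. d \<sigma> \<partial>lborel)"
      unfolding mu by (subst emeasure_density) auto
    \<comment> \<open>Only finiteness is wanted, so exp(-2 \<sigma>) is weakened to exp(-\<sigma>):
      Euler's integral then appears without a change of variables.\<close>
    also have "\<dots> \<le> (\<integral>\<^sup>+\<sigma>. ennreal C * ennreal (indicator {0..} \<sigma> * \<sigma> powr (\<alpha> + 1 - 1) / exp \<sigma>) \<partial>lborel)"
    proof (intro nn_integral_mono)
      fix \<sigma> :: real
      have "C * \<sigma> powr \<alpha> * exp (- 2 * \<sigma>) \<le> C * (\<sigma> powr \<alpha> / exp \<sigma>)" if "0 < \<sigma>"
      proof -
        have "exp (- 2 * \<sigma>) \<le> exp (- \<sigma>)" using that by simp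
        then have "\<sigma> powr \<alpha> * exp (- 2 * \<sigma>) \<le> \<sigma> powr \<alpha> * exp (- \<sigma>)" by (intro mult_left_mono) auto
        then show ?thesis using C by (simp add: exp_minus field_simps)
      qed
      then show "d \<sigma> \<le> ennreal C * ennreal (indicator {0..} \<sigma> * \<sigma> powr (\<alpha> + 1 - 1) / exp \<sigma>)"
        using C by (auto simp: d_def indicator_def ennreal_leI simp flip: ennreal_mult)
    qed
    also have "\<dots> = ennreal C * (\<integral>\<^sup>+\<sigma>. ennreal (indicator {0..} \<sigma> * \<sigma> powr (\<alpha> + 1 - 1) / exp \<sigma>) \<partial>lborel)"
      by (rule nn_integral_cmult) measurable
    also have "\<dots> = ennreal C * ennreal (Gamma (\<alpha> + 1))"
      using Gamma_conv_nn_integral_real[of "\<alpha> + 1"] \<alpha> by simp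
    also have "\<dots> < \<infinity>" by (simp add: ennreal_mult_less_top)
    finally show ?thesis .
  qed
  show ?thesis
  proof (intro shift_measure.intro finite_measureI shift_measure_axioms.intro)
    show "emeasure (mu_measure \<alpha>) (space (mu_measure \<alpha>)) \<noteq> \<infinity>"
      using fin by (simp add: mu)
    show "sets (mu_measure \<alpha>) = sets borel" by (simp add: mu)
    show "AE \<sigma> in mu_measure \<alpha>. 0 \<le> \<sigma>"
      unfolding mu by (subst AE_density) (auto simp: d_def indicator_def intro!: AE_I2)
  next
    fix \<epsilon> :: real assume \<epsilon>: "\<epsilon> > 0"
    show "emeasure (mu_measure \<alpha>) {..\<epsilon>} \<noteq> 0"
    proof
      assume "emeasure (mu_measure \<alpha>) {..\<epsilon>} = 0"
      then have "(\<integral>\<^sup>+\<sigma>. d \<sigma> * indicator {..\<epsilon>} \<sigma> \<partial>lborel) = 0"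
        unfolding mu by (subst (asm) emeasure_density) auto
      then have "AE \<sigma> in lborel. d \<sigma> * indicator {..\<epsilon>} \<sigma> = 0"
        by (subst (asm) nn_integral_0_iff_AE) auto
      then have "AE \<sigma> in lborel. \<sigma> \<notin> {0<..\<epsilon>}"
        by eventually_elim (use C in \<open>auto simp: d_def indicator_def split: if_splits\<close>)
      then have "emeasure lborel {0<..\<epsilon>} = 0"
        by (subst (asm) AE_iff_measurable[of "{0<..\<epsilon>}"]) auto
      then show False using \<epsilon> by simp
    qed
  qed
qed

text \<open>The two norms are compared on polynomials only. This is enough, because a completion
  evaluates its norm only at differences of polynomials.\<close>

lemma dirichlet_completion_hardy:
  "dirichlet_completion (hardy_norm p) = dirichlet_completion (shift_norm (return borel 0) p 1)"
proof -
  interpret shift_measure "return borel (0::real)" by (rule shift_measure_return)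
  have eq: "shift_norm (return borel 0) p 1 a = hardy_norm p a" if a: "a \<in> dirichlet_polys" for a
  proof -
    \<comment> \<open>Shifting by 0 erases the coefficient 0, since \<open>0 powr 0 = 0\<close>; for
      a polynomial that coefficient is 0 anyway.\<close>
    have "dshift 0 a = a"
      using a by (auto simp: dshift_def dirichlet_polys_def fun_eq_iff)
    moreover have "(\<lambda>\<sigma>. hardy_norm p (dshift \<sigma> a)) \<in> borel_measurable borel"
      using measurable_hardy_norm_dshift[OF a, of p] by (simp add: measurable_cong_sets[OF sets_shift refl])
    ultimately show ?thesis
      unfolding shift_norm_def by (subst integral_return) (auto simp: hardy_norm_nonneg)
  qed
  then have "(\<forall>k. P k \<in> dirichlet_polys) \<and> R (\<lambda>k l. hardy_norm p (\<lambda>n. P k n - P l n))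
      \<longleftrightarrow> (\<forall>k. P k \<in> dirichlet_polys) \<and> R (\<lambda>k l. shift_norm (return borel 0) p 1 (\<lambda>n. P k n - P l n))"
    for P :: "nat \<Rightarrow> nat \<Rightarrow> complex" and R :: "(nat \<Rightarrow> nat \<Rightarrow> real) \<Rightarrow> bool"
    using dirichlet_polys_diff(1)[of "P _" "P _"] by auto
  from this[where R="\<lambda>d. (\<forall>\<epsilon>>0. \<exists>K. \<forall>k\<ge>K. \<forall>l\<ge>K. d k l < \<epsilon>) \<and> _"] show ?thesis
    unfolding dirichlet_completion_def by auto
qed

lemma mixed_norm_eq_shift_norm: "mixed_norm p q \<alpha> = shift_norm (mu_measure \<alpha>) p q"
  by (intro ext) (simp add: mixed_norm_def shift_norm_def)

text \<open>Re (c X n) has mean zero by symmetry and lies in an interval of length 2 |c|, so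
  Hoeffding's lemma gives exp((2 |c|)^2 / 8), which is the required exp(|c|^2 / 2).\<close>

lemma (in prob_space) random_coeffs_unimodularI:
  assumes indep: "indep_vars (\<lambda>_. borel) X {1..}"
    and unimodular: "\<And>n. 1 \<le> n \<Longrightarrow> AE \<omega> in M. norm (X n \<omega>) = 1"
    and symmetric: "\<And>n. 1 \<le> n \<Longrightarrow> distr M borel (\<lambda>\<omega>. - X n \<omega>) = distr M borel (X n)"
  shows "random_coeffs M X"
proof (intro random_coeffs.intro random_coeffs_axioms.intro prob_space_axioms assms)
  fix n :: nat assume n: "1 \<le> n"
  have [measurable]: "X n \<in> borel_measurable M"
    using indep n by (auto simp: indep_vars_def)
  have "(\<integral>\<^sup>+\<omega>. ennreal ((norm (X n \<omega>))\<^sup>2) \<partial>M) = (\<integral>\<^sup>+\<omega>. 1 \<partial>M)"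
    using unimodular[OF n] by (intro nn_integral_cong_AE) (auto elim!: eventually_mono)
  then show "(\<integral>\<^sup>+\<omega>. ennreal ((norm (X n \<omega>))\<^sup>2) \<partial>M) = 1"
    by (simp add: emeasure_space_1)
  fix c
  interpret bounded: interval_bounded_random_variable M "\<lambda>\<omega>. Re (c * X n \<omega>)" "- norm c" "norm c"
  proof
    show "AE \<omega> in M. Re (c * X n \<omega>) \<in> {- norm c..norm c}"
      using unimodular[OF n]
    proof eventually_elim
      case (elim \<omega>)
      then show ?case
        using abs_Re_le_cmod[of "c * X n \<omega>"] by (simp add: norm_mult abs_le_iff)
    qed
  qed measurable
  have "(LINT \<omega>|M. Re (c * X n \<omega>)) = (LINT x|distr M borel (X n). Re (c * x))"
    by (subst integral_distr) auto
  also have "\<dots> = (LINT x|distr M borel (\<lambda>\<omega>. - X n \<omega>). Re (c * x))"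
    by (simp add: symmetric[OF n])
  also have "\<dots> = - (LINT \<omega>|M. Re (c * X n \<omega>))"
    by (subst integral_distr) (auto simp flip: Bochner_Integration.integral_minus)
  finally have "(LINT \<omega>|M. Re (c * X n \<omega>)) = 0" by simp
  from bounded.Hoeffdings_lemma_nn_integral_0[of 1, OF _ this]
  show "(\<integral>\<^sup>+\<omega>. ennreal (exp (Re (c * X n \<omega>))) \<partial>M) \<le> ennreal (exp ((norm c)\<^sup>2 / 2))"
    by (simp add: power2_eq_square)
qed

lemma (in prob_space) bernoulli_rv_AE:
  assumes [measurable]: "Y \<in> borel_measurable M" and Y: "bernoulli_rv M Y"
  shows "AE \<omega> in M. Y \<omega> = 1 \<or> Y \<omega> = -1"
proof -
  have "prob ({\<omega> \<in> space M. Y \<omega> = 1} \<union> {\<omega> \<in> space M. Y \<omega> = -1})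
      = prob {\<omega> \<in> space M. Y \<omega> = 1} + prob {\<omega> \<in> space M. Y \<omega> = -1}"
    by (rule finite_measure_Union) auto
  also have "\<dots> = 1" using Y by (simp add: bernoulli_rv_def)
  finally have "AE \<omega> in M. \<omega> \<in> {\<omega> \<in> space M. Y \<omega> = 1} \<union> {\<omega> \<in> space M. Y \<omega> = -1}"
    by (subst (asm) prob_eq_1) auto
  then show ?thesis by (auto elim!: eventually_mono)
qed

lemma (in prob_space) emeasure_distr_bernoulli:
  assumes [measurable]: "Y \<in> borel_measurable M" "A \<in> sets borel" and Y: "bernoulli_rv M Y"
  shows "emeasure (distr M borel Y) A = indicator A 1 * ennreal (1/2) + indicator A (-1) * ennreal (1/2)"
proof -
  have half: "emeasure M {\<omega> \<in> space M. Y \<omega> = 1} = ennreal (1/2)" "emeasure M {\<omega> \<in> space M. Y \<omega> = -1} = ennreal (1/2)"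
    using Y by (simp_all only: emeasure_eq_measure bernoulli_rv_def)
  have "emeasure (distr M borel Y) A = (\<integral>\<^sup>+\<omega>. indicator A (Y \<omega>) \<partial>M)"
    by (subst nn_integral_distr[symmetric, where f="indicator A" and M'=borel]) auto
  also have "\<dots> = (\<integral>\<^sup>+\<omega>. indicator A 1 * indicator {\<omega> \<in> space M. Y \<omega> = 1} \<omega> + indicator A (-1) * indicator {\<omega> \<in> space M. Y \<omega> = -1} \<omega> \<partial>M)"
    using bernoulli_rv_AE[OF assms(1) Y] AE_space
    by (intro nn_integral_cong_AE, eventually_elim) (auto simp: indicator_def)
  also have "\<dots> = indicator A 1 * ennreal (1/2) + indicator A (-1) * ennreal (1/2)"
    by (simp add: nn_integral_add nn_integral_cmult half)
  finally show ?thesis .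
qed

lemma (in prob_space) bernoulli_rv_uminus: "bernoulli_rv M Y \<Longrightarrow> bernoulli_rv M (\<lambda>\<omega>. - Y \<omega>)"
  by (auto simp: bernoulli_rv_def minus_equation_iff[of _ 1] eq_commute[of "- 1"] neg_equal_iff_equal)

text \<open>Completing the square: the integrand is exp(t^2 / 2) times the normal density with mean
  t.\<close>

lemma nn_integral_std_normal_exp:
  "(\<integral>\<^sup>+x. ennreal (std_normal_density x) * ennreal (exp (t * x)) \<partial>lborel) = ennreal (exp (t\<^sup>2 / 2))"
proof -
  have "std_normal_density x * exp (t * x) = exp (t\<^sup>2 / 2) * normal_density t 1 x" for x
    by (simp add: std_normal_density_def normal_density_def field_simps power2_eq_square flip: exp_add)
  then have "(\<integral>\<^sup>+x. ennreal (std_normal_density x) * ennreal (exp (t * x)) \<partial>lborel)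
      = (\<integral>\<^sup>+x. ennreal (exp (t\<^sup>2 / 2)) * ennreal (normal_density t 1 x) \<partial>lborel)"
    by (simp flip: ennreal_mult)
  also have "\<dots> = ennreal (exp (t\<^sup>2 / 2)) * (\<integral>\<^sup>+x. ennreal (normal_density t 1 x) \<partial>lborel)"
    by (rule nn_integral_cmult) measurable
  also have "(\<integral>\<^sup>+x. ennreal (normal_density t 1 x) \<partial>lborel) = 1"
    by (simp add: nn_integral_eq_integral)
  finally show ?thesis by simp
qed

lemma (in prob_space) gaussian_rv_nn_integral:
  assumes [measurable]: "Y \<in> borel_measurable M" "f \<in> borel_measurable borel" and Y: "gaussian_rv M Y"
  shows "(\<integral>\<^sup>+\<omega>. f (Y \<omega>) \<partial>M) = (\<integral>\<^sup>+x. ennreal (std_normal_density x) * f (of_real x) \<partial>lborel)"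
proof -
  have "(\<integral>\<^sup>+\<omega>. f (Y \<omega>) \<partial>M) = (\<integral>\<^sup>+y. f y \<partial>distr M borel Y)"
    by (subst nn_integral_distr) auto
  also have "\<dots> = (\<integral>\<^sup>+x. f (of_real x) \<partial>density lborel (\<lambda>x. ennreal (std_normal_density x)))"
    using Y unfolding gaussian_rv_def by (simp add: nn_integral_distr)
  also have "\<dots> = (\<integral>\<^sup>+x. ennreal (std_normal_density x) * f (of_real x) \<partial>lborel)"
    by (subst nn_integral_density) auto
  finally show ?thesis .
qed

lemma (in prob_space) distr_gaussian_uminus:
  assumes [measurable]: "Y \<in> borel_measurable M" and Y: "gaussian_rv M Y"
  shows "distr M borel (\<lambda>\<omega>. - Y \<omega>) = distr M borel Y"
proof (rule measure_eqI)
  fix A assume "A \<in> sets (distr M borel (\<lambda>\<omega>. - Y \<omega>))"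
  then have [measurable]: "A \<in> sets borel" by simp
  have "emeasure (distr M borel (\<lambda>\<omega>. - Y \<omega>)) A = (\<integral>\<^sup>+\<omega>. indicator A (- Y \<omega>) \<partial>M)"
    by (subst nn_integral_distr[symmetric, where f="indicator A" and M'=borel]) auto
  also have "\<dots> = (\<integral>\<^sup>+x. ennreal (std_normal_density x) * indicator A (- of_real x) \<partial>lborel)"
    by (rule gaussian_rv_nn_integral[OF assms(1) _ Y, where f="\<lambda>y. indicator A (- y)"]) measurable
  also have "\<dots> = (\<integral>\<^sup>+x. ennreal (std_normal_density x) * indicator A (of_real x) \<partial>lborel)"
    by (subst nn_integral_real_affine[where c="-1" and t=0]) (auto simp: std_normal_density_def)
  also have "\<dots> = (\<integral>\<^sup>+\<omega>. indicator A (Y \<omega>) \<partial>M)"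
    by (rule gaussian_rv_nn_integral[OF assms(1) _ Y, symmetric]) measurable
  also have "\<dots> = emeasure (distr M borel Y) A"
    by (subst nn_integral_distr[symmetric, where f="indicator A" and M'=borel]) auto
  finally show "emeasure (distr M borel (\<lambda>\<omega>. - Y \<omega>)) A = emeasure (distr M borel Y) A" .
qed simp

lemma standard_random_sequence_imp_random_coeffs:
  assumes "standard_random_sequence M X"
  shows "random_coeffs M X"
proof -
  interpret prob_space M using assms by (simp add: standard_random_sequence_def)
  have indep: "indep_vars (\<lambda>_. borel) X {1..}"
    using assms by (simp add: standard_random_sequence_def)
  have X[measurable]: "X n \<in> borel_measurable M" if "1 \<le> n" for n
    using indep that by (auto simp: indep_vars_def)
  consider "\<forall>n\<ge>1. bernoulli_rv M (X n)" | "\<forall>n\<ge>1. steinhaus_rv M (X n)" | "\<forall>n\<ge>1. gaussian_rv M (X n)"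
    using assms unfolding standard_random_sequence_def by blast
  then show ?thesis
  proof cases
    case 1
    show ?thesis
    proof (rule random_coeffs_unimodularI[OF indep])
      fix n :: nat assume n: "1 \<le> n"
      show "AE \<omega> in M. norm (X n \<omega>) = 1"
        using bernoulli_rv_AE[OF X[OF n]] 1 n by (auto elim!: eventually_mono)
      show "distr M borel (\<lambda>\<omega>. - X n \<omega>) = distr M borel (X n)"
        using emeasure_distr_bernoulli[OF X[OF n]] emeasure_distr_bernoulli[OF borel_measurable_uminus[OF X[OF n]]]
          bernoulli_rv_uminus 1 n
        by (intro measure_eqI) auto
    qed
  next
    case 2
    show ?thesis
    proof (rule random_coeffs_unimodularI[OF indep])
      fix n :: nat assume n: "1 \<le> n"
      then have law: "distr M borel (X n) = circle_measure" and [measurable]: "X n \<in> borel_measurable M"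
        using 2 X by (auto simp: steinhaus_rv_def)
      have "AE z in distr M borel (X n). norm z = 1"
        unfolding law by (rule AE_circle_norm)
      then show "AE \<omega> in M. norm (X n \<omega>) = 1"
        by (subst (asm) AE_distr_iff) auto
      \<comment> \<open>Negation is the rotation of the circle by -1, so rotation invariance gives
        the symmetry.\<close>
      have "distr M borel (\<lambda>\<omega>. - X n \<omega>) = distr (distr M borel (X n)) borel (\<lambda>z. - z)"
        by (subst distr_distr) (auto simp: o_def)
      also have "\<dots> = distr circle_measure circle_measure (\<lambda>z. -1 * z)"
        unfolding law by (intro distr_cong) auto
      also have "\<dots> = circle_measure"
        by (rule distr_circle_rotate) simp
      finally show "distr M borel (\<lambda>\<omega>. - X n \<omega>) = distr M borel (X n)"
        by (simp add: law)
    qed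
  next
    case 3
    show ?thesis
    proof (intro random_coeffs.intro random_coeffs_axioms.intro prob_space_axioms indep)
      fix n :: nat assume n: "1 \<le> n"
      note X_n = X[OF n]
      have Y: "gaussian_rv M (X n)" using 3 n by blast
      show "distr M borel (\<lambda>\<omega>. - X n \<omega>) = distr M borel (X n)"
        by (rule distr_gaussian_uminus[OF X_n Y])
      have "(\<integral>\<^sup>+\<omega>. ennreal ((norm (X n \<omega>))\<^sup>2) \<partial>M) = (\<integral>\<^sup>+x. ennreal (std_normal_density x) * ennreal ((norm (complex_of_real x))\<^sup>2) \<partial>lborel)"
        by (rule gaussian_rv_nn_integral[OF X_n _ Y]) measurable
      also have "\<dots> = (\<integral>\<^sup>+x. ennreal (std_normal_density x * x ^ (2 * 1)) \<partial>lborel)"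
        by (simp flip: ennreal_mult)
      also have "\<dots> = ennreal (fact (2 * 1) / (2 ^ 1 * fact 1))"
        using std_normal_moment_even[of 1] by (intro nn_integral_eq_integral[THEN trans]) (auto simp: has_bochner_integral_iff)
      finally show "(\<integral>\<^sup>+\<omega>. ennreal ((norm (X n \<omega>))\<^sup>2) \<partial>M) = 1"
        by simp
      fix c
      have "(\<integral>\<^sup>+\<omega>. ennreal (exp (Re (c * X n \<omega>))) \<partial>M) = (\<integral>\<^sup>+x. ennreal (std_normal_density x) * ennreal (exp (Re (c * complex_of_real x))) \<partial>lborel)"
        by (rule gaussian_rv_nn_integral[OF X_n _ Y]) measurable
      \<comment> \<open>The Gaussian variables are real, so only the real part of c enters the
        exponent.\<close>
      also have "\<dots> = ennreal (exp ((Re c)\<^sup>2 / 2))"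
        using nn_integral_std_normal_exp[of "Re c"] by simp
      also have "\<dots> \<le> ennreal (exp ((norm c)\<^sup>2 / 2))"
        using abs_Re_le_cmod[of c] by (simp add: ennreal_leI abs_le_square_iff[symmetric])
      finally show "(\<integral>\<^sup>+\<omega>. ennreal (exp (Re (c * X n \<omega>))) \<partial>M) \<le> ennreal (exp ((norm c)\<^sup>2 / 2))" .
    qed
  qed
qed

theorem corollary3p3:
  fixes p \<alpha> :: real and q :: ereal
    and M :: "'w measure" and X :: "nat \<Rightarrow> 'w \<Rightarrow> complex"
  assumes "0 < p" and "0 < q" and "q \<le> \<infinity>" and "\<alpha> > -1"
    and "standard_random_sequence M X"
  shows "symbol_space M X (mixed_space p q \<alpha>) = mixed_space 2 q \<alpha> \<and>
         symbol_space M X (hardy_space p) = hardy_space 2 \<and>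
         symbol_space M X (bergman_space p \<alpha>) = mixed_space 2 (ereal p) \<alpha>"
proof -
  note X = standard_random_sequence_imp_random_coeffs[OF assms(5)]
  have hardy: "symbol_space M X (hardy_space p) = hardy_space 2"
    unfolding hardy_space_def dirichlet_completion_hardy
    by (rule symbol_space_completion[OF X shift_measure_return assms(1) zero_less_one])
  have mixed: "symbol_space M X (mixed_space p (ereal r) \<alpha>) = mixed_space 2 (ereal r) \<alpha>" if "0 < r" for r
    using symbol_space_completion[OF X shift_measure_mu[OF assms(4)] assms(1) that]
    by (simp add: mixed_space_def mixed_norm_eq_shift_norm)
  have "symbol_space M X (mixed_space p q \<alpha>) = mixed_space 2 q \<alpha>"
  proof (cases q)
    case (real r)
    then show ?thesis using mixed[of r] assms(2) by simp
  next
    case PInf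
    then show ?thesis using hardy by (simp add: mixed_space_def)
  qed (use assms(2) in simp)
  with hardy mixed[OF assms(1)] show ?thesis
    by (simp add: bergman_space_def)
qed

end
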